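(* For any integer $m\ge 2$ and $n=2m+2$ there exists an elliptic symbol $Q$ of order $2m$ on $\mathbb{R}^n$ such that the fundamental solution $K_{L_Q}$ of the associated operator $L_Q$ is sign changing for $|x-y|\to 0$.
   Context: An elliptic symbol of order $2m$ on $\mathbb{R}^n$ is a real $2m$-homogeneous polynomial $Q(\xi)=\sum_{i_1,\dots,i_{2m}=1}^n A_{i_1,\dots,i_{2m}}\xi_{i_1}\cdots\xi_{i_{2m}}$ for which there is $\lambda>0$ with $Q(\xi)\ge\lambda|\xi|^{2m}$ for all $\xi\in\mathbb{R}^n$. The associated operator is $L_Q=(-1)^m Q\left(\frac{\partial}{\partial x_1},\dots,\frac{\partial}{\partial x_n}\right)$. For $L=L_Q$ and even $n>2m$, $K_L$ denotes John's fundamental solution $$K_L(x,y)=-\frac{1}{(2\pi)^{n}}(-\Delta_y)^{\frac{n-2m}{2}}\int_{|\xi|=1}\frac{\log|(x-y)\cdot\xi|}{Q(\xi)}\,d\mathcal{H}^{n-1}(\xi),\qquad x\ne y,$$ which satisfies $\int_{\mathbb{R}^n}K_L(x,y)L\psi(y)\,dy=\psi(x)$ for all $\psi\in C_0^\infty(\mathbb{R}^n)$. $\mathcal{H}^k$ is the $k$-dimensional Hausdorff measure. "$K_L$ is sign changing for $|x-y|\to0$" means that for every $r>0$ there are points with $0<|x-y|<r$ where $K_L(x,y)>0$ and points with $0<|x-y|<r$ where $K_L(x,y)<0$. *)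

theory Defs
  imports "HOL-Analysis.Analysis"
begin

section \<open>Hausdorff measure\<close>

text \<open>The normalisation makes the \<open>n\<close>-dimensional measure on \<open>n\<close>-space agree with Lebesgue measure.
  The empty set is treated separately because \<open>0 ^ 0 = 1\<close>.\<close>

definition hausdorff_gauge :: "nat \<Rightarrow> 'a::metric_space set \<Rightarrow> ennreal" where
  "hausdorff_gauge k S =
     (if S = {} then 0 else ennreal (unit_ball_vol (real k) * (diameter S / 2) ^ k))"

text \<open>Boundedness is required explicitly since \<^const>\<open>diameter\<close> is unspecified on unbounded sets.\<close>

definition hausdorff_covers :: "real \<Rightarrow> 'a::metric_space set \<Rightarrow> (nat \<Rightarrow> 'a set) set" where
  "hausdorff_covers \<delta> A =
     {C. A \<subseteq> (\<Union>i. C i) \<and> (\<forall>i. bounded (C i) \<and> diameter (C i) \<le> \<delta>)}"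

definition hausdorff_premeasure :: "nat \<Rightarrow> real \<Rightarrow> 'a::metric_space set \<Rightarrow> ennreal" where
  "hausdorff_premeasure k \<delta> A = (INF C\<in>hausdorff_covers \<delta> A. \<Sum>i. hausdorff_gauge k (C i))"

definition hausdorff_outer :: "nat \<Rightarrow> 'a::metric_space set \<Rightarrow> ennreal" where
  "hausdorff_outer k A = (SUP \<delta>\<in>{0<..}. hausdorff_premeasure k \<delta> A)"

definition hausdorff_measure :: "nat \<Rightarrow> 'a::metric_space measure" where
  "hausdorff_measure k = measure_of UNIV (sets borel) (hausdorff_outer k)"

text \<open>\<^const>\<open>measure_of\<close> silently yields the zero measure when the given set function is not countably
  additive. The rest of this section shows that this does not happen here, by Caratheodory's
  criterion for metric outer measures.\<close>

lemma hausdorff_gauge_empty [simp]: "hausdorff_gauge k {} = 0"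
  by (simp add: hausdorff_gauge_def)

lemma hausdorff_premeasure_le:
  "C \<in> hausdorff_covers \<delta> A \<Longrightarrow> hausdorff_premeasure k \<delta> A \<le> (\<Sum>i. hausdorff_gauge k (C i))"
  unfolding hausdorff_premeasure_def by (rule INF_lower)

lemma hausdorff_premeasure_mono:
  assumes "A \<subseteq> B" "\<epsilon> \<le> \<delta>"
  shows "hausdorff_premeasure k \<delta> A \<le> hausdorff_premeasure k \<epsilon> B"
proof -
  have "hausdorff_covers \<epsilon> B \<subseteq> hausdorff_covers \<delta> A"
    using assms by (auto simp: hausdorff_covers_def intro: order_trans)
  then show ?thesis
    unfolding hausdorff_premeasure_def by (rule INF_superset_mono) simp
qed

lemma hausdorff_outer_mono: "A \<subseteq> B \<Longrightarrow> hausdorff_outer k A \<le> hausdorff_outer k B"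
  unfolding hausdorff_outer_def by (rule SUP_mono) (auto intro: hausdorff_premeasure_mono)

lemma hausdorff_premeasure_le_outer:
  "\<delta> > 0 \<Longrightarrow> hausdorff_premeasure k \<delta> A \<le> hausdorff_outer k A"
  unfolding hausdorff_outer_def by (intro SUP_upper) auto

lemma hausdorff_outer_empty [simp]: "hausdorff_outer k ({} :: 'a::metric_space set) = 0"
proof -
  have "hausdorff_premeasure k \<delta> ({} :: 'a set) \<le> 0" if "\<delta> > 0" for \<delta>
    using hausdorff_premeasure_le[of "\<lambda>_. {}" \<delta> "{} :: 'a set" k] that
    by (simp add: hausdorff_covers_def)
  then show ?thesis
    unfolding hausdorff_outer_def by (intro antisym SUP_least) auto
qed

lemma hausdorff_premeasure_UN:
  fixes A :: "nat \<Rightarrow> 'a::metric_space set"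
  shows "hausdorff_premeasure k \<delta> (\<Union>i. A i) \<le> (\<Sum>i. hausdorff_premeasure k \<delta> (A i))"
proof (rule ennreal_le_epsilon)
  fix e :: real
  assume fin: "(\<Sum>i. hausdorff_premeasure k \<delta> (A i)) < top" and "0 < e"
  have "\<exists>C \<in> hausdorff_covers \<delta> (A n). (\<Sum>i. hausdorff_gauge k (C i)) <
          hausdorff_premeasure k \<delta> (A n) + ennreal (e * (1/2)^Suc n)" for n
  proof -
    have "hausdorff_premeasure k \<delta> (A n) \<noteq> top"
      using fin by (metis ennreal_suminf_lessD less_top)
    then have "hausdorff_premeasure k \<delta> (A n) <
                 hausdorff_premeasure k \<delta> (A n) + ennreal (e * (1/2)^Suc n)"
      using \<open>0 < e\<close> using ennreal_add_left_cancel_less[of "hausdorff_premeasure k \<delta> (A n)" 0]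
      by simp
    then show ?thesis
      unfolding hausdorff_premeasure_def[of k \<delta> "A n"] INF_less_iff by blast
  qed
  then obtain C where C: "\<And>n. C n \<in> hausdorff_covers \<delta> (A n)"
    and le: "\<And>n. (\<Sum>i. hausdorff_gauge k (C n i)) <
               hausdorff_premeasure k \<delta> (A n) + ennreal (e * (1/2)^Suc n)"
    by metis
  define D where "D = (\<lambda>p. C (fst (prod_decode p)) (snd (prod_decode p)))"
  have D_eq: "D (prod_encode (n, i)) = C n i" for n i
    by (simp add: D_def)
  have "D \<in> hausdorff_covers \<delta> (\<Union>i. A i)"
    unfolding hausdorff_covers_def
  proof (intro CollectI conjI allI subsetI)
    fix x assume "x \<in> (\<Union>i. A i)"
    then obtain n where "x \<in> A n" by blast
    then obtain i where "x \<in> C n i" using C[of n] by (auto simp: hausdorff_covers_def)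
    then show "x \<in> (\<Union>i. D i)" by (metis D_eq UN_I UNIV_I)
  qed (use C in \<open>auto simp: hausdorff_covers_def D_def\<close>)
  then have "hausdorff_premeasure k \<delta> (\<Union>i. A i) \<le> (\<Sum>p. hausdorff_gauge k (D p))"
    by (rule hausdorff_premeasure_le)
  also have "\<dots> = (\<Sum>n. \<Sum>i. hausdorff_gauge k (C n i))"
    using suminf_ennreal_2dimen[of "\<lambda>n. \<Sum>i. hausdorff_gauge k (C n i)"
            "\<lambda>(n, i). hausdorff_gauge k (C n i)"]
    by (simp add: D_def case_prod_beta)
  also have "\<dots> \<le> (\<Sum>n. hausdorff_premeasure k \<delta> (A n) + ennreal (e * (1/2)^Suc n))"
    using le by (intro suminf_le) (auto intro: less_imp_le)
  also have "\<dots> = (\<Sum>n. hausdorff_premeasure k \<delta> (A n)) + (\<Sum>n. ennreal (e * (1/2)^Suc n))"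
    by (rule suminf_add[symmetric]) auto
  also have "(\<Sum>n. ennreal (e * (1/2)^Suc n)) = ennreal e"
    using \<open>0 < e\<close> sums_mult[OF power_half_series, of e]
    by (intro suminf_ennreal_eq) auto
  finally show "hausdorff_premeasure k \<delta> (\<Union>i. A i) \<le>
                  (\<Sum>i. hausdorff_premeasure k \<delta> (A i)) + ennreal e" .
qed

lemma hausdorff_outer_UN:
  fixes A :: "nat \<Rightarrow> 'a::metric_space set"
  shows "hausdorff_outer k (\<Union>i. A i) \<le> (\<Sum>i. hausdorff_outer k (A i))"
  unfolding hausdorff_outer_def[of k "\<Union>i. A i"]
proof (rule SUP_least)
  fix \<delta> :: real assume "\<delta> \<in> {0<..}"
  then have "(\<Sum>i. hausdorff_premeasure k \<delta> (A i)) \<le> (\<Sum>i. hausdorff_outer k (A i))"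
    by (intro suminf_le) (auto intro: hausdorff_premeasure_le_outer)
  with hausdorff_premeasure_UN[of k \<delta> A]
  show "hausdorff_premeasure k \<delta> (\<Union>i. A i) \<le> (\<Sum>i. hausdorff_outer k (A i))"
    by (rule order_trans)
qed

lemma hausdorff_outer_Un:
  "hausdorff_outer k (A \<union> B) \<le> hausdorff_outer k A + hausdorff_outer k B"
proof -
  have "hausdorff_outer k (\<Union>i. binaryset A B i) \<le> (\<Sum>i. hausdorff_outer k (binaryset A B i))"
    by (rule hausdorff_outer_UN)
  then show ?thesis
    by (simp add: UN_binaryset_eq suminf_binaryset_eq)
qed

lemma hausdorff_premeasure_separated:
  assumes sep: "\<And>a b. a \<in> A \<Longrightarrow> b \<in> B \<Longrightarrow> dist a b > \<delta>"
  shows "hausdorff_premeasure k \<delta> A + hausdorff_premeasure k \<delta> B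
           \<le> hausdorff_premeasure k \<delta> (A \<union> B)"
  unfolding hausdorff_premeasure_def[of k \<delta> "A \<union> B"]
proof (rule INF_greatest)
  fix C assume C: "C \<in> hausdorff_covers \<delta> (A \<union> B)"
  define CA where "CA = (\<lambda>i. if C i \<inter> A \<noteq> {} then C i else {})"
  define CB where "CB = (\<lambda>i. if C i \<inter> B \<noteq> {} then C i else {})"
  have pos: "0 \<le> \<delta>"
    using C diameter_ge_0 by (force simp: hausdorff_covers_def intro: order_trans)
  have "CA \<in> hausdorff_covers \<delta> A" "CB \<in> hausdorff_covers \<delta> B"
    using C pos by (fastforce simp: hausdorff_covers_def CA_def CB_def)+
  then have "hausdorff_premeasure k \<delta> A + hausdorff_premeasure k \<delta> B
      \<le> (\<Sum>i. hausdorff_gauge k (CA i)) + (\<Sum>i. hausdorff_gauge k (CB i))"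
    by (intro add_mono hausdorff_premeasure_le)
  also have "\<dots> = (\<Sum>i. hausdorff_gauge k (CA i) + hausdorff_gauge k (CB i))"
    by (rule suminf_add) auto
  also have "\<dots> \<le> (\<Sum>i. hausdorff_gauge k (C i))"
  proof (rule suminf_le)
    fix i
    have "C i \<inter> A = {} \<or> C i \<inter> B = {}"
    proof (rule ccontr)
      assume "\<not> ?thesis"
      then obtain a b where ab: "a \<in> C i" "a \<in> A" "b \<in> C i" "b \<in> B" by blast
      then have "dist a b \<le> diameter (C i)"
        using C by (auto simp: hausdorff_covers_def intro: diameter_bounded_bound)
      also have "\<dots> \<le> \<delta>" using C by (auto simp: hausdorff_covers_def)
      finally show False using sep[OF ab(2,4)] by simp
    qed
    then show "hausdorff_gauge k (CA i) + hausdorff_gauge k (CB i) \<le> hausdorff_gauge k (C i)"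
      by (auto simp: CA_def CB_def)
  qed auto
  finally show "hausdorff_premeasure k \<delta> A + hausdorff_premeasure k \<delta> B
                  \<le> (\<Sum>i. hausdorff_gauge k (C i))" .
qed

lemma hausdorff_outer_separated:
  assumes d: "d > 0" and sep: "\<And>a b. a \<in> A \<Longrightarrow> b \<in> B \<Longrightarrow> dist a b \<ge> d"
  shows "hausdorff_outer k A + hausdorff_outer k B \<le> hausdorff_outer k (A \<union> B)"
proof -
  have "hausdorff_premeasure k \<delta> A + hausdorff_premeasure k \<epsilon> B \<le> hausdorff_outer k (A \<union> B)"
    if "\<delta> > 0" "\<epsilon> > 0" for \<delta> \<epsilon>
  proof -
    define \<eta> where "\<eta> = min (d/2) (min \<delta> \<epsilon>)"
    have \<eta>: "\<eta> > 0" "\<eta> \<le> \<delta>" "\<eta> \<le> \<epsilon>" "\<eta> < d" using that d by (auto simp: \<eta>_def)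
    have "hausdorff_premeasure k \<delta> A + hausdorff_premeasure k \<epsilon> B
            \<le> hausdorff_premeasure k \<eta> A + hausdorff_premeasure k \<eta> B"
      using \<eta> by (intro add_mono hausdorff_premeasure_mono) auto
    also have "\<dots> \<le> hausdorff_premeasure k \<eta> (A \<union> B)"
      using sep \<eta> by (intro hausdorff_premeasure_separated) fastforce
    also have "\<dots> \<le> hausdorff_outer k (A \<union> B)"
      using \<eta> by (intro hausdorff_premeasure_le_outer)
    finally show ?thesis .
  qed
  then have "hausdorff_outer k A + hausdorff_premeasure k \<epsilon> B \<le> hausdorff_outer k (A \<union> B)"
    if "\<epsilon> > 0" for \<epsilon>
    using that unfolding hausdorff_outer_def[of k A]
    by (subst ennreal_SUP_add_left[symmetric]) (auto intro!: SUP_least)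
  then show ?thesis
    unfolding hausdorff_outer_def[of k B] by (auto simp: ennreal_SUP_add_right intro: SUP_least)
qed

lemma hausdorff_outer_separated_sum:
  fixes R :: "nat \<Rightarrow> 'a::metric_space set"
  assumes sep: "\<And>i. i < n \<Longrightarrow>
    \<exists>d>0. \<forall>a \<in> (\<Union>j<i. R j). \<forall>b \<in> R i. dist a b \<ge> d"
  shows "(\<Sum>i<n. hausdorff_outer k (R i)) \<le> hausdorff_outer k (\<Union>i<n. R i)"
  using sep
proof (induction n)
  case (Suc n)
  obtain d where "d > 0" "\<forall>a \<in> (\<Union>j<n. R j). \<forall>b \<in> R n. dist a b \<ge> d"
    using Suc.prems[of n] by auto
  then have "hausdorff_outer k (\<Union>i<n. R i) + hausdorff_outer k (R n)
               \<le> hausdorff_outer k ((\<Union>i<n. R i) \<union> R n)"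
    by (intro hausdorff_outer_separated[of d]) auto
  moreover have "(\<Sum>i<n. hausdorff_outer k (R i)) \<le> hausdorff_outer k (\<Union>i<n. R i)"
    using Suc by simp
  ultimately show ?case
    by (simp add: lessThan_Suc Un_commute add.commute) (meson add_left_mono order_trans)
qed simp

lemma hausdorff_outer_closed_split:
  fixes F X :: "'a::metric_space set"
  assumes "closed F"
  shows "hausdorff_outer k (X \<inter> F) + hausdorff_outer k (X - F) \<le> hausdorff_outer k X"
proof (cases "F = {} \<or> hausdorff_outer k X = top")
  case True then show ?thesis by auto
next
  case False
  then have ne: "F \<noteq> {}" and fin: "hausdorff_outer k X < top" by (auto simp: less_top)
  let ?H = "hausdorff_outer k"
  define r where "r = (\<lambda>n::nat. 1 / (real n + 1))"
  have r_pos: "r n > 0" for n by (simp add: r_def)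
  have r_dec: "r (Suc n) < r n" for n by (simp add: r_def field_simps)
  have r_mono: "r n \<le> r m" if "m \<le> n" for m n using that by (simp add: r_def field_simps)
  define Y where "Y = (\<lambda>n. {x\<in>X. infdist x F \<ge> r n})"
  define R where "R = (\<lambda>n. {x\<in>X. r (Suc n) \<le> infdist x F \<and> infdist x F < r n})"
  have gap: "dist a b \<ge> r i - r j" if "infdist a F \<ge> r i" "infdist b F \<le> r j" for a b i j
    using infdist_triangle[of a F b] that by simp
  have half: "(\<Sum>i<n. ?H (R (2*i + c))) \<le> ?H X" for c n
  proof -
    have "(\<Sum>i<n. ?H (R (2*i + c))) \<le> ?H (\<Union>i<n. R (2*i + c))"
    proof (rule hausdorff_outer_separated_sum)
      fix i
      show "\<exists>d>0. \<forall>a \<in> (\<Union>j<i. R (2*j+c)). \<forall>b \<in> R (2*i+c). dist a b \<ge> d"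
      proof (cases i)
        case 0 then show ?thesis by (auto intro: exI[of _ 1])
      next
        case (Suc l)
        have "dist a b \<ge> r (2*l+c+1) - r (2*i+c)" if "j < i" "a \<in> R (2*j+c)" "b \<in> R (2*i+c)" for a b j
        proof (rule gap)
          have "r (2*l+c+1) \<le> r (Suc (2*j+c))" using that Suc by (intro r_mono) auto
          then show "r (2*l+c+1) \<le> infdist a F" using that by (auto simp: R_def)
        qed (use that in \<open>auto simp: R_def\<close>)
        moreover have "r (2*l+c+1) - r (2*i+c) > 0"
          using r_dec[of "2*l+c+1"] Suc by simp
        ultimately show ?thesis by blast
      qed
    qed
    also have "\<dots> \<le> ?H X" by (rule hausdorff_outer_mono) (auto simp: R_def)
    finally show ?thesis .
  qed
  have "(\<Sum>i<n. ?H (R i)) \<le> ?H X + ?H X" for n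
  proof -
    have "(\<Sum>i<n. ?H (R i)) \<le> (\<Sum>i<2*n. ?H (R i))"
      by (rule sum_mono2) auto
    also have "\<dots> = (\<Sum>i<n. ?H (R (2*i + 0))) + (\<Sum>i<n. ?H (R (2*i + 1)))"
      by (induction n) (auto simp: algebra_simps)
    also have "\<dots> \<le> ?H X + ?H X" by (intro add_mono half)
    finally show ?thesis .
  qed
  then have "(\<Sum>i. ?H (R i)) \<le> ?H X + ?H X"
    by (intro suminf_le_const) auto
  then have sum_fin: "(\<Sum>i. ?H (R i)) \<noteq> top"
    using fin by (auto simp: top_unique)
  define T where "T = (\<lambda>n. \<Sum>i. ?H (R (i + n)))"
  have T_lim: "T \<longlonglongrightarrow> 0"
  proof -
    define h where "h = (\<lambda>i. enn2real (?H (R i)))"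
    have h_eq: "?H (R i) = ennreal (h i)" for i
      using ennreal_suminf_lessD[of "\<lambda>i. ?H (R i)" top i] sum_fin
      by (simp add: h_def less_top)
    have h0: "h i \<ge> 0" for i by (simp add: h_def)
    have summ: "summable h"
      using sum_fin h0 by (intro summable_suminf_not_top) (auto simp: h_eq)
    have "(\<lambda>n. \<Sum>i. h (i + n)) \<longlonglongrightarrow> 0"
      by (rule suminf_exist_split2[OF summ])
    moreover have "T n = ennreal (\<Sum>i. h (i + n))" for n
      unfolding T_def h_eq using h0 summ
      by (intro suminf_ennreal2) (auto simp: summable_iff_shift)
    ultimately show ?thesis
      using tendsto_ennrealI[of "\<lambda>n. \<Sum>i. h (i + n)" 0 sequentially]
      by (subst tendsto_cong[OF always_eventually]) auto
  qed
  have bound: "?H (X \<inter> F) + ?H (X - F) \<le> ?H X + T n" for n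
  proof -
    have "X - F \<subseteq> Y n \<union> (\<Union>i. R (i + n))"
    proof
      fix x assume x: "x \<in> X - F"
      then have "infdist x F > 0"
        using in_closed_iff_infdist_zero[OF assms ne] infdist_nonneg[of x F]
        by (metis DiffD2 less_eq_real_def)
      then obtain N :: nat where "inverse (real (Suc N)) < infdist x F"
        using reals_Archimedean by blast
      then have ex: "\<exists>N. r N \<le> infdist x F"
        by (intro exI[of _ N]) (simp add: r_def inverse_eq_divide add.commute)
      define N where "N = (LEAST N. r N \<le> infdist x F)"
      have N: "r N \<le> infdist x F" unfolding N_def using ex by (rule LeastI_ex)
      show "x \<in> Y n \<union> (\<Union>i. R (i + n))"
      proof (cases "N \<le> n")
        case True
        then show ?thesis using r_mono[of N n] N x by (auto simp: Y_def)
      next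
        case False
        then obtain i where i: "N = Suc (i + n)"
          by (metis add.commute add_Suc_right less_iff_Suc_add not_le)
        have "\<not> r (i + n) \<le> infdist x F"
          using i not_less_Least[of "i + n" "\<lambda>N. r N \<le> infdist x F"] by (auto simp: N_def)
        then show ?thesis using N x i by (auto simp: R_def)
      qed
    qed
    then have "?H (X - F) \<le> ?H (Y n) + ?H (\<Union>i. R (i + n))"
      using hausdorff_outer_mono hausdorff_outer_Un order_trans by blast
    also have "\<dots> \<le> ?H (Y n) + T n"
      unfolding T_def by (intro add_left_mono hausdorff_outer_UN)
    finally have "?H (X \<inter> F) + ?H (X - F) \<le> (?H (X \<inter> F) + ?H (Y n)) + T n"
      by (metis add.assoc add_left_mono)
    also have "?H (X \<inter> F) + ?H (Y n) \<le> ?H (X \<inter> F \<union> Y n)"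
    proof (rule hausdorff_outer_separated[OF r_pos[of n]])
      fix a b assume "a \<in> X \<inter> F" "b \<in> Y n"
      then show "r n \<le> dist a b"
        using infdist_le[of a F b] by (auto simp: Y_def dist_commute)
    qed
    also have "?H (X \<inter> F \<union> Y n) \<le> ?H X"
      by (rule hausdorff_outer_mono) (auto simp: Y_def)
    finally show ?thesis by (auto simp: add_right_mono)
  qed
  have "(\<lambda>n. ?H X + T n) \<longlonglongrightarrow> ?H X + 0"
    by (intro tendsto_add tendsto_const T_lim)
  then show ?thesis
    using bound by (intro LIMSEQ_le_const[of _ "?H X"]) auto
qed

lemma hausdorff_outer_measure_space: "outer_measure_space (Pow UNIV) (hausdorff_outer k)"
  unfolding outer_measure_space_def positive_def increasing_def countably_subadditive_def
  by (auto intro: hausdorff_outer_mono hausdorff_outer_UN)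

lemma sets_borel_subset_hausdorff:
  "sets (borel :: 'a::metric_space measure) \<subseteq> lambda_system UNIV (Pow UNIV) (hausdorff_outer k)" (is "_ \<subseteq> ?L")
proof -
  interpret P: sigma_algebra UNIV "Pow (UNIV :: 'a set)" by (rule sigma_algebra_Pow)
  interpret L: sigma_algebra UNIV ?L
    using P.caratheodory_lemma[OF hausdorff_outer_measure_space, of k]
    unfolding measure_space_def by blast
  have "F \<in> ?L" if "closed F" for F
  proof -
    have "hausdorff_outer k (X \<inter> F) + hausdorff_outer k (X - F) = hausdorff_outer k X" for X
    proof (rule antisym)
      have "X \<inter> F \<union> (X - F) = X" by blast
      then show "hausdorff_outer k X \<le> hausdorff_outer k (X \<inter> F) + hausdorff_outer k (X - F)"
        by (metis hausdorff_outer_Un)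
    qed (rule hausdorff_outer_closed_split[OF that])
    then show ?thesis unfolding P.lambda_system_eq by blast
  qed
  then have "sigma_sets UNIV (Collect closed) \<subseteq> ?L"
    by (intro L.sigma_sets_subset) auto
  then show ?thesis by (simp add: borel_eq_closed)
qed

lemma sets_hausdorff_measure [simp, measurable_cong]: "sets (hausdorff_measure k) = sets borel"
  by (simp add: hausdorff_measure_def) (metis sets.sigma_sets_eq space_borel)

lemma space_hausdorff_measure [simp]: "space (hausdorff_measure k) = UNIV"
  by (simp add: hausdorff_measure_def space_measure_of_conv)

theorem emeasure_hausdorff_measure:
  fixes A :: "'a::metric_space set"
  assumes "A \<in> sets borel"
  shows "emeasure (hausdorff_measure k) A = hausdorff_outer k A"
proof -
  interpret P: sigma_algebra UNIV "Pow (UNIV :: 'a set)" by (rule sigma_algebra_Pow)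
  have ms: "measure_space (UNIV :: 'a set) (lambda_system UNIV (Pow UNIV) (hausdorff_outer k)) (hausdorff_outer k)"
    by (rule P.caratheodory_lemma[OF hausdorff_outer_measure_space])
  have sa: "sigma_algebra UNIV (sets (borel :: 'a measure))"
    by (metis sets.sigma_algebra_axioms space_borel)
  have "measure_space (UNIV :: 'a set) (sets borel) (hausdorff_outer k)"
    using sets_borel_subset_hausdorff[of k] ms sa
    by (auto simp: measure_space_def positive_def countably_additive_def)
  then show ?thesis
    unfolding hausdorff_measure_def using assms
    by (intro emeasure_measure_of_sigma[OF sa]) (auto simp: measure_space_def)
qed


section \<open>Elliptic symbols and John's fundamental solution\<close>

text \<open>The multi-indices \<open>(i\<^sub>1, \<dots>, i\<^sub>2\<^sub>m)\<close> are the lists of length \<open>2m\<close>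
  over the index type of the coordinates.\<close>

definition homogeneous_form :: "nat \<Rightarrow> ('n::finite list \<Rightarrow> real) \<Rightarrow> real^'n \<Rightarrow> real" where
  "homogeneous_form d A \<xi> = (\<Sum>is\<in>{is. length is = d}. A is * (\<Prod>i\<leftarrow>is. \<xi> $ i))"

definition elliptic_symbol :: "nat \<Rightarrow> (real^'n::finite \<Rightarrow> real) \<Rightarrow> bool" where
  "elliptic_symbol m Q \<longleftrightarrow>
     (\<exists>A. Q = homogeneous_form (2 * m) A) \<and>
     (\<exists>c>0. \<forall>\<xi>. Q \<xi> \<ge> c * norm \<xi> ^ (2 * m))"

definition partial_deriv :: "'n::finite \<Rightarrow> (real^'n \<Rightarrow> real) \<Rightarrow> real^'n \<Rightarrow> real" where
  "partial_deriv i f x = deriv (\<lambda>t. f (x + t *\<^sub>R axis i 1)) 0"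

definition laplacian :: "(real^'n::finite \<Rightarrow> real) \<Rightarrow> real^'n \<Rightarrow> real" where
  "laplacian f x = (\<Sum>i\<in>UNIV. partial_deriv i (partial_deriv i f) x)"

text \<open>\<open>K\<^sub>L\<close> for \<open>L = L\<^sub>Q\<close>, the operator \<open>(-1)\<^sup>m Q(\<partial>\<^sub>1, \<dots>, \<partial>\<^sub>n)\<close>.
  The formula is meant for even \<open>n = CARD('n) > 2m\<close> and \<open>x \<noteq> y\<close>. On the null set
  \<open>(x - y) \<bullet> \<xi> = 0\<close> of the sphere the integrand takes the value \<open>0\<close>, since \<open>ln 0 = 0\<close>.\<close>

definition john_kernel :: "nat \<Rightarrow> (real^'n::finite \<Rightarrow> real) \<Rightarrow> real^'n \<Rightarrow> real^'n \<Rightarrow> real" where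
  "john_kernel m Q x y =
     - (1 / (2 * pi) ^ CARD('n)) *
       ((\<lambda>f z. - laplacian f z) ^^ ((CARD('n) - 2 * m) div 2))
         (\<lambda>y'. LINT \<xi>:sphere 0 1|hausdorff_measure (CARD('n) - 1).
                  ln \<bar>(x - y') \<bullet> \<xi>\<bar> / Q \<xi>) y"

definition sign_changing_near_diagonal :: "('a::metric_space \<Rightarrow> 'a \<Rightarrow> real) \<Rightarrow> bool" where
  "sign_changing_near_diagonal K \<longleftrightarrow>
     (\<forall>r>0. (\<exists>x y. 0 < dist x y \<and> dist x y < r \<and> K x y > 0) \<and>
            (\<exists>x y. 0 < dist x y \<and> dist x y < r \<and> K x y < 0))"

end

theory Submission
  imports Defs
begin

text \<open>Fix a coordinate \<open>p\<close> and let \<open>Q\<close> restrict to \<open>(\<xi>\<^sub>p\<^sup>2 - a)\<^sup>2 + \<epsilon>\<^sup>2\<close> on the unit sphere. For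
  \<open>n = 2m + 2\<close> the kernel is, up to a positive factor, the Laplacian of
  \<open>F(z) = \<integral> ln \<bar>z \<bullet> \<xi>\<bar> g(\<xi>) d\<sigma>(\<xi>)\<close> with \<open>g = 1/Q\<close>. Since \<open>\<Delta>F\<close> is homogeneous of degree \<open>-2\<close>, it
  suffices to find its sign at two coordinate vectors. Rotating in a coordinate plane moves the
  dependence on \<open>z\<close> into the smooth factor \<open>g\<close>, which gives the second derivatives of \<open>F\<close>.

  At \<open>e\<^sub>p\<close>, write \<open>g = g\<^sub>0 + \<xi>\<^sub>p\<^sup>2 \<kappa>\<close> with \<open>g\<^sub>0\<close> constant; \<open>a \<ge> 1/2\<close> makes \<open>\<kappa> \<ge> 0\<close>, and second differences give
  \<open>\<Delta>F(e\<^sub>p) \<le> (n - 2) g\<^sub>0 \<sigma>(S) - \<integral> \<kappa> d\<sigma>\<close>. Choosing \<open>a\<close> and a small \<open>\<epsilon>\<close> so that \<open>\<kappa>\<close> concentrates where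
  \<open>\<sigma>\<close> has enough mass makes this negative. At \<open>e\<^sub>i\<close> with \<open>i \<noteq> p\<close>, the rotations fixing \<open>\<xi>\<^sub>p\<close> give
  the contribution \<open>(n - 3) \<integral> g d\<sigma>\<close>, and the remaining second derivative, in direction \<open>e\<^sub>p\<close>, is
  nonnegative because the mean of \<open>ln \<bar>r cos \<theta> + b\<bar>\<close> over the circle is least at \<open>b = 0\<close>. Hence
  \<open>\<Delta>F(e\<^sub>i) > 0\<close>.\<close>

section \<open>Hausdorff measure of the unit sphere\<close>

text \<open>Formally, the Laplacian of \<open>ln \<bar>z \<bullet> \<xi>\<bar>\<close> in
  \<open>z\<close> is \<open>- 1 / (z \<bullet> \<xi>)^2\<close> for a unit vector \<xi>, which is
  not integrable across the equator \<open>z \<bullet> \<xi> = 0\<close>. This obstacle shapes the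
  proof. At the distinguished axis, the constant in the splitting of \<open>g\<close> is its value
  on the equator; what remains carries the square that cancels the singularity, and minus the
  integral of \<kappa> is left. For constant \<open>g\<close> the potential is a multiple of
  \<open>ln \<bar>z\<bar>\<close> up to a constant, with positive Laplacian. A negative value
  therefore needs \<open>g\<close> to be much larger away from the equator than on it, and the near
  zeros of the symbol at \<open>\<xi>_p^2 = a\<close> provide this. Existence of the second
  derivatives and their sign are separate matters: rotation settles the first, while the delicate
  signs come from symmetric second differences, where one-sided estimates of the logarithm are
  enough. The surface measure is accessible only through Hausdorff covers. The argument rests on its
  being finite, nonzero and rotation invariant; averages over rotations in a coordinate plane stand
  in for polar coordinates, and a pigeonhole argument for an explicit density.\<close>

lemma hausdorff_premeasure_isometry_le:
  fixes f :: "'a::metric_space \<Rightarrow> 'b::metric_space"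
  assumes iso: "\<And>x y. dist (f x) (f y) = dist x y"
  shows "hausdorff_premeasure k \<delta> (f ` A) \<le> hausdorff_premeasure k \<delta> A"
  unfolding hausdorff_premeasure_def[of k \<delta> A]
proof (rule INF_greatest)
  fix C assume C: "C \<in> hausdorff_covers \<delta> A"
  have diam: "diameter (f ` S) = diameter S" for S
  proof -
    have "(\<lambda>(x, y). dist x y) ` (f ` S \<times> f ` S) = (\<lambda>(x, y). dist x y) ` (S \<times> S)"
      using iso by (force simp: image_iff)
    then show ?thesis by (simp add: diameter_def)
  qed
  have bdd: "bounded (f ` S)" if S: "bounded S" for S
  proof -
    obtain x e where "\<forall>y\<in>S. dist x y \<le> e" using S unfolding bounded_def by blast
    then show ?thesis unfolding bounded_def by (intro exI[of _ "f x"] exI[of _ e]) (auto simp: iso)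
  qed
  have "(\<lambda>i. f ` C i) \<in> hausdorff_covers \<delta> (f ` A)"
    using C by (fastforce simp: hausdorff_covers_def diam bdd)
  then have "hausdorff_premeasure k \<delta> (f ` A) \<le> (\<Sum>i. hausdorff_gauge k (f ` C i))"
    by (rule hausdorff_premeasure_le)
  also have "\<dots> = (\<Sum>i. hausdorff_gauge k (C i))"
    by (simp add: hausdorff_gauge_def diam cong: if_cong)
  finally show "hausdorff_premeasure k \<delta> (f ` A) \<le> (\<Sum>i. hausdorff_gauge k (C i))" .
qed

lemma hausdorff_outer_isometry_le:
  fixes f :: "'a::metric_space \<Rightarrow> 'b::metric_space"
  assumes "\<And>x y. dist (f x) (f y) = dist x y"
  shows "hausdorff_outer k (f ` A) \<le> hausdorff_outer k A"
  unfolding hausdorff_outer_def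
  by (rule SUP_mono) (use hausdorff_premeasure_isometry_le[OF assms] in blast)

lemma hausdorff_outer_isometry:
  fixes f :: "'a::metric_space \<Rightarrow> 'b::metric_space"
  assumes iso: "\<And>x y. dist (f x) (f y) = dist x y" and surj: "surj f"
  shows "hausdorff_outer k (f ` A) = hausdorff_outer k A"
proof (rule antisym[OF hausdorff_outer_isometry_le[OF iso]])
  have "dist (inv f x) (inv f y) = dist x y" for x y
    using iso[of "inv f x" "inv f y"] surj by (simp add: surj_f_inv_f)
  then have "hausdorff_outer k (inv f ` f ` A) \<le> hausdorff_outer k (f ` A)"
    by (rule hausdorff_outer_isometry_le)
  moreover have "inj f" using iso by (metis dist_eq_0_iff injI)
  ultimately show "hausdorff_outer k A \<le> hausdorff_outer k (f ` A)"
    by (simp add: image_comp)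
qed

section \<open>Finiteness of the surface measure by packing and covering\<close>

lemma hausdorff_premeasure_finite_cover:
  fixes C :: "'t \<Rightarrow> 'a::metric_space set"
  assumes "finite T" "A \<subseteq> (\<Union>t\<in>T. C t)" "\<delta> \<ge> 0"
    and C: "\<And>t. t \<in> T \<Longrightarrow> bounded (C t) \<and> diameter (C t) \<le> \<delta>"
  shows "hausdorff_premeasure k \<delta> A \<le> (\<Sum>t\<in>T. hausdorff_gauge k (C t))"
proof -
  obtain e where e: "bij_betw e {..<card T} T"
    using ex_bij_betw_nat_finite[OF \<open>finite T\<close>] by (auto simp: atLeast0LessThan)
  define D where "D = (\<lambda>i. if i < card T then C (e i) else {})"
  have "D \<in> hausdorff_covers \<delta> A"
    unfolding hausdorff_covers_def
  proof (intro CollectI conjI allI subsetI)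
    fix x assume "x \<in> A"
    then obtain t where "t \<in> T" "x \<in> C t" using assms(2) by blast
    moreover then obtain i where "i < card T" "e i = t"
      using e by (metis bij_betw_iff_bijections lessThan_iff)
    ultimately show "x \<in> (\<Union>i. D i)" by (auto simp: D_def intro!: exI[of _ i])
  next
    fix i
    have "e i \<in> T" if "i < card T" using e that by (auto simp: bij_betw_def)
    then show "bounded (D i)" "diameter (D i) \<le> \<delta>" using C assms(3) by (auto simp: D_def)
  qed
  then have "hausdorff_premeasure k \<delta> A \<le> (\<Sum>i. hausdorff_gauge k (D i))"
    by (rule hausdorff_premeasure_le)
  also have "\<dots> = (\<Sum>i<card T. hausdorff_gauge k (D i))"
    by (rule suminf_finite) (auto simp: D_def)
  also have "\<dots> = (\<Sum>i<card T. hausdorff_gauge k (C (e i)))"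
    by (simp add: D_def)
  also have "\<dots> = (\<Sum>t\<in>T. hausdorff_gauge k (C t))"
    using sum.reindex_bij_betw[OF e] .
  finally show ?thesis .
qed

text \<open>A separated set of maximal cardinality is a net, because a point farther than
  \<open>r\<close> from all its elements could be added. The bound \<open>N\<close> makes the
  maximum exist.\<close>

lemma finite_net_bounded_card:
  fixes S :: "'a::metric_space set"
  assumes r: "r > 0"
    and bound: "\<And>T. finite T \<Longrightarrow> T \<subseteq> S \<Longrightarrow> (\<forall>x\<in>T. \<forall>y\<in>T. x \<noteq> y \<longrightarrow> r \<le> dist x y) \<Longrightarrow> card T \<le> N"
  obtains T where "finite T" "T \<subseteq> S" "\<forall>x\<in>T. \<forall>y\<in>T. x \<noteq> y \<longrightarrow> r \<le> dist x y"
    "S \<subseteq> (\<Union>t\<in>T. cball t r)"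
proof -
  define P where "P = (\<lambda>T. finite T \<and> T \<subseteq> S \<and> (\<forall>x\<in>T. \<forall>y\<in>T. x \<noteq> y \<longrightarrow> r \<le> dist x y))"
  have "P {}" by (simp add: P_def)
  moreover have "\<forall>T. P T \<longrightarrow> card T < Suc N" using bound by (auto simp: P_def less_Suc_eq_le)
  ultimately obtain T where T: "P T" and max: "\<And>T'. P T' \<Longrightarrow> card T' \<le> card T"
    using ex_has_greatest_nat[of P "{}" card "Suc N"] by blast
  have "S \<subseteq> (\<Union>t\<in>T. cball t r)"
  proof (rule ccontr)
    assume "\<not> ?thesis"
    then obtain x where x: "x \<in> S" "x \<notin> (\<Union>t\<in>T. cball t r)" by blast
    then have far: "r < dist t x" if "t \<in> T" for t using that by (auto simp: not_le)
    then have "x \<notin> T" using r by fastforce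
    moreover have "P (insert x T)"
      using T x(1) far by (auto simp: P_def dist_commute less_imp_le)
    ultimately show False
      using max[of "insert x T"] T by (auto simp: P_def)
  qed
  then show ?thesis using that T by (auto simp: P_def)
qed

text \<open>The point is linearity in \<open>x\<close>: up to a constant, the left side is the
  volume of the shell between the radii \<open>1 - x\<close> and \<open>1 + x\<close>.\<close>

lemma power_diff_le_linear:
  fixes x :: real
  assumes "0 \<le> x" "x \<le> 1"
  shows "(1 + x) ^ n - (1 - x) ^ n \<le> real n * 2 ^ n * x"
proof (cases n)
  case (Suc p)
  have "(1 + x) ^ Suc p - (1 - x) ^ Suc p =
      ((1 + x) - (1 - x)) * (\<Sum>i<Suc p. (1 + x) ^ i * (1 - x) ^ (p - i))"
    by (rule diff_power_eq_sum[of "1 + x" p "1 - x"])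
  also have "\<dots> \<le> (2 * x) * (\<Sum>i<Suc p. 2 ^ p)"
  proof (intro mult_mono sum_mono)
    fix i assume "i \<in> {..<Suc p}"
    then have "(1 + x) ^ i \<le> 2 ^ i" "(2::real) ^ i \<le> 2 ^ p" "(1 - x) ^ (p - i) \<le> 1"
      using assms by (auto intro!: power_mono power_le_one power_increasing)
    then have "(1 + x) ^ i * (1 - x) ^ (p - i) \<le> 2 ^ p * 1"
      using assms by (intro mult_mono order_trans[of "(1 + x) ^ i" "2 ^ i" "2 ^ p"]) auto
    then show "(1 + x) ^ i * (1 - x) ^ (p - i) \<le> 2 ^ p" by simp
  qed (use assms in \<open>auto intro!: sum_nonneg simp del: sum.lessThan_Suc\<close>)
  finally show ?thesis using Suc by (simp add: algebra_simps)
qed simp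

text \<open>Disjoint balls of radius \<open>x\<close> around the points fit into the shell between
  the radii \<open>1 - x\<close> and \<open>1 + x\<close>, whose volume is only of order
  \<open>x\<close>. One factor \<open>x\<close> cancels, so the packing number grows like that of a
  set of dimension one less than the space.\<close>

lemma card_separated_subset_sphere:
  fixes T :: "'a::euclidean_space set"
  assumes x: "0 < x" "x \<le> 1" and T: "finite T" "T \<subseteq> sphere 0 1"
    and sep: "\<forall>s\<in>T. \<forall>t\<in>T. s \<noteq> t \<longrightarrow> 2 * x \<le> dist s t"
  shows "real (card T) * x ^ DIM('a) \<le> real DIM('a) * 2 ^ DIM('a) * x"
proof -
  let ?n = "DIM('a)" and ?\<omega> = "unit_ball_vol (real DIM('a))"
  have "disjoint_family_on (\<lambda>t. ball t x) T"
    unfolding disjoint_family_on_def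
  proof (intro ballI impI)
    fix s t assume "s \<in> T" "t \<in> T" "s \<noteq> t"
    then have "x + x \<le> dist s t" using sep by auto
    then show "ball s x \<inter> ball t x = {}" by (rule disjoint_ballI)
  qed
  then have "measure lborel (\<Union>t\<in>T. ball t x) = (\<Sum>t\<in>T. measure lborel (ball t x))"
    using T x by (intro measure_finite_Union) (auto simp: emeasure_ball)
  then have "real (card T) * (?\<omega> * x ^ ?n) = measure lborel (\<Union>t\<in>T. ball t x)"
    using x by (simp add: content_ball)
  also have "\<dots> \<le> measure lborel (ball 0 (1 + x) - ball 0 (1 - x) :: 'a set)"
  proof (rule measure_mono_fmeasurable)
    show "(\<Union>t\<in>T. ball t x) \<subseteq> ball 0 (1 + x) - ball 0 (1 - x)"
    proof
      fix y assume "y \<in> (\<Union>t\<in>T. ball t x)"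
      then obtain t where t: "norm t = 1" "dist t y < x" using T by auto
      have "norm y \<le> norm t + dist t y" "norm t \<le> norm y + dist t y"
        by (metis add.commute dist_0_norm dist_commute dist_triangle)+
      then show "y \<in> ball 0 (1 + x) - ball 0 (1 - x)" using t by simp
    qed
    show "(ball 0 (1 + x) - ball 0 (1 - x) :: 'a set) \<in> fmeasurable lborel"
      using x by (intro fmeasurable.Diff) (auto simp: fmeasurable_def emeasure_ball)
  qed (auto intro!: borel_open)
  also have "\<dots> = measure lborel (ball 0 (1 + x) :: 'a set) - measure lborel (ball 0 (1 - x) :: 'a set)"
    using x by (intro measure_Diff) (auto simp: emeasure_ball intro!: subset_ball)
  also have "\<dots> = ?\<omega> * ((1 + x) ^ ?n - (1 - x) ^ ?n)"
    using x by (simp add: content_ball algebra_simps)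
  also have "\<dots> \<le> ?\<omega> * (real ?n * 2 ^ ?n * x)"
    using x by (intro mult_left_mono power_diff_le_linear) auto
  finally have "?\<omega> * (real (card T) * x ^ ?n) \<le> ?\<omega> * (real ?n * 2 ^ ?n * x)"
    by (simp add: algebra_simps)
  then show ?thesis by (simp add: mult_le_cancel_left_pos)
qed

text \<open>A maximal \<open>2 * x\<close>-separated subset gives a cover by balls of diameter
  \<open>4 * x\<close>, and the packing bound keeps the gauge sum below \<open>B\<close>, which does
  not depend on the scale \<open>x\<close>.\<close>

lemma hausdorff_outer_sphere_finite:
  "hausdorff_outer (DIM('a) - 1) (sphere 0 1 :: 'a::euclidean_space set) < top"
proof -
  let ?n = "DIM('a)" and ?S = "sphere 0 1 :: 'a set"
  define p where "p = ?n - 1"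
  have n: "?n = Suc p" by (simp add: p_def)
  define B where "B = unit_ball_vol (real p) * 2 ^ p * (real ?n * 2 ^ ?n)"
  have small: "hausdorff_premeasure p (4 * x) ?S \<le> ennreal B" if x: "0 < x" "x \<le> 1" for x
  proof -
    have card: "real (card T) * x ^ p \<le> real ?n * 2 ^ ?n"
      if "finite T" "T \<subseteq> ?S" "\<forall>s\<in>T. \<forall>t\<in>T. s \<noteq> t \<longrightarrow> 2 * x \<le> dist s t" for T
      using card_separated_subset_sphere[OF x that] x
      by (simp only: n power_Suc mult.left_commute[of _ x] mult.commute[of _ x] mult_le_cancel_left_pos)
    obtain N :: nat where N: "real ?n * 2 ^ ?n / x ^ p \<le> real N"
      using real_arch_simple by blast
    have cardN: "card T \<le> N"
      if "finite T" "T \<subseteq> ?S" "\<forall>s\<in>T. \<forall>t\<in>T. s \<noteq> t \<longrightarrow> 2 * x \<le> dist s t" for T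
    proof -
      have "real (card T) \<le> real ?n * 2 ^ ?n / x ^ p"
        using card[OF that] x by (simp add: pos_le_divide_eq)
      then show ?thesis using N by linarith
    qed
    have "0 < 2 * x" using x by simp
    then obtain T where T: "finite T" "T \<subseteq> ?S" "\<forall>s\<in>T. \<forall>t\<in>T. s \<noteq> t \<longrightarrow> 2 * x \<le> dist s t"
      "?S \<subseteq> (\<Union>t\<in>T. cball t (2 * x))"
      by (rule finite_net_bounded_card[OF _ cardN])
    have "hausdorff_premeasure p (4 * x) ?S \<le> (\<Sum>t\<in>T. hausdorff_gauge p (cball t (2 * x)))"
      using T x by (intro hausdorff_premeasure_finite_cover) auto
    also have "\<dots> = (\<Sum>t\<in>T. ennreal (unit_ball_vol (real p) * (2 * x) ^ p))"
      using x by (intro sum.cong) (auto simp: hausdorff_gauge_def)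
    also have "\<dots> = ennreal (unit_ball_vol (real p) * 2 ^ p * (real (card T) * x ^ p))"
      using x by (simp add: sum_ennreal power_mult_distrib ennreal_of_nat_eq_real_of_nat
          flip: ennreal_mult'')
    also have "\<dots> \<le> ennreal B"
      unfolding B_def using card[OF T(1-3)] by (intro ennreal_leI mult_left_mono) auto
    finally show ?thesis .
  qed
  have "hausdorff_outer p ?S \<le> ennreal B"
    unfolding hausdorff_outer_def
  proof (rule SUP_least)
    fix \<delta> :: real assume "\<delta> \<in> {0<..}"
    then have "0 < min 1 (\<delta> / 4)" "min 1 (\<delta> / 4) \<le> 1" "4 * min 1 (\<delta> / 4) \<le> \<delta>" by auto
    then show "hausdorff_premeasure p \<delta> ?S \<le> ennreal B"
      using small hausdorff_premeasure_mono[of ?S ?S] by (meson order_refl order_trans)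
  qed
  then show ?thesis unfolding p_def by (simp add: order_le_less_trans)
qed

text \<open>The cone is a tube of thickness \<open>d\<close> around a unit segment. About
  \<open>1 / d\<close> balls of radius \<open>2 * d\<close> cover it, and their total volume is of
  order \<open>d ^ (DIM('a) - 1)\<close>, like the gauge of a set of diameter
  \<open>d\<close>.\<close>

lemma cone_over_small_set_cover:
  fixes C :: "'a::euclidean_space set"
  assumes C: "C \<subseteq> sphere 0 1" "\<And>x y. x \<in> C \<Longrightarrow> y \<in> C \<Longrightarrow> dist x y \<le> d" and d: "0 < d" "d \<le> 1"
  obtains B where "B \<in> sets lborel" "{r *\<^sub>R x |r x. 0 \<le> r \<and> r \<le> 1 \<and> x \<in> C} \<subseteq> B"
    "emeasure lborel B \<le> ennreal (3 * unit_ball_vol (real DIM('a)) * 2 ^ DIM('a) * d ^ (DIM('a) - 1))"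
proof (cases "C = {}")
  case True
  then show ?thesis by (intro that[of "{}"]) auto
next
  case False
  then obtain c where c: "c \<in> C" by blast
  let ?n = "DIM('a)" and ?\<omega> = "unit_ball_vol (real DIM('a))"
  define K where "K = nat \<lfloor>1 / d\<rfloor>"
  have K: "real K \<le> 1 / d" using d by (simp add: K_def)
  define B where "B = (\<Union>k\<le>K. cball ((real k * d) *\<^sub>R c) (2 * d))"
  have "{r *\<^sub>R x |r x. 0 \<le> r \<and> r \<le> 1 \<and> x \<in> C} \<subseteq> B"
  proof
    fix y assume "y \<in> {r *\<^sub>R x |r x. 0 \<le> r \<and> r \<le> 1 \<and> x \<in> C}"
    then obtain r x where r: "0 \<le> r" "r \<le> 1" "x \<in> C" "y = r *\<^sub>R x" by blast
    define k where "k = nat \<lfloor>r / d\<rfloor>"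
    have "real k \<le> r / d" "r / d < real k + 1" using r d by (auto simp: k_def)
    then have k: "real k * d \<le> r" "r < real k * d + d" using d by (auto simp: field_simps)
    have "r / d \<le> 1 / d" using r d by (simp add: divide_right_mono)
    then have "k \<le> K" unfolding k_def K_def by (intro nat_mono floor_mono)
    have "norm (c - x) \<le> d" using C(2)[OF c \<open>x \<in> C\<close>] by (simp add: dist_norm)
    have "norm x = 1" using C(1) r by auto
    have "(real k * d) *\<^sub>R c - y = (real k * d) *\<^sub>R (c - x) - (r - real k * d) *\<^sub>R x"
      by (simp add: r algebra_simps)
    then have "norm ((real k * d) *\<^sub>R c - y) \<le> (real k * d) * norm (c - x) + (r - real k * d) * norm x"
      using norm_triangle_ineq4[of "(real k * d) *\<^sub>R (c - x)" "(r - real k * d) *\<^sub>R x"] k d by simp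
    also have "\<dots> \<le> 1 * d + d * 1"
      using k r d \<open>norm (c - x) \<le> d\<close> \<open>norm x = 1\<close> by (intro add_mono mult_mono) auto
    finally have "y \<in> cball ((real k * d) *\<^sub>R c) (2 * d)" by (simp add: dist_norm)
    then show "y \<in> B" using \<open>k \<le> K\<close> by (auto simp: B_def)
  qed
  moreover have "emeasure lborel B \<le> ennreal (3 * ?\<omega> * 2 ^ ?n * d ^ (?n - 1))"
  proof -
    have "emeasure lborel B \<le> (\<Sum>k\<le>K. emeasure lborel (cball ((real k * d) *\<^sub>R c) (2 * d)))"
      unfolding B_def by (rule emeasure_subadditive_finite) auto
    also have "\<dots> = of_nat (Suc K) * ennreal (?\<omega> * (2 * d) ^ ?n)"
      using d by (simp add: emeasure_cball)
    also have "\<dots> = ennreal (real (Suc K) * (?\<omega> * (2 * d) ^ ?n))"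
      using d by (simp only: ennreal_of_nat_eq_real_of_nat) (simp add: ennreal_mult)
    also have "\<dots> \<le> ennreal (3 * ?\<omega> * 2 ^ ?n * d ^ (?n - 1))"
    proof (rule ennreal_leI)
      have "real (Suc K) * d \<le> 2"
        using K d by (simp add: field_simps)
      then have "(real (Suc K) * d) * (?\<omega> * 2 ^ ?n * d ^ (?n - 1)) \<le> 3 * (?\<omega> * 2 ^ ?n * d ^ (?n - 1))"
        using d by (intro mult_right_mono) auto
      moreover have dn: "d ^ ?n = d * d ^ (?n - 1)"
        by (simp add: power_eq_if[of d ?n])
      ultimately show "real (Suc K) * (?\<omega> * (2 * d) ^ ?n) \<le> 3 * ?\<omega> * 2 ^ ?n * d ^ (?n - 1)"
        by (simp only: power_mult_distrib dn mult_ac)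
    qed
    finally show ?thesis .
  qed
  ultimately show ?thesis by (intro that[of B]) (auto simp: B_def)
qed

text \<open>The cones over the members of a cover of the sphere fill the unit ball, so the volume of
  the ball bounds the gauge sum from below.\<close>

lemma hausdorff_outer_sphere_pos:
  assumes "DIM('a) \<ge> 2"
  shows "hausdorff_outer (DIM('a) - 1) (sphere 0 1 :: 'a::euclidean_space set) > 0"
proof -
  let ?n = "DIM('a)" and ?S = "sphere 0 1 :: 'a set" and ?\<omega> = "unit_ball_vol (real DIM('a))"
  define p where "p = ?n - 1"
  have p: "p \<ge> 1" using assms by (simp add: p_def)
  define c where "c = 3 * ?\<omega> * 2 ^ ?n"
  have c: "c > 0" by (simp add: c_def)
  define v where "v = unit_ball_vol (real p) / 2 ^ p"
  have v: "v > 0" by (simp add: v_def)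
  \<comment> \<open>The numbers \<open>\<eta> i\<close> below sum to \<open>e\<close>, so enlarging
    the diameters by them costs at most half of the volume of the ball.\<close>
  define e where "e = min 1 (?\<omega> / (2 * c))"
  have e: "0 < e" "e \<le> 1" "c * e \<le> ?\<omega> / 2" using c by (auto simp: e_def min_def field_simps)
  have "ennreal (v * ?\<omega> / (2 * c)) \<le> (\<Sum>i. hausdorff_gauge p (C i))"
    if C: "C \<in> hausdorff_covers 1 ?S" for C
  proof -
    define \<eta> where "\<eta> = (\<lambda>i::nat. e * (1/2) ^ Suc i)"
    have \<eta>: "0 < \<eta> i" "\<eta> i \<le> 1" for i
      using e mult_le_one[of e "(1/2) ^ Suc i"] power_le_one[of "1/2::real" "Suc i"]
      by (auto simp: \<eta>_def simp del: power_Suc)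
    \<comment> \<open>A cover may contain points or empty sets, of diameter \<open>0\<close>,
      whereas the cone estimate needs a positive size; \<open>\<eta> i\<close> supplies it.\<close>
    define d where "d = (\<lambda>i. max (diameter (C i)) (\<eta> i))"
    have bC: "bounded (C i)" "diameter (C i) \<le> 1" for i using C by (auto simp: hausdorff_covers_def)
    have d: "0 < d i" "d i \<le> 1" for i using \<eta> bC by (auto simp: d_def less_max_iff_disj)
    have dist_le: "dist x y \<le> d i" if "x \<in> C i \<inter> ?S" "y \<in> C i \<inter> ?S" for x y i
    proof -
      have "dist x y \<le> diameter (C i)" using that bC by (intro diameter_bounded_bound) auto
      then show ?thesis by (simp add: d_def)
    qed
    define cone_cover where "cone_cover = (\<lambda>i B. B \<in> sets lborel \<and>
      {r *\<^sub>R x |r x. 0 \<le> r \<and> r \<le> 1 \<and> x \<in> C i \<inter> ?S} \<subseteq> B \<and>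
      emeasure lborel B \<le> ennreal (c * d i ^ p))"
    have "\<exists>B. cone_cover i B" for i
    proof -
      obtain B where "B \<in> sets lborel" "{r *\<^sub>R x |r x. 0 \<le> r \<and> r \<le> 1 \<and> x \<in> C i \<inter> ?S} \<subseteq> B"
        "emeasure lborel B \<le> ennreal (3 * ?\<omega> * 2 ^ ?n * d i ^ (?n - 1))"
        by (rule cone_over_small_set_cover[of "C i \<inter> ?S" "d i"]) (use d dist_le in auto)
      then show ?thesis unfolding cone_cover_def c_def p_def by blast
    qed
    then obtain B where "\<And>i. cone_cover i (B i)" by metis
    then have B: "\<And>i. B i \<in> sets lborel"
        "\<And>i. {r *\<^sub>R x |r x. 0 \<le> r \<and> r \<le> 1 \<and> x \<in> C i \<inter> ?S} \<subseteq> B i"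
        "\<And>i. emeasure lborel (B i) \<le> ennreal (c * d i ^ p)"
      unfolding cone_cover_def by blast+
    have "cball 0 1 \<subseteq> (\<Union>i. B i) \<union> {0}"
    proof
      fix y :: 'a assume y: "y \<in> cball 0 1"
      show "y \<in> (\<Union>i. B i) \<union> {0}"
      proof (cases "y = 0")
        case False
        define u where "u = y /\<^sub>R norm y"
        have u: "u \<in> ?S" "y = norm y *\<^sub>R u" using False by (simp_all add: u_def)
        have "?S \<subseteq> (\<Union>i. C i)" using C by (simp add: hausdorff_covers_def)
        with u obtain i where "u \<in> C i" by blast
        then have "y \<in> {r *\<^sub>R x |r x. 0 \<le> r \<and> r \<le> 1 \<and> x \<in> C i \<inter> ?S}"
          using u y by (intro CollectI exI[of _ "norm y"] exI[of _ u]) auto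
        then have "y \<in> B i" using B(2) by blast
        then show ?thesis by blast
      qed simp
    qed
    then have "emeasure lborel (cball 0 1 :: 'a set) \<le> emeasure lborel ((\<Union>i. B i) \<union> {0})"
      using B(1) by (intro emeasure_mono) auto
    also have "\<dots> \<le> emeasure lborel (\<Union>i. B i) + emeasure lborel {0 :: 'a}"
      using B(1) by (intro emeasure_subadditive) auto
    also have "\<dots> = emeasure lborel (\<Union>i. B i)" by simp
    also have "\<dots> \<le> (\<Sum>i. emeasure lborel (B i))"
      using B(1) by (intro emeasure_subadditive_countably) auto
    also have "\<dots> \<le> (\<Sum>i. ennreal (c / v) * hausdorff_gauge p (C i) + ennreal (c * \<eta> i))"
    proof (rule suminf_le)
      fix i
      show "emeasure lborel (B i) \<le> ennreal (c / v) * hausdorff_gauge p (C i) + ennreal (c * \<eta> i)"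
      proof (cases "C i = {}")
        case True
        have "d i ^ p \<le> \<eta> i"
          using True \<eta>[of i] p power_decreasing[of 1 p "\<eta> i"] by (simp add: d_def less_imp_le max_def)
        then have "ennreal (c * d i ^ p) \<le> ennreal (c * \<eta> i)"
          using c by (intro ennreal_leI) simp
        then show ?thesis using B(3)[of i] True by simp
      next
        case False
        have D0: "0 \<le> diameter (C i)" using bC by (simp add: diameter_ge_0)
        \<comment> \<open>This uses \<open>p \<ge> 1\<close>, that is, dimension at least
          two.\<close>
        have "\<eta> i ^ p \<le> \<eta> i"
          using \<eta>[of i] p power_decreasing[of 1 p "\<eta> i"] by (simp add: less_imp_le)
        then have "d i ^ p \<le> diameter (C i) ^ p + \<eta> i"
          using \<eta>[of i] zero_le_power[OF D0, of p] by (auto simp: d_def max_def)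
        then have "c * d i ^ p \<le> c * (diameter (C i) ^ p + \<eta> i)"
          using c by (intro mult_left_mono) auto
        also have "\<dots> = c / v * (unit_ball_vol (real p) * (diameter (C i) / 2) ^ p) + c * \<eta> i"
          using unit_ball_vol_pos[of "real p"]
          by (simp add: v_def power_divide distrib_left less_imp_neq[symmetric])
        finally have "c * d i ^ p \<le> c / v * (unit_ball_vol (real p) * (diameter (C i) / 2) ^ p) + c * \<eta> i" .
        then have "ennreal (c * d i ^ p) \<le> ennreal (c / v * (unit_ball_vol (real p) * (diameter (C i) / 2) ^ p) + c * \<eta> i)"
          by (rule ennreal_leI)
        also have "\<dots> = ennreal (c / v) * hausdorff_gauge p (C i) + ennreal (c * \<eta> i)"
        proof -
          have "0 \<le> c / v" "0 \<le> unit_ball_vol (real p) * (diameter (C i) / 2) ^ p" "0 \<le> c * \<eta> i"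
            using c v D0 \<eta>[of i] by simp_all
          then show ?thesis
            using False by (simp only: hausdorff_gauge_def ennreal_plus ennreal_mult mult_nonneg_nonneg if_False)
        qed
        finally show ?thesis using B(3)[of i] by simp
      qed
    qed auto
    also have "\<dots> = (\<Sum>i. ennreal (c / v) * hausdorff_gauge p (C i)) + (\<Sum>i. ennreal (c * \<eta> i))"
      by (rule suminf_add[symmetric]) auto
    also have "(\<Sum>i. ennreal (c * \<eta> i)) = ennreal (c * e)"
    proof (rule suminf_ennreal_eq)
      show "0 \<le> c * \<eta> i" for i using c \<eta>[of i] by simp
      show "(\<lambda>i. c * \<eta> i) sums (c * e)"
        using sums_mult[OF power_half_series, of "c * e"] by (simp add: \<eta>_def mult.assoc)
    qed
    finally have le: "ennreal ?\<omega> \<le> ennreal (c / v) * (\<Sum>i. hausdorff_gauge p (C i)) + ennreal (c * e)"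
      by (simp add: emeasure_cball)
    show ?thesis
    proof (cases "(\<Sum>i. hausdorff_gauge p (C i))")
      case (real s)
      have nonneg: "0 \<le> c / v" "0 \<le> c * e" using c v e by simp_all
      have "ennreal ?\<omega> \<le> ennreal (c / v * s + c * e)"
        using le real nonneg by (simp only: ennreal_plus ennreal_mult mult_nonneg_nonneg)
      moreover have "0 \<le> c / v * s + c * e"
        using nonneg real mult_nonneg_nonneg[of "c / v" s] by linarith
      ultimately have "?\<omega> \<le> c / v * s + c * e"
        by (simp only: ennreal_le_iff)
      then have "?\<omega> / 2 \<le> c / v * s" using e by linarith
      then have "v * ?\<omega> / (2 * c) \<le> s" using c v by (simp add: field_simps)
      then show ?thesis using real by (simp add: ennreal_leI)
    qed simp
  qed
  then have "ennreal (v * ?\<omega> / (2 * c)) \<le> hausdorff_premeasure p 1 ?S"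
    unfolding hausdorff_premeasure_def by (rule INF_greatest)
  also have "\<dots> \<le> hausdorff_outer p ?S" by (rule hausdorff_premeasure_le_outer) simp
  finally have "ennreal (v * ?\<omega> / (2 * c)) \<le> hausdorff_outer p ?S" .
  moreover have "0 < ennreal (v * ?\<omega> / (2 * c))" using c v by simp
  ultimately show ?thesis unfolding p_def by (rule order_less_le_trans[rotated])
qed

text \<open>A measure on the whole space that is concentrated on the sphere: its sigma-algebra
  consists of the Borel sets, rotations act on it directly, and facts about unit vectors become
  almost-everywhere statements.\<close>

definition sphere_measure :: "'a::euclidean_space measure" where
  "sphere_measure = density (hausdorff_measure (DIM('a) - 1)) (indicator (sphere 0 1))"

lemma sphere_borel [measurable]: "sphere (a :: 'a::euclidean_space) r \<in> sets borel"
  by (simp add: borel_closed)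

lemma sets_sphere_measure [simp, measurable_cong]: "sets sphere_measure = sets borel"
  by (simp add: sphere_measure_def)

lemma space_sphere_measure [simp]: "space sphere_measure = UNIV"
  by (simp add: sphere_measure_def)

lemma emeasure_sphere_measure:
  fixes A :: "'a::euclidean_space set"
  assumes "A \<in> sets borel"
  shows "emeasure sphere_measure A = hausdorff_outer (DIM('a) - 1) (A \<inter> sphere 0 1)"
proof -
  have "emeasure sphere_measure A = (\<integral>\<^sup>+x. indicator (A \<inter> sphere 0 1) x \<partial>hausdorff_measure (DIM('a) - 1))"
    unfolding sphere_measure_def using assms
    by (subst emeasure_density)
      (auto intro!: nn_integral_cong simp del: nn_integral_indicator split: split_indicator)
  also have "\<dots> = hausdorff_outer (DIM('a) - 1) (A \<inter> sphere 0 1)"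
    using assms sphere_borel[of "0::'a" 1]
    by (simp only: nn_integral_indicator sets_hausdorff_measure sets.Int emeasure_hausdorff_measure)
  finally show ?thesis .
qed

lemma integral_sphere_measure:
  fixes f :: "'a::euclidean_space \<Rightarrow> real"
  assumes "f \<in> borel_measurable borel"
  shows "(\<integral>x. f x \<partial>sphere_measure) = (LINT x:sphere 0 1|hausdorff_measure (DIM('a) - 1). f x)"
proof -
  have "(\<integral>x. f x \<partial>sphere_measure) =
      (\<integral>x. f x \<partial>density (hausdorff_measure (DIM('a) - 1)) (\<lambda>x. ennreal (indicator (sphere 0 1) x)))"
    by (simp add: sphere_measure_def ennreal_indicator)
  also have "\<dots> = (\<integral>x. indicator (sphere 0 1) x *\<^sub>R f x \<partial>hausdorff_measure (DIM('a) - 1))"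
    using assms by (intro integral_density) auto
  finally show ?thesis by (simp add: set_lebesgue_integral_def)
qed

lemma finite_sphere_measure: "finite_measure (sphere_measure :: 'a::euclidean_space measure)"
proof (rule finite_measureI)
  show "emeasure sphere_measure (space sphere_measure :: 'a set) \<noteq> \<infinity>"
    using hausdorff_outer_sphere_finite[where 'a='a] emeasure_sphere_measure[of "UNIV :: 'a set"]
    by simp
qed

lemma AE_sphere_measure: "AE x in (sphere_measure :: 'a::euclidean_space measure). norm x = 1"
proof (rule AE_I)
  show "{x \<in> space sphere_measure. \<not> norm x = 1} \<subseteq> - sphere 0 (1::real)"
    by auto
  show "emeasure sphere_measure (- sphere (0::'a) 1) = 0"
    using sphere_borel[of "0::'a" 1] by (subst emeasure_sphere_measure) auto
  show "- sphere (0::'a) 1 \<in> sets sphere_measure"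
    using sphere_borel[of "0::'a" 1] by auto
qed

lemma orthogonal_transformation_measurable:
  fixes T :: "'a::euclidean_space \<Rightarrow> 'a"
  assumes "orthogonal_transformation T"
  shows "T \<in> borel_measurable borel"
  using assms by (intro borel_measurable_continuous_onI linear_continuous_on
      linear_conv_bounded_linear[THEN iffD1] orthogonal_transformation_linear)

text \<open>Orthogonal maps are surjective isometries that preserve the sphere, and the Hausdorff
  outer measure depends on distances only.\<close>

lemma distr_sphere_measure:
  fixes T :: "'a::euclidean_space \<Rightarrow> 'a"
  assumes T: "orthogonal_transformation T"
  shows "distr sphere_measure borel T = sphere_measure"
proof (rule measure_eqI)
  have [measurable]: "T \<in> borel_measurable borel"
    using T by (rule orthogonal_transformation_measurable)
  fix A assume "A \<in> sets (distr sphere_measure borel T)"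
  then have A [measurable]: "A \<in> sets borel" by simp
  have "surj T" using T by (rule orthogonal_transformation_surj)
  have "T ` (T -` A \<inter> sphere 0 1) = A \<inter> sphere 0 1"
  proof (intro equalityI subsetI)
    fix y assume "y \<in> A \<inter> sphere 0 1"
    moreover obtain x where "y = T x" using \<open>surj T\<close> by auto
    ultimately show "y \<in> T ` (T -` A \<inter> sphere 0 1)"
      using orthogonal_transformation_norm[OF T] by auto
  qed (use orthogonal_transformation_norm[OF T] in auto)
  moreover have "hausdorff_outer k (T ` B) = hausdorff_outer k B" for B k
    using T \<open>surj T\<close> by (intro hausdorff_outer_isometry) (auto simp: orthogonal_transformation_isometry)
  ultimately have "hausdorff_outer k (T -` A \<inter> sphere 0 1) = hausdorff_outer k (A \<inter> sphere 0 1)" for k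
    by metis
  moreover have "T -` A \<in> sets borel" using measurable_sets[of T borel borel A] by simp
  ultimately show "emeasure (distr sphere_measure borel T) A = emeasure sphere_measure A"
    by (simp add: emeasure_distr emeasure_sphere_measure)
qed simp

section \<open>Logarithmic means over the circle\<close>

definition circle_measure :: "real measure" where
  "circle_measure = uniform_measure lborel {0..<2 * pi}"

lemma sets_circle_measure [simp, measurable_cong]: "sets circle_measure = sets borel"
  by (simp add: circle_measure_def)

lemma space_circle_measure [simp]: "space circle_measure = UNIV"
  by (simp add: circle_measure_def)

lemma nn_integral_circle_measure:
  assumes "u \<in> borel_measurable borel"
  shows "(\<integral>\<^sup>+\<theta>. u \<theta> \<partial>circle_measure) = (\<integral>\<^sup>+\<theta>. u \<theta> * indicator {0..<2 * pi} \<theta> \<partial>lborel) / ennreal (2 * pi)"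
  unfolding circle_measure_def using assms by (subst nn_integral_uniform_measure) auto

lemma emeasure_circle_measure_UNIV [simp]: "emeasure circle_measure UNIV = 1"
  unfolding circle_measure_def by (subst emeasure_uniform_measure) auto

lemma finite_measure_circle: "finite_measure circle_measure"
  by (rule finite_measureI) simp

lemma AE_circle_measure:
  assumes "countable {\<theta>. \<not> P \<theta>}"
  shows "AE \<theta> in circle_measure. P \<theta>"
proof -
  have "AE \<theta> in lborel. \<theta> \<notin> {\<theta>. \<not> P \<theta>}"
    by (intro AE_not_in countable_imp_null_set_lborel assms)
  then have "AE \<theta> in lborel. \<theta> \<in> {0..<2 * pi} \<longrightarrow> P \<theta>" by eventually_elim auto
  then show ?thesis unfolding circle_measure_def by (intro AE_uniform_measureI) auto
qed

text \<open>The part \<open>{p..<p + \<alpha>}\<close> of the shifted window that sticks out of the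
  period is moved back onto \<open>{0..<\<alpha>}\<close>.\<close>

lemma nn_integral_periodic_window:
  fixes u :: "real \<Rightarrow> ennreal"
  assumes u [measurable]: "u \<in> borel_measurable borel" and per: "\<And>\<theta>. u (\<theta> + p) = u \<theta>"
    and \<alpha>: "0 \<le> \<alpha>" "\<alpha> \<le> p"
  shows "(\<integral>\<^sup>+\<theta>. u (\<theta> + \<alpha>) * indicator {0..<p} \<theta> \<partial>lborel) = (\<integral>\<^sup>+\<theta>. u \<theta> * indicator {0..<p} \<theta> \<partial>lborel)"
proof -
  have "(\<integral>\<^sup>+\<theta>. u \<theta> * indicator {\<alpha>..<\<alpha> + p} \<theta> \<partial>lborel) =
      (\<integral>\<^sup>+\<theta>. u (\<alpha> + 1 * \<theta>) * indicator {\<alpha>..<\<alpha> + p} (\<alpha> + 1 * \<theta>) \<partial>lborel)"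
    by (subst nn_integral_real_affine[where c = 1 and t = \<alpha>]) auto
  also have "\<dots> = (\<integral>\<^sup>+\<theta>. u (\<theta> + \<alpha>) * indicator {0..<p} \<theta> \<partial>lborel)"
    by (intro nn_integral_cong) (auto simp: add.commute split: split_indicator)
  finally have 1: "(\<integral>\<^sup>+\<theta>. u (\<theta> + \<alpha>) * indicator {0..<p} \<theta> \<partial>lborel) =
      (\<integral>\<^sup>+\<theta>. u \<theta> * indicator {\<alpha>..<\<alpha> + p} \<theta> \<partial>lborel)" ..
  have "(\<integral>\<^sup>+\<theta>. u \<theta> * indicator {p..<p + \<alpha>} \<theta> \<partial>lborel) =
      (\<integral>\<^sup>+\<theta>. u (p + 1 * \<theta>) * indicator {p..<p + \<alpha>} (p + 1 * \<theta>) \<partial>lborel)"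
    by (subst nn_integral_real_affine[where c = 1 and t = p]) auto
  also have "\<dots> = (\<integral>\<^sup>+\<theta>. u \<theta> * indicator {0..<\<alpha>} \<theta> \<partial>lborel)"
  proof (rule nn_integral_cong)
    fix \<theta> show "u (p + 1 * \<theta>) * indicator {p..<p + \<alpha>} (p + 1 * \<theta>) = u \<theta> * indicator {0..<\<alpha>} \<theta>"
      using per[of \<theta>] by (auto simp: add.commute split: split_indicator)
  qed
  finally have 2: "(\<integral>\<^sup>+\<theta>. u \<theta> * indicator {p..<p + \<alpha>} \<theta> \<partial>lborel) =
      (\<integral>\<^sup>+\<theta>. u \<theta> * indicator {0..<\<alpha>} \<theta> \<partial>lborel)" .
  have "(\<integral>\<^sup>+\<theta>. u \<theta> * indicator {\<alpha>..<\<alpha> + p} \<theta> \<partial>lborel) =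
      (\<integral>\<^sup>+\<theta>. u \<theta> * indicator {\<alpha>..<p} \<theta> + u \<theta> * indicator {p..<p + \<alpha>} \<theta> \<partial>lborel)"
    using \<alpha> by (intro nn_integral_cong) (auto split: split_indicator)
  also have "\<dots> = (\<integral>\<^sup>+\<theta>. u \<theta> * indicator {\<alpha>..<p} \<theta> \<partial>lborel) + (\<integral>\<^sup>+\<theta>. u \<theta> * indicator {p..<p + \<alpha>} \<theta> \<partial>lborel)"
    by (rule nn_integral_add) auto
  also have "\<dots> = (\<integral>\<^sup>+\<theta>. u \<theta> * indicator {\<alpha>..<p} \<theta> \<partial>lborel) + (\<integral>\<^sup>+\<theta>. u \<theta> * indicator {0..<\<alpha>} \<theta> \<partial>lborel)"
    by (simp only: 2)
  also have "\<dots> = (\<integral>\<^sup>+\<theta>. u \<theta> * indicator {\<alpha>..<p} \<theta> + u \<theta> * indicator {0..<\<alpha>} \<theta> \<partial>lborel)"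
    by (rule nn_integral_add[symmetric]) auto
  also have "\<dots> = (\<integral>\<^sup>+\<theta>. u \<theta> * indicator {0..<p} \<theta> \<partial>lborel)"
    using \<alpha> by (intro nn_integral_cong) (auto split: split_indicator)
  finally show ?thesis using 1 by simp
qed

lemma periodic_int_multiple:
  fixes f :: "real \<Rightarrow> 'a"
  assumes "\<And>\<theta>. f (\<theta> + p) = f \<theta>"
  shows "f (\<theta> + of_int k * p) = f \<theta>"
proof (induction k arbitrary: \<theta> rule: int_induct[of _ 0])
  case (step1 i)
  have "f (\<theta> + of_int (i + 1) * p) = f (\<theta> + of_int i * p + p)" by (simp add: algebra_simps)
  then show ?case using assms step1 by simp
next
  case (step2 i)
  have "f (\<theta> + of_int (i - 1) * p) = f (\<theta> + of_int (i - 1) * p + p)" using assms by metis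
  also have "\<dots> = f (\<theta> + of_int i * p)" by (simp add: algebra_simps)
  finally show ?case using step2 by simp
qed simp

lemma nn_integral_circle_shift:
  fixes u :: "real \<Rightarrow> ennreal"
  assumes u [measurable]: "u \<in> borel_measurable borel" and per: "\<And>\<theta>. u (\<theta> + 2 * pi) = u \<theta>"
  shows "(\<integral>\<^sup>+\<theta>. u (\<theta> + \<alpha>) \<partial>circle_measure) = (\<integral>\<^sup>+\<theta>. u \<theta> \<partial>circle_measure)"
proof -
  define k where "k = \<lfloor>\<alpha> / (2 * pi)\<rfloor>"
  define \<beta> where "\<beta> = \<alpha> - of_int k * (2 * pi)"
  have "of_int k \<le> \<alpha> / (2 * pi)" "\<alpha> / (2 * pi) < of_int k + 1"
    by (simp_all add: k_def)
  then have \<beta>: "0 \<le> \<beta>" "\<beta> \<le> 2 * pi"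
    by (simp_all add: \<beta>_def field_simps)
  have "u (\<theta> + \<alpha>) = u (\<theta> + \<beta>)" for \<theta>
    using periodic_int_multiple[of u "2 * pi" "\<theta> + \<beta>" k, OF per] by (simp add: \<beta>_def add.assoc)
  then have "(\<integral>\<^sup>+\<theta>. u (\<theta> + \<alpha>) \<partial>circle_measure) = (\<integral>\<^sup>+\<theta>. u (\<theta> + \<beta>) \<partial>circle_measure)" by simp
  also have "\<dots> = (\<integral>\<^sup>+\<theta>. u \<theta> \<partial>circle_measure)"
    using nn_integral_periodic_window[OF u per \<beta>] by (simp add: nn_integral_circle_measure)
  finally show ?thesis .
qed

lemma integrable_circle_shift:
  fixes f :: "real \<Rightarrow> real"
  assumes f: "integrable circle_measure f" and per: "\<And>\<theta>. f (\<theta> + 2 * pi) = f \<theta>"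
  shows "integrable circle_measure (\<lambda>\<theta>. f (\<theta> + \<alpha>))"
    and "(\<integral>\<theta>. f (\<theta> + \<alpha>) \<partial>circle_measure) = (\<integral>\<theta>. f \<theta> \<partial>circle_measure)"
proof -
  have [measurable]: "f \<in> borel_measurable borel"
    using borel_measurable_integrable[OF f] by (simp cong: measurable_cong_sets)
  have "(\<integral>\<^sup>+\<theta>. ennreal (norm (f (\<theta> + \<alpha>))) \<partial>circle_measure) = (\<integral>\<^sup>+\<theta>. ennreal (norm (f \<theta>)) \<partial>circle_measure)"
    using per by (intro nn_integral_circle_shift[of "\<lambda>\<theta>. ennreal (norm (f \<theta>))"]) auto
  then show i: "integrable circle_measure (\<lambda>\<theta>. f (\<theta> + \<alpha>))"
    using f by (auto simp: integrable_iff_bounded)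
  have "(\<integral>\<^sup>+\<theta>. ennreal (f (\<theta> + \<alpha>)) \<partial>circle_measure) = (\<integral>\<^sup>+\<theta>. ennreal (f \<theta>) \<partial>circle_measure)"
    "(\<integral>\<^sup>+\<theta>. ennreal (- f (\<theta> + \<alpha>)) \<partial>circle_measure) = (\<integral>\<^sup>+\<theta>. ennreal (- f \<theta>) \<partial>circle_measure)"
    using per nn_integral_circle_shift[of "\<lambda>\<theta>. ennreal (f \<theta>)"]
      nn_integral_circle_shift[of "\<lambda>\<theta>. ennreal (- f \<theta>)"] by auto
  then show "(\<integral>\<theta>. f (\<theta> + \<alpha>) \<partial>circle_measure) = (\<integral>\<theta>. f \<theta> \<partial>circle_measure)"
    using i f by (simp add: real_lebesgue_integral_def)
qed

text \<open>Taylor's bound \<open>sin x \<ge> x - x ^ 3 / 6\<close> together with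
  \<open>x * x \<le> 4\<close> leaves the factor \<open>1 - 4 / 6\<close>.\<close>

lemma sin_ge_third:
  fixes x :: real
  assumes "0 \<le> x" "x \<le> pi / 2"
  shows "x / 3 \<le> sin x"
proof -
  have "\<bar>sin x - x\<bar> \<le> x ^ 3 / 6"
    using Maclaurin_sin_bound[of x 3] assms by (simp add: eval_nat_numeral sin_coeff_def)
  moreover have "x < 2" using assms pi_half_less_two by linarith
  then have "x * x \<le> 2 * 2" using assms by (intro mult_mono) auto
  then have "x * (x * x) \<le> x * (2 * 2)" using assms by (intro mult_left_mono) auto
  then have "x ^ 3 \<le> 4 * x" by (simp add: power3_eq_cube mult.assoc)
  ultimately show ?thesis by linarith
qed

text \<open>The antiderivative \<open>x - x * ln (x / c)\<close> has the finite limits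
  \<open>0\<close> and \<open>c\<close> at the ends, and for an integrand of constant sign this
  already yields integrability.\<close>

lemma set_integrable_neg_ln:
  fixes c :: real
  assumes "c > 0"
  shows "set_integrable lborel {0<..<c} (\<lambda>x. - ln (x / c))"
proof -
  have "set_integrable lborel (einterval 0 (ereal c)) (\<lambda>x. - ln (x / c))"
  proof (rule interval_integral_FTC_nonneg(1)[where F = "\<lambda>x. x - x * ln (x / c)" and A = 0 and B = c])
    show "0 < ereal c" using assms by simp
    fix x :: real assume x: "0 < ereal x" "ereal x < ereal c"
    show "DERIV (\<lambda>x. x - x * ln (x / c)) x :> - ln (x / c)"
      using x assms by (auto intro!: derivative_eq_intros simp: field_simps)
    show "isCont (\<lambda>x. - ln (x / c)) x"
      using x assms by (auto intro!: continuous_intros)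
  next
    show "AE x in lborel. 0 < ereal x \<longrightarrow> ereal x < ereal c \<longrightarrow> 0 \<le> - ln (x / c)"
      using assms by (intro AE_I2) (auto simp: ln_le_zero_iff)
    \<comment> \<open>With \<open>y = c / x\<close> the term \<open>x * ln (x / c)\<close> is
      \<open>- c * (ln y / y)\<close>, which vanishes as \<open>y\<close> tends to infinity.\<close>
    have "filterlim (\<lambda>x. c * inverse x) at_top (at_right 0)"
      using assms by (intro filterlim_tendsto_pos_mult_at_top[OF tendsto_const] filterlim_inverse_at_top_right)
    then have "((\<lambda>x. ln (c * inverse x) / (c * inverse x)) \<longlongrightarrow> 0) (at_right 0)"
      by (rule filterlim_compose[OF ln_x_over_x_tendsto_0])
    then have "((\<lambda>x. x + c * (ln (c * inverse x) / (c * inverse x))) \<longlongrightarrow> 0 + c * 0) (at_right 0)"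
      by (intro tendsto_intros)
    moreover have "\<forall>\<^sub>F x in at_right 0. x + c * (ln (c * inverse x) / (c * inverse x)) = x - x * ln (x / c)"
      using eventually_at_right_less[of 0]
      by eventually_elim (use assms in \<open>simp add: ln_mult ln_div ln_inverse field_simps\<close>)
    ultimately have "((\<lambda>x. x - x * ln (x / c)) \<longlongrightarrow> 0) (at_right 0)"
      using tendsto_cong by fastforce
    then show "(((\<lambda>x. x - x * ln (x / c)) \<circ> real_of_ereal) \<longlongrightarrow> 0) (at_right 0)"
      by (simp add: zero_ereal_def ereal_tendsto_simps)
    have "((\<lambda>x. x - x * ln (x / c)) \<longlongrightarrow> c - c * ln (c / c)) (at_left c)"
      using assms by (intro tendsto_intros) auto
    then show "(((\<lambda>x. x - x * ln (x / c)) \<circ> real_of_ereal) \<longlongrightarrow> c) (at_left (ereal c))"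
      using assms by (simp add: ereal_tendsto_simps)
  qed
  then show ?thesis by (simp add: einterval_def greaterThanLessThan_def lessThan_def greaterThan_def Int_def conj_commute)
qed

text \<open>The logarithm is singular at both ends of the period. On the first half
  \<open>sin (t / 2) \<ge> t / 6\<close> gives an integrable majorant; reflection at
  \<open>pi\<close> gives one on the second half.\<close>

lemma integrable_ln_sin_half: "integrable circle_measure (\<lambda>\<theta>. ln \<bar>sin (\<theta> / 2)\<bar>)"
proof -
  \<comment> \<open>The scale comes from \<open>ln (t / 6) = ln (t / (6 * pi)) + ln pi\<close>; it
    makes \<open>f\<close> nonnegative everywhere, so that \<open>f\<close> and its reflection can
    simply be added.\<close>
  define f where "f = (\<lambda>\<theta>. indicator {0<..<6 * pi} \<theta> *\<^sub>R - ln (\<theta> / (6 * pi)) :: real)"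
  have f: "integrable lborel f"
    using set_integrable_neg_ln[of "6 * pi"] by (simp add: set_integrable_def f_def)
  then have "integrable lborel (\<lambda>\<theta>. f (2 * pi + -1 * \<theta>))"
    by (rule lborel_integrable_real_affine) simp
  with f have dom: "integrable lborel (\<lambda>\<theta>. f \<theta> + f (2 * pi + -1 * \<theta>) + 2 * ln pi * indicator {0..<2 * pi} \<theta>)"
    by (intro Bochner_Integration.integrable_add integrable_mult_right) auto
  have bound: "norm (indicator {0..<2 * pi} \<theta> *\<^sub>R ln \<bar>sin (\<theta> / 2)\<bar>) \<le>
      f \<theta> + f (2 * pi + -1 * \<theta>) + 2 * ln pi * indicator {0..<2 * pi} \<theta>" if "\<theta> \<noteq> 0" for \<theta>
  proof (cases "\<theta> \<in> {0..<2 * pi}")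
    case True
    have ln_pi: "0 \<le> ln pi" using pi_ge_two by simp
    have f0: "0 \<le> f x" for x by (auto simp: f_def ln_le_zero_iff split: split_indicator)
    have key: "- ln (sin (t / 2)) \<le> f t + ln pi" "sin (t / 2) > 0" if t: "0 < t" "t \<le> pi" for t
    proof -
      have "t / 6 \<le> sin (t / 2)" using sin_ge_third[of "t / 2"] t by simp
      moreover have "0 < t / 6" using t by simp
      ultimately have "ln (t / 6) \<le> ln (sin (t / 2))" "sin (t / 2) > 0" by auto
      moreover have "ln (t / 6) = ln (t / (6 * pi)) + ln pi"
        using t by (simp add: ln_div ln_mult)
      ultimately have "- ln (sin (t / 2)) \<le> - ln (t / (6 * pi)) + ln pi" "sin (t / 2) > 0"
        using ln_pi by linarith+
      then show "- ln (sin (t / 2)) \<le> f t + ln pi" "sin (t / 2) > 0"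
        using t by (auto simp: f_def)
    qed
    have \<theta>: "0 < \<theta>" "\<theta> < 2 * pi" using True that by auto
    have "0 < sin (\<theta> / 2) \<and> - ln (sin (\<theta> / 2)) \<le> f \<theta> + f (2 * pi + -1 * \<theta>) + 2 * ln pi"
    proof (cases "\<theta> \<le> pi")
      case True
      then show ?thesis using key[of \<theta>] \<theta> f0[of "2 * pi + -1 * \<theta>"] ln_pi by linarith
    next
      case False
      have "sin (\<theta> / 2) = sin ((2 * pi + -1 * \<theta>) / 2)"
        using sin_pi_minus[of "\<theta> / 2"] by (simp add: diff_divide_distrib)
      then have ln_eq: "ln (sin (\<theta> / 2)) = ln (sin ((2 * pi + -1 * \<theta>) / 2))" by simp
      have "0 < 2 * pi + -1 * \<theta>" "2 * pi + -1 * \<theta> \<le> pi" using \<theta> False by linarith+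
      note key[OF this]
      then show ?thesis using f0[of \<theta>] ln_pi ln_eq \<open>sin (\<theta> / 2) = _\<close> by (intro conjI) linarith+
    qed
    moreover have "ln (sin (\<theta> / 2)) \<le> 0" if "0 < sin (\<theta> / 2)" using that by (simp add: ln_le_zero_iff)
    ultimately show ?thesis using True by simp
  next
    case False
    have "0 \<le> f x" for x by (auto simp: f_def ln_le_zero_iff split: split_indicator)
    then show ?thesis using False by simp
  qed
  have "integrable lborel (\<lambda>\<theta>. indicator {0..<2 * pi} \<theta> *\<^sub>R ln \<bar>sin (\<theta> / 2)\<bar>)"
  proof (rule Bochner_Integration.integrable_bound[OF dom])
    show "AE \<theta> in lborel. norm (indicator {0..<2 * pi} \<theta> *\<^sub>R ln \<bar>sin (\<theta> / 2)\<bar>) \<le>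
        norm (f \<theta> + f (2 * pi + -1 * \<theta>) + 2 * ln pi * indicator {0..<2 * pi} \<theta>)"
      using AE_lborel_singleton[of "0::real"]
    proof eventually_elim
      case (elim \<theta>)
      from bound[OF elim] show ?case unfolding real_norm_def by linarith
    qed
  qed measurable
  then have "(\<integral>\<^sup>+\<theta>. ennreal (norm (indicator {0..<2 * pi} \<theta> *\<^sub>R ln \<bar>sin (\<theta> / 2)\<bar>)) \<partial>lborel) < \<infinity>"
    unfolding integrable_iff_bounded by blast
  also have "(\<integral>\<^sup>+\<theta>. ennreal (norm (indicator {0..<2 * pi} \<theta> *\<^sub>R ln \<bar>sin (\<theta> / 2)\<bar>)) \<partial>lborel) =
      (\<integral>\<^sup>+\<theta>. ennreal (norm (ln \<bar>sin (\<theta> / 2)\<bar>)) * indicator {0..<2 * pi} \<theta> \<partial>lborel)"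
    by (intro nn_integral_cong) (auto split: split_indicator)
  finally show ?thesis
    by (subst integrable_iff_bounded)
       (auto simp: nn_integral_circle_measure divide_ennreal_def ennreal_mult_less_top inverse_ennreal)
qed

text \<open>Classically this is \<open>- ln 2\<close>. Only comparisons between means enter the
  argument, so the constant is carried as a symbol.\<close>

definition circle_log_mean :: real where
  "circle_log_mean = (\<integral>\<theta>. ln \<bar>sin (\<theta> / 2)\<bar> \<partial>circle_measure)"

lemma countable_zeros_sin_affine:
  fixes \<phi> :: real
  shows "countable {\<theta>. sin ((\<theta> + \<phi>) / 2) = 0}"
proof -
  have "{\<theta>. sin ((\<theta> + \<phi>) / 2) = 0} \<subseteq> range (\<lambda>i::int. 2 * (of_int i * pi) - \<phi>)"
    by (auto simp: sin_zero_iff_int2 image_iff field_simps)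
  then show ?thesis by (rule countable_subset) simp
qed

lemma ln_sin_half_shift:
  shows "integrable circle_measure (\<lambda>\<theta>. ln \<bar>sin ((\<theta> + \<phi>) / 2)\<bar>)"
    and "(\<integral>\<theta>. ln \<bar>sin ((\<theta> + \<phi>) / 2)\<bar> \<partial>circle_measure) = circle_log_mean"
proof -
  have per: "ln \<bar>sin ((\<theta> + 2 * pi) / 2)\<bar> = ln \<bar>sin (\<theta> / 2)\<bar>" for \<theta> :: real
    by (simp add: add_divide_distrib)
  show "integrable circle_measure (\<lambda>\<theta>. ln \<bar>sin ((\<theta> + \<phi>) / 2)\<bar>)"
    and "(\<integral>\<theta>. ln \<bar>sin ((\<theta> + \<phi>) / 2)\<bar> \<partial>circle_measure) = circle_log_mean"
    unfolding circle_log_mean_def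
    using integrable_circle_shift[OF integrable_ln_sin_half per, of \<phi>] by auto
qed

text \<open>Writing \<open>b = cos \<phi>\<close>, the sum-to-product formula turns the logarithm into two translates of
  \<open>ln \<bar>sin (\<theta> / 2)\<bar>\<close>; in particular its mean does not depend on \<open>b\<close>.\<close>

lemma ln_cos_plus_const_inside:
  assumes "\<bar>b\<bar> \<le> 1"
  shows "integrable circle_measure (\<lambda>\<theta>. ln \<bar>cos \<theta> + b\<bar>)"
    and "(\<integral>\<theta>. ln \<bar>cos \<theta> + b\<bar> \<partial>circle_measure) = ln 2 + 2 * circle_log_mean"
proof -
  interpret finite_measure circle_measure by (rule finite_measure_circle)
  obtain \<phi> where \<phi>: "b = cos \<phi>" using assms by (metis abs_le_iff cos_arccos minus_le_iff)
  define L where "L = (\<lambda>\<theta>. ln 2 + (ln \<bar>sin ((\<theta> + (\<phi> + pi)) / 2)\<bar> + ln \<bar>sin ((\<theta> + (pi - \<phi>)) / 2)\<bar>))"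
  have i: "integrable circle_measure L"
    unfolding L_def by (intro Bochner_Integration.integrable_add ln_sin_half_shift) auto
  have prod: "cos \<theta> + b = 2 * (sin ((\<theta> + (\<phi> + pi)) / 2) * sin ((\<theta> + (pi - \<phi>)) / 2))" for \<theta>
  proof -
    have "(\<theta> + (\<phi> + pi)) / 2 = (\<theta> + \<phi>) / 2 + pi / 2" "(\<theta> + (pi - \<phi>)) / 2 = (\<theta> - \<phi>) / 2 + pi / 2"
      by (simp_all add: field_simps)
    then have "sin ((\<theta> + (\<phi> + pi)) / 2) = cos ((\<theta> + \<phi>) / 2)" "sin ((\<theta> + (pi - \<phi>)) / 2) = cos ((\<theta> - \<phi>) / 2)"
      by (simp_all only: sin_add) simp_all
    then show ?thesis by (simp add: \<phi> cos_plus_cos)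
  qed
  have "AE \<theta> in circle_measure. sin ((\<theta> + (\<phi> + pi)) / 2) \<noteq> 0"
    "AE \<theta> in circle_measure. sin ((\<theta> + (pi - \<phi>)) / 2) \<noteq> 0"
    using countable_zeros_sin_affine by (auto intro!: AE_circle_measure)
  then have ae: "AE \<theta> in circle_measure. L \<theta> = ln \<bar>cos \<theta> + b\<bar>"
  proof eventually_elim
    case (elim \<theta>)
    then show ?case unfolding prod L_def by (simp add: abs_mult ln_mult)
  qed
  have m: "L \<in> borel_measurable circle_measure" "(\<lambda>\<theta>. ln \<bar>cos \<theta> + b\<bar>) \<in> borel_measurable circle_measure"
    unfolding L_def by measurable
  show "integrable circle_measure (\<lambda>\<theta>. ln \<bar>cos \<theta> + b\<bar>)"
    using integrable_cong_AE[OF m ae] i by simp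
  have "(\<integral>\<theta>. ln \<bar>cos \<theta> + b\<bar> \<partial>circle_measure) = (\<integral>\<theta>. L \<theta> \<partial>circle_measure)"
    using integral_cong_AE[OF m ae] by simp
  also have "\<dots> = ln 2 + 2 * circle_log_mean"
    unfolding L_def
    by (simp add: ln_sin_half_shift measure_def)
  finally show "(\<integral>\<theta>. ln \<bar>cos \<theta> + b\<bar> \<partial>circle_measure) = ln 2 + 2 * circle_log_mean" .
qed

text \<open>Pairing \<theta> with \<open>\<theta> + pi\<close> gives the product
  \<open>b^2 - (cos \<theta>)^2\<close>, which for \<open>\<bar>b\<bar> > 1\<close> is at least
  \<open>(sin \<theta>)^2\<close>. Hence twice the mean is at least twice the mean of
  \<open>ln \<bar>sin \<theta>\<bar>\<close>, which is a shift of the case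
  \<open>b = 0\<close>.\<close>

lemma ln_cos_plus_const_outside:
  assumes b: "\<bar>b\<bar> > 1"
  shows "integrable circle_measure (\<lambda>\<theta>. ln \<bar>cos \<theta> + b\<bar>)"
    and "(\<integral>\<theta>. ln \<bar>cos \<theta> + b\<bar> \<partial>circle_measure) \<ge> ln 2 + 2 * circle_log_mean"
proof -
  interpret finite_measure circle_measure by (rule finite_measure_circle)
  have bnd: "\<bar>b\<bar> - 1 \<le> \<bar>cos \<theta> + b\<bar>" "\<bar>cos \<theta> + b\<bar> \<le> \<bar>b\<bar> + 1" for \<theta>
    using abs_cos_le_one[of \<theta>] by linarith+
  show i: "integrable circle_measure (\<lambda>\<theta>. ln \<bar>cos \<theta> + b\<bar>)"
  proof (rule integrable_const_bound[where B = "\<bar>ln (\<bar>b\<bar> - 1)\<bar> + \<bar>ln (\<bar>b\<bar> + 1)\<bar>"])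
    show "AE \<theta> in circle_measure. norm (ln \<bar>cos \<theta> + b\<bar>) \<le> \<bar>ln (\<bar>b\<bar> - 1)\<bar> + \<bar>ln (\<bar>b\<bar> + 1)\<bar>"
    proof (rule AE_I2)
      fix \<theta> :: real
      have "0 < \<bar>b\<bar> - 1" using b by simp
      then have "ln (\<bar>b\<bar> - 1) \<le> ln \<bar>cos \<theta> + b\<bar>" "ln \<bar>cos \<theta> + b\<bar> \<le> ln (\<bar>b\<bar> + 1)"
        using bnd[of \<theta>] by (auto intro!: ln_mono)
      then show "norm (ln \<bar>cos \<theta> + b\<bar>) \<le> \<bar>ln (\<bar>b\<bar> - 1)\<bar> + \<bar>ln (\<bar>b\<bar> + 1)\<bar>"
        unfolding real_norm_def by (intro abs_leI) linarith+
    qed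
  qed measurable
  have per: "ln \<bar>cos (\<theta> + 2 * pi) + b\<bar> = ln \<bar>cos \<theta> + b\<bar>" "ln \<bar>cos (\<theta> + 2 * pi) + 0\<bar> = ln \<bar>cos \<theta> + 0\<bar>" for \<theta>
    by simp_all
  have i0: "integrable circle_measure (\<lambda>\<theta>. ln \<bar>cos \<theta> + 0\<bar>)" by (rule ln_cos_plus_const_inside) simp
  have "2 * (ln 2 + 2 * circle_log_mean) =
      (\<integral>\<theta>. 2 * ln \<bar>cos (\<theta> + pi / 2) + 0\<bar> \<partial>circle_measure)"
    using integrable_circle_shift(2)[OF i0 per(2), of "pi / 2"] ln_cos_plus_const_inside(2)[of 0] by simp
  also have "\<dots> \<le> (\<integral>\<theta>. ln \<bar>cos \<theta> + b\<bar> + ln \<bar>cos (\<theta> + pi) + b\<bar> \<partial>circle_measure)"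
  proof (rule integral_mono_AE)
    show "integrable circle_measure (\<lambda>\<theta>. 2 * ln \<bar>cos (\<theta> + pi / 2) + 0\<bar>)"
      by (intro integrable_mult_right integrable_circle_shift(1)[OF i0 per(2)])
    show "integrable circle_measure (\<lambda>\<theta>. ln \<bar>cos \<theta> + b\<bar> + ln \<bar>cos (\<theta> + pi) + b\<bar>)"
      by (intro Bochner_Integration.integrable_add i integrable_circle_shift(1)[OF i per(1)])
    have "countable {\<theta>. cos (\<theta> + pi / 2) = 0}"
    proof -
      have "{\<theta>. cos (\<theta> + pi / 2) = 0} \<subseteq> range (\<lambda>i::int. of_int i * pi)"
        by (auto simp: cos_add sin_zero_iff_int2)
      then show ?thesis by (rule countable_subset) simp
    qed
    then have "AE \<theta> in circle_measure. cos (\<theta> + pi / 2) \<noteq> 0" by (auto intro!: AE_circle_measure)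
    then show "AE \<theta> in circle_measure. 2 * ln \<bar>cos (\<theta> + pi / 2) + 0\<bar> \<le> ln \<bar>cos \<theta> + b\<bar> + ln \<bar>cos (\<theta> + pi) + b\<bar>"
    proof eventually_elim
      case (elim \<theta>)
      have s: "cos (\<theta> + pi / 2) = - sin \<theta>" by (simp add: cos_add)
      have nz: "0 < \<bar>cos \<theta> + b\<bar>" "0 < \<bar>cos (\<theta> + pi) + b\<bar>"
        using bnd[of \<theta>] bnd[of "\<theta> + pi"] b by linarith+
      have "\<not> b\<^sup>2 \<le> 1" using b by (simp add: abs_square_le_1)
      then have "1 < b\<^sup>2" by simp
      have "(sin \<theta>)\<^sup>2 = 1 - (cos \<theta>)\<^sup>2" by (simp add: sin_squared_eq)
      also have "\<dots> \<le> \<bar>b\<^sup>2 - (cos \<theta>)\<^sup>2\<bar>" using \<open>1 < b\<^sup>2\<close> by linarith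
      also have "b\<^sup>2 - (cos \<theta>)\<^sup>2 = (cos \<theta> + b) * (cos (\<theta> + pi) + b)"
        by (simp add: algebra_simps power2_eq_square)
      finally have "ln ((sin \<theta>)\<^sup>2) \<le> ln (\<bar>cos \<theta> + b\<bar> * \<bar>cos (\<theta> + pi) + b\<bar>)"
        using elim s by (intro ln_mono) (auto simp: abs_mult)
      moreover have "ln ((sin \<theta>)\<^sup>2) = 2 * ln \<bar>sin \<theta>\<bar>"
        using elim s ln_realpow[of "\<bar>sin \<theta>\<bar>" 2] by simp
      ultimately show ?case using nz s by (simp add: ln_mult)
    qed
  qed
  also have "\<dots> = 2 * (\<integral>\<theta>. ln \<bar>cos \<theta> + b\<bar> \<partial>circle_measure)"
    using integrable_circle_shift[OF i per(1), of pi] i by (subst Bochner_Integration.integral_add) auto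
  finally show "(\<integral>\<theta>. ln \<bar>cos \<theta> + b\<bar> \<partial>circle_measure) \<ge> ln 2 + 2 * circle_log_mean" by simp
qed

lemma polar_rotation:
  fixes x y :: real
  obtains \<alpha> where "\<And>\<theta>. cos \<theta> * x - sin \<theta> * y = sqrt (x\<^sup>2 + y\<^sup>2) * cos (\<theta> + \<alpha>)"
proof -
  obtain r a where xy: "x = r * cos a" "y = r * sin a" and r: "r = sqrt (x\<^sup>2 + y\<^sup>2)"
  proof (cases "x = 0 \<and> y = 0")
    case True then show ?thesis using that[of 0 0] by simp
  next
    case False
    define r where "r = sqrt (x\<^sup>2 + y\<^sup>2)"
    have "x\<^sup>2 + y\<^sup>2 > 0" using False by (simp add: sum_power2_gt_zero_iff)
    then have r: "r > 0" "r\<^sup>2 = x\<^sup>2 + y\<^sup>2" by (simp_all add: r_def)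
    then have "(x / r)\<^sup>2 + (y / r)\<^sup>2 = 1"
      using False by (simp add: power_divide add_divide_distrib[symmetric])
    then obtain a where a: "x / r = cos a" "y / r = sin a" using sincos_total_2pi by metis
    have "x = r * cos a" "y = r * sin a" using r unfolding a[symmetric] by simp_all
    then show ?thesis using r_def by (rule that)
  qed
  have "cos \<theta> * x - sin \<theta> * y = r * cos (\<theta> + a)" for \<theta>
    unfolding xy by (simp add: cos_add algebra_simps)
  then show ?thesis unfolding r by (rule that)
qed

text \<open>In polar form the mean is \<open>ln r\<close> plus the mean of
  \<open>ln \<bar>cos \<theta> + b / r\<bar>\<close>. As a function of \<open>b\<close> it is, up to
  sign, the logarithmic potential of the arcsine law on \<open>[-r, r]\<close>: constant on that
  interval and nowhere smaller outside it.\<close>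

lemma ln_rotation_integrable_mean:
  fixes x y b :: real
  assumes xy: "x\<^sup>2 + y\<^sup>2 > 0"
  shows "integrable circle_measure (\<lambda>\<theta>. ln \<bar>cos \<theta> * x - sin \<theta> * y + b\<bar>)" (is ?I)
    and "(\<integral>\<theta>. ln \<bar>cos \<theta> * x - sin \<theta> * y + b\<bar> \<partial>circle_measure) \<ge>
      (\<integral>\<theta>. ln \<bar>cos \<theta> * x - sin \<theta> * y\<bar> \<partial>circle_measure)" (is ?M)
proof -
  interpret finite_measure circle_measure by (rule finite_measure_circle)
  define r where "r = sqrt (x\<^sup>2 + y\<^sup>2)"
  have r: "r > 0" using xy by (simp add: r_def)
  obtain \<alpha> where \<alpha>: "\<And>\<theta>. cos \<theta> * x - sin \<theta> * y = r * cos (\<theta> + \<alpha>)"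
    using polar_rotation[of x y] unfolding r_def by blast
  have base: "integrable circle_measure (\<lambda>\<theta>. ln \<bar>r * cos \<theta> + c\<bar>)"
    "(\<integral>\<theta>. ln \<bar>r * cos \<theta> + c\<bar> \<partial>circle_measure) = ln r + (\<integral>\<theta>. ln \<bar>cos \<theta> + c / r\<bar> \<partial>circle_measure)" for c
  proof -
    have i: "integrable circle_measure (\<lambda>\<theta>. ln \<bar>cos \<theta> + c / r\<bar>)"
      using ln_cos_plus_const_inside(1)[of "c / r"] ln_cos_plus_const_outside(1)[of "c / r"] by linarith
    have "countable {\<theta>. cos \<theta> + c / r = 0}"
    proof (cases "\<bar>c / r\<bar> \<le> 1")
      case True
      then obtain \<phi> where \<phi>: "c / r = cos \<phi>" by (metis abs_le_iff cos_arccos minus_le_iff)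
      have "{\<theta>. cos \<theta> + c / r = 0} \<subseteq> {\<theta>. sin ((\<theta> + (\<phi> + pi)) / 2) = 0} \<union> {\<theta>. sin ((\<theta> + (pi - \<phi>)) / 2) = 0}"
      proof
        fix \<theta> assume "\<theta> \<in> {\<theta>. cos \<theta> + c / r = 0}"
        then have "cos ((\<theta> + \<phi>) / 2) = 0 \<or> cos ((\<theta> - \<phi>) / 2) = 0" by (simp add: \<phi> cos_plus_cos)
        moreover have "(\<theta> + (\<phi> + pi)) / 2 = (\<theta> + \<phi>) / 2 + pi / 2" "(\<theta> + (pi - \<phi>)) / 2 = (\<theta> - \<phi>) / 2 + pi / 2"
          by (simp_all add: field_simps)
        then have "sin ((\<theta> + (\<phi> + pi)) / 2) = cos ((\<theta> + \<phi>) / 2)" "sin ((\<theta> + (pi - \<phi>)) / 2) = cos ((\<theta> - \<phi>) / 2)"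
          by (simp_all only: sin_add) simp_all
        ultimately show "\<theta> \<in> {\<theta>. sin ((\<theta> + (\<phi> + pi)) / 2) = 0} \<union> {\<theta>. sin ((\<theta> + (pi - \<phi>)) / 2) = 0}"
          by auto
      qed
      then show ?thesis by (rule countable_subset) (simp add: countable_zeros_sin_affine)
    next
      case False
      have "cos \<theta> + c / r \<noteq> 0" for \<theta> using False abs_cos_le_one[of \<theta>] by linarith
      then show ?thesis by simp
    qed
    then have "AE \<theta> in circle_measure. cos \<theta> + c / r \<noteq> 0" by (auto intro!: AE_circle_measure)
    then have ae: "AE \<theta> in circle_measure. ln r + ln \<bar>cos \<theta> + c / r\<bar> = ln \<bar>r * cos \<theta> + c\<bar>"
    proof eventually_elim
      case (elim \<theta>)
      have "r * cos \<theta> + c = r * (cos \<theta> + c / r)" using r by (simp add: field_simps)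
      then show ?case using r elim by (simp add: abs_mult ln_mult)
    qed
    have m: "(\<lambda>\<theta>. ln r + ln \<bar>cos \<theta> + c / r\<bar>) \<in> borel_measurable circle_measure"
      "(\<lambda>\<theta>. ln \<bar>r * cos \<theta> + c\<bar>) \<in> borel_measurable circle_measure"
      by measurable
    have i': "integrable circle_measure (\<lambda>\<theta>. ln r + ln \<bar>cos \<theta> + c / r\<bar>)"
      using i by (intro Bochner_Integration.integrable_add) auto
    show "integrable circle_measure (\<lambda>\<theta>. ln \<bar>r * cos \<theta> + c\<bar>)"
      using integrable_cong_AE[OF m ae] i' by simp
    have "(\<integral>\<theta>. ln \<bar>r * cos \<theta> + c\<bar> \<partial>circle_measure) = (\<integral>\<theta>. ln r + ln \<bar>cos \<theta> + c / r\<bar> \<partial>circle_measure)"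
      using integral_cong_AE[OF m ae] by simp
    also have "\<dots> = ln r + (\<integral>\<theta>. ln \<bar>cos \<theta> + c / r\<bar> \<partial>circle_measure)"
      using i by (subst Bochner_Integration.integral_add) (auto simp: measure_def)
    finally show "(\<integral>\<theta>. ln \<bar>r * cos \<theta> + c\<bar> \<partial>circle_measure) = ln r + (\<integral>\<theta>. ln \<bar>cos \<theta> + c / r\<bar> \<partial>circle_measure)" .
  qed
  have per: "ln \<bar>r * cos (\<theta> + 2 * pi) + c\<bar> = ln \<bar>r * cos \<theta> + c\<bar>" for \<theta> c by simp
  have shift: "integrable circle_measure (\<lambda>\<theta>. ln \<bar>r * cos (\<theta> + \<alpha>) + c\<bar>)"
    "(\<integral>\<theta>. ln \<bar>r * cos (\<theta> + \<alpha>) + c\<bar> \<partial>circle_measure) = (\<integral>\<theta>. ln \<bar>r * cos \<theta> + c\<bar> \<partial>circle_measure)" for c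
    using integrable_circle_shift[OF base(1) per] by auto
  show ?I using shift(1)[of b] by (simp add: \<alpha>)
  have "(\<integral>\<theta>. ln \<bar>cos \<theta> + 0 / r\<bar> \<partial>circle_measure) = ln 2 + 2 * circle_log_mean"
    by (rule ln_cos_plus_const_inside) simp
  also have "\<dots> \<le> (\<integral>\<theta>. ln \<bar>cos \<theta> + b / r\<bar> \<partial>circle_measure)"
    using ln_cos_plus_const_inside(2)[of "b / r"] ln_cos_plus_const_outside(2)[of "b / r"] by linarith
  finally have "(\<integral>\<theta>. ln \<bar>r * cos \<theta> + 0\<bar> \<partial>circle_measure) \<le> (\<integral>\<theta>. ln \<bar>r * cos \<theta> + b\<bar> \<partial>circle_measure)"
    unfolding base(2) by simp
  then show ?M using shift(2)[of 0] shift(2)[of b] by (simp add: \<alpha>)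
qed

section \<open>Rotation invariance and integrability of the logarithm\<close>

text \<open>The orientation is chosen so that for \<open>i \<noteq> j\<close> the vector
  \<open>axis i 1\<close> turns towards \<open>axis j 1\<close>; the angle \<open>arctan s\<close>
  then reaches the direction of \<open>axis i 1 + s *\<^sub>R axis j 1\<close>.\<close>

definition plane_rotation :: "'n \<Rightarrow> 'n \<Rightarrow> real \<Rightarrow> real^'n \<Rightarrow> real^'n::finite" where
  "plane_rotation i j \<theta> x = (\<chi> k. if k = i then cos \<theta> * x $ i - sin \<theta> * x $ j
     else if k = j then sin \<theta> * x $ i + cos \<theta> * x $ j else x $ k)"

lemma plane_rotation_nth:
  "plane_rotation i j \<theta> x $ i = cos \<theta> * x $ i - sin \<theta> * x $ j"
  "i \<noteq> j \<Longrightarrow> plane_rotation i j \<theta> x $ j = sin \<theta> * x $ i + cos \<theta> * x $ j"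
  "k \<noteq> i \<Longrightarrow> k \<noteq> j \<Longrightarrow> plane_rotation i j \<theta> x $ k = x $ k"
  by (auto simp: plane_rotation_def)

lemma sum_split_two:
  fixes f :: "'n::finite \<Rightarrow> 'b::comm_monoid_add"
  assumes "i \<noteq> j"
  shows "sum f UNIV = f i + (f j + sum f (UNIV - {i, j}))"
proof -
  have "sum f UNIV = f i + sum f (UNIV - {i})" by (rule sum.remove) auto
  also have "sum f (UNIV - {i}) = f j + sum f (UNIV - {i} - {j})"
    using assms by (intro sum.remove) auto
  also have "UNIV - {i} - {j} = UNIV - {i, j}" by blast
  finally show ?thesis .
qed

lemma orthogonal_plane_rotation:
  assumes "i \<noteq> j"
  shows "orthogonal_transformation (plane_rotation i j \<theta>)"
  unfolding orthogonal_transformation_def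
proof (intro conjI allI)
  show "linear (plane_rotation i j \<theta>)"
    by (rule linearI) (auto simp: plane_rotation_def vec_eq_iff algebra_simps)
  fix v w :: "real^'a"
  have "plane_rotation i j \<theta> v \<bullet> plane_rotation i j \<theta> w =
      (\<Sum>k\<in>UNIV. plane_rotation i j \<theta> v $ k * plane_rotation i j \<theta> w $ k)"
    by (simp add: inner_vec_def)
  also have "\<dots> = (cos \<theta> * v $ i - sin \<theta> * v $ j) * (cos \<theta> * w $ i - sin \<theta> * w $ j) +
      ((sin \<theta> * v $ i + cos \<theta> * v $ j) * (sin \<theta> * w $ i + cos \<theta> * w $ j) +
       (\<Sum>k\<in>UNIV - {i, j}. v $ k * w $ k))"
    unfolding sum_split_two[OF assms] using assms
    by (simp add: plane_rotation_nth)
  also have "\<dots> = ((cos \<theta>)\<^sup>2 + (sin \<theta>)\<^sup>2) * (v $ i * w $ i) + (((cos \<theta>)\<^sup>2 + (sin \<theta>)\<^sup>2) * (v $ j * w $ j) +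
       (\<Sum>k\<in>UNIV - {i, j}. v $ k * w $ k))"
    by algebra
  also have "\<dots> = (\<Sum>k\<in>UNIV. v $ k * w $ k)"
    unfolding sum_split_two[OF assms] by simp
  finally show "plane_rotation i j \<theta> v \<bullet> plane_rotation i j \<theta> w = v \<bullet> w"
    by (simp add: inner_vec_def)
qed

lemma nn_integral_sphere_orthogonal:
  fixes f :: "'a::euclidean_space \<Rightarrow> ennreal" and T :: "'a \<Rightarrow> 'a"
  assumes T: "orthogonal_transformation T" and f: "f \<in> borel_measurable borel"
  shows "(\<integral>\<^sup>+x. f (T x) \<partial>sphere_measure) = (\<integral>\<^sup>+x. f x \<partial>sphere_measure)"
proof -
  have "(\<integral>\<^sup>+x. f x \<partial>distr sphere_measure borel T) = (\<integral>\<^sup>+x. f (T x) \<partial>sphere_measure)"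
    using f orthogonal_transformation_measurable[OF T] by (intro nn_integral_distr) auto
  then show ?thesis by (simp add: distr_sphere_measure[OF T])
qed

lemma integral_sphere_orthogonal:
  fixes f :: "'a::euclidean_space \<Rightarrow> real" and T :: "'a \<Rightarrow> 'a"
  assumes T: "orthogonal_transformation T" and f: "f \<in> borel_measurable borel"
  shows "(\<integral>x. f (T x) \<partial>sphere_measure) = (\<integral>x. f x \<partial>sphere_measure)"
    and "integrable sphere_measure (\<lambda>x. f (T x)) \<longleftrightarrow> integrable sphere_measure f"
proof -
  have T': "T \<in> measurable sphere_measure borel"
    using orthogonal_transformation_measurable[OF T] by simp
  show "(\<integral>x. f (T x) \<partial>sphere_measure) = (\<integral>x. f x \<partial>sphere_measure)"
    using integral_distr[OF T' f] by (simp add: distr_sphere_measure[OF T])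
  show "integrable sphere_measure (\<lambda>x. f (T x)) \<longleftrightarrow> integrable sphere_measure f"
    using integrable_distr_eq[OF T' f] by (simp add: distr_sphere_measure[OF T])
qed

lemma plane_rotation_measurable [measurable]:
  "(\<lambda>p. plane_rotation i j (fst p) (snd p)) \<in> borel_measurable (borel \<Otimes>\<^sub>M borel)"
proof -
  have "continuous_on UNIV (\<lambda>p. plane_rotation i j (fst p) (snd p) $ k)" for k
    by (cases "k = i"; cases "k = j") (auto simp: plane_rotation_def intro!: continuous_intros)
  then have "continuous_on UNIV (\<lambda>p. \<chi> k. plane_rotation i j (fst p) (snd p) $ k)"
    by (rule continuous_on_vec_lambda)
  then have "(\<lambda>p. plane_rotation i j (fst p) (snd p)) \<in> borel_measurable borel"
    by (intro borel_measurable_continuous_onI) simp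
  then show ?thesis by (simp add: borel_prod)
qed

lemma measurable_pair_circle_sphere:
  "measurable (circle_measure \<Otimes>\<^sub>M sphere_measure) N = measurable (borel \<Otimes>\<^sub>M borel) N"
  by (intro measurable_cong_sets sets_pair_measure_cong) auto

lemma pair_sigma_finite_circle_sphere:
  "pair_sigma_finite circle_measure (sphere_measure :: 'a::euclidean_space measure)"
  by (simp add: pair_sigma_finite_def finite_measure.axioms(1) finite_measure_circle finite_sphere_measure)

text \<open>Fubini combined with rotation invariance. This takes the place of slicing the sphere
  into circles: questions about the sphere reduce to means over one angle.\<close>

lemma nn_integral_sphere_average:
  fixes f :: "real^'n::finite \<Rightarrow> ennreal"
  assumes ij: "i \<noteq> j" and f [measurable]: "f \<in> borel_measurable borel"
  shows "(\<integral>\<^sup>+\<xi>. f \<xi> \<partial>sphere_measure) = (\<integral>\<^sup>+\<xi>. \<integral>\<^sup>+\<theta>. f (plane_rotation i j \<theta> \<xi>) \<partial>circle_measure \<partial>sphere_measure)"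
proof -
  interpret pair_sigma_finite circle_measure "sphere_measure :: (real^'n) measure"
    by (rule pair_sigma_finite_circle_sphere)
  have m: "(\<lambda>p. f (plane_rotation i j (fst p) (snd p))) \<in> borel_measurable (circle_measure \<Otimes>\<^sub>M sphere_measure)"
    unfolding measurable_pair_circle_sphere by measurable
  have "(\<integral>\<^sup>+\<xi>. \<integral>\<^sup>+\<theta>. f (plane_rotation i j \<theta> \<xi>) \<partial>circle_measure \<partial>sphere_measure) =
      (\<integral>\<^sup>+\<theta>. \<integral>\<^sup>+\<xi>. f (plane_rotation i j \<theta> \<xi>) \<partial>sphere_measure \<partial>circle_measure)"
    using Fubini[OF m] by simp
  also have "\<dots> = (\<integral>\<^sup>+\<theta>. \<integral>\<^sup>+\<xi>. f \<xi> \<partial>(sphere_measure :: (real^'n) measure) \<partial>circle_measure)"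
    using nn_integral_sphere_orthogonal[OF orthogonal_plane_rotation[OF ij] f] by simp
  also have "\<dots> = (\<integral>\<^sup>+\<xi>. f \<xi> \<partial>sphere_measure)" by simp
  finally show ?thesis ..
qed

lemma integral_sphere_average:
  fixes f :: "real^'n::finite \<Rightarrow> real"
  assumes ij: "i \<noteq> j" and f: "integrable sphere_measure f"
  shows "integrable sphere_measure (\<lambda>\<xi>. \<integral>\<theta>. f (plane_rotation i j \<theta> \<xi>) \<partial>circle_measure)"
    and "(\<integral>\<xi>. f \<xi> \<partial>sphere_measure) = (\<integral>\<xi>. \<integral>\<theta>. f (plane_rotation i j \<theta> \<xi>) \<partial>circle_measure \<partial>sphere_measure)"
proof -
  interpret pair_sigma_finite circle_measure "sphere_measure :: (real^'n) measure"
    by (rule pair_sigma_finite_circle_sphere)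
  interpret circle: finite_measure circle_measure by (rule finite_measure_circle)
  have fm [measurable]: "f \<in> borel_measurable borel"
    using borel_measurable_integrable[OF f] by (simp cong: measurable_cong_sets)
  note rot = orthogonal_plane_rotation[OF ij]
  have m: "(\<lambda>p. f (plane_rotation i j (fst p) (snd p))) \<in> borel_measurable (circle_measure \<Otimes>\<^sub>M sphere_measure)"
    unfolding measurable_pair_circle_sphere by measurable
  have "integrable (circle_measure \<Otimes>\<^sub>M sphere_measure) (\<lambda>p. f (plane_rotation i j (fst p) (snd p)))"
  proof (rule Fubini_integrable[OF m])
    have "(\<integral>y. norm (f (plane_rotation i j x y)) \<partial>sphere_measure) = (\<integral>y. norm (f y) \<partial>sphere_measure)" for x
      by (rule integral_sphere_orthogonal(1)[OF rot, of "\<lambda>y. norm (f y)"]) measurable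
    then show "integrable circle_measure
        (\<lambda>x. \<integral>y. norm (f (plane_rotation i j (fst (x, y)) (snd (x, y)))) \<partial>sphere_measure)" by simp
    show "AE x in circle_measure. integrable sphere_measure (\<lambda>y. f (plane_rotation i j (fst (x, y)) (snd (x, y))))"
      using f by (simp add: integral_sphere_orthogonal(2)[OF rot fm])
  qed
  then have i: "integrable (circle_measure \<Otimes>\<^sub>M sphere_measure) (\<lambda>(\<theta>, \<xi>). f (plane_rotation i j \<theta> \<xi>))"
    by (simp add: case_prod_unfold)
  show "integrable sphere_measure (\<lambda>\<xi>. \<integral>\<theta>. f (plane_rotation i j \<theta> \<xi>) \<partial>circle_measure)"
    by (rule integrable_snd[OF i])
  have "(\<integral>\<xi>. \<integral>\<theta>. f (plane_rotation i j \<theta> \<xi>) \<partial>circle_measure \<partial>sphere_measure) =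
      (\<integral>\<theta>. \<integral>\<xi>. f (plane_rotation i j \<theta> \<xi>) \<partial>sphere_measure \<partial>circle_measure)"
    by (rule Fubini_integral[OF i])
  also have "\<dots> = (\<integral>\<theta>. (\<integral>\<xi>. f \<xi> \<partial>sphere_measure) \<partial>circle_measure)"
    by (simp add: integral_sphere_orthogonal(1)[OF rot fm])
  also have "\<dots> = (\<integral>\<xi>. f \<xi> \<partial>sphere_measure)" by (simp add: measure_def)
  finally show "(\<integral>\<xi>. f \<xi> \<partial>sphere_measure) = (\<integral>\<xi>. \<integral>\<theta>. f (plane_rotation i j \<theta> \<xi>) \<partial>circle_measure \<partial>sphere_measure)" ..
qed

text \<open>Infinite at \<open>0\<close>, so that finiteness of an integral also excludes that the argument vanishes
  on a set of positive measure, which \<open>ln 0 = 0\<close> would hide.\<close>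

definition log_weight :: "real \<Rightarrow> ennreal" where
  "log_weight x = (if x = 0 then \<infinity> else ennreal \<bar>ln \<bar>x\<bar>\<bar>)"

lemma log_weight_measurable [measurable]: "log_weight \<in> borel_measurable borel"
  unfolding log_weight_def by measurable

lemma log_weight_mult:
  assumes "r > 0"
  shows "log_weight (r * x) \<le> ennreal \<bar>ln r\<bar> + log_weight x"
proof (cases "x = 0")
  case False
  have "\<bar>ln \<bar>r * x\<bar>\<bar> \<le> \<bar>ln r\<bar> + \<bar>ln \<bar>x\<bar>\<bar>"
    using assms False by (simp add: abs_mult ln_mult)
  then show ?thesis using assms False by (simp add: log_weight_def ennreal_leI flip: ennreal_plus)
qed (simp add: log_weight_def)

lemma nn_integral_log_weight_cos: "(\<integral>\<^sup>+\<theta>. log_weight (cos \<theta>) \<partial>circle_measure) < \<infinity>"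
proof -
  have "countable {\<theta> :: real. cos \<theta> = 0}"
  proof -
    have "{\<theta> :: real. cos \<theta> = 0} \<subseteq> range (\<lambda>i::int. of_int i * pi + pi / 2)"
      by (auto simp: cos_zero_iff_int2 image_iff)
    then show ?thesis by (rule countable_subset) simp
  qed
  then have "AE \<theta> in circle_measure. cos \<theta> \<noteq> 0" by (auto intro!: AE_circle_measure)
  then have "(\<integral>\<^sup>+\<theta>. log_weight (cos \<theta>) \<partial>circle_measure) = (\<integral>\<^sup>+\<theta>. ennreal (norm (ln \<bar>cos \<theta> + 0\<bar>)) \<partial>circle_measure)"
    by (intro nn_integral_cong_AE) (auto simp: log_weight_def)
  then show ?thesis
    using ln_cos_plus_const_inside(1)[of 0] by (simp add: integrable_iff_bounded)
qed

lemma nn_integral_log_weight_rotation: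
  fixes x y :: real
  assumes "x\<^sup>2 + y\<^sup>2 > 0"
  shows "(\<integral>\<^sup>+\<theta>. log_weight (cos \<theta> * x - sin \<theta> * y) \<partial>circle_measure) \<le>
    ennreal \<bar>ln (sqrt (x\<^sup>2 + y\<^sup>2))\<bar> + (\<integral>\<^sup>+\<theta>. log_weight (cos \<theta>) \<partial>circle_measure)"
proof -
  define r where "r = sqrt (x\<^sup>2 + y\<^sup>2)"
  have r: "r > 0" using assms by (simp add: r_def)
  obtain \<alpha> where \<alpha>: "\<And>\<theta>. cos \<theta> * x - sin \<theta> * y = r * cos (\<theta> + \<alpha>)"
    using polar_rotation[of x y] unfolding r_def by blast
  have "(\<integral>\<^sup>+\<theta>. log_weight (cos \<theta> * x - sin \<theta> * y) \<partial>circle_measure) \<le>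
      (\<integral>\<^sup>+\<theta>. ennreal \<bar>ln r\<bar> + log_weight (cos (\<theta> + \<alpha>)) \<partial>circle_measure)"
    unfolding \<alpha> by (intro nn_integral_mono log_weight_mult r)
  also have "\<dots> = ennreal \<bar>ln r\<bar> + (\<integral>\<^sup>+\<theta>. log_weight (cos (\<theta> + \<alpha>)) \<partial>circle_measure)"
    by (subst nn_integral_add) auto
  also have "(\<integral>\<^sup>+\<theta>. log_weight (cos (\<theta> + \<alpha>)) \<partial>circle_measure) = (\<integral>\<^sup>+\<theta>. log_weight (cos \<theta>) \<partial>circle_measure)"
    by (rule nn_integral_circle_shift[of "\<lambda>\<theta>. log_weight (cos \<theta>)"]) auto
  finally show ?thesis by (simp add: r_def)
qed

lemma norm_sq_sum: "(norm (x :: real^'n::finite))\<^sup>2 = (\<Sum>k\<in>UNIV. (x $ k)\<^sup>2)"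
  by (simp add: norm_eq_sqrt_inner inner_vec_def power2_eq_square sum_nonneg)

text \<open>The circle mean in the plane of \<open>i\<close> and \<open>j\<close> is bounded only as
  long as the radius \<open>sqrt (\<xi>_i^2 + \<xi>_j^2)\<close> stays away from \<open>0\<close>.
  The sphere is therefore covered by the sets \<open>P j\<close>, on which the squared radius is at
  least \<open>1 / CARD('n)\<close>; each is invariant under the rotations used on it.\<close>

lemma nn_integral_sphere_log_weight:
  fixes i :: "'n::finite"
  assumes n: "CARD('n) \<ge> 2"
  shows "(\<integral>\<^sup>+\<xi>. log_weight (\<xi> $ i) \<partial>(sphere_measure :: (real^'n) measure)) < \<infinity>"
proof -
  let ?\<sigma> = "sphere_measure :: (real^'n) measure"
  define c where "c = 1 / real CARD('n)"
  have c: "0 < c" "c \<le> 1" using n by (simp_all add: c_def)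
  define P where "P = (\<lambda>j (\<xi> :: real^'n). c \<le> (\<xi> $ i)\<^sup>2 + (\<xi> $ j)\<^sup>2)"
  define B where "B = ennreal \<bar>ln (sqrt c)\<bar> + (\<integral>\<^sup>+\<theta>. log_weight (cos \<theta>) \<partial>circle_measure)"
  have B: "B < \<infinity>" using nn_integral_log_weight_cos by (simp add: B_def less_top[symmetric])
  have piece: "(\<integral>\<^sup>+\<xi>. log_weight (\<xi> $ i) * indicator {\<xi>. P j \<xi>} \<xi> \<partial>?\<sigma>) < \<infinity>" if j: "j \<noteq> i" for j
  proof -
    have [measurable]: "Measurable.pred borel (P j)" unfolding P_def by measurable
    have P_rot: "P j (plane_rotation i j \<theta> \<xi>) = P j \<xi>" for \<theta> \<xi>
    proof -
      have "(plane_rotation i j \<theta> \<xi> $ i)\<^sup>2 + (plane_rotation i j \<theta> \<xi> $ j)\<^sup>2 =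
          ((cos \<theta>)\<^sup>2 + (sin \<theta>)\<^sup>2) * ((\<xi> $ i)\<^sup>2 + (\<xi> $ j)\<^sup>2)"
        unfolding plane_rotation_nth(1) plane_rotation_nth(2)[OF not_sym[OF j]] by algebra
      then show ?thesis by (simp add: P_def)
    qed
    have "(\<integral>\<^sup>+\<xi>. log_weight (\<xi> $ i) * indicator {\<xi>. P j \<xi>} \<xi> \<partial>?\<sigma>) =
        (\<integral>\<^sup>+\<xi>. \<integral>\<^sup>+\<theta>. log_weight (plane_rotation i j \<theta> \<xi> $ i) * indicator {\<xi>. P j \<xi>} (plane_rotation i j \<theta> \<xi>)
           \<partial>circle_measure \<partial>?\<sigma>)"
      using j by (intro nn_integral_sphere_average) auto
    also have "\<dots> \<le> (\<integral>\<^sup>+\<xi>. B \<partial>?\<sigma>)"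
    proof (rule nn_integral_mono_AE)
      show "AE \<xi> in ?\<sigma>. (\<integral>\<^sup>+\<theta>. log_weight (plane_rotation i j \<theta> \<xi> $ i) *
          indicator {\<xi>. P j \<xi>} (plane_rotation i j \<theta> \<xi>) \<partial>circle_measure) \<le> B"
        using AE_sphere_measure
      proof eventually_elim
        case (elim \<xi>)
        show ?case
        proof (cases "P j \<xi>")
          case True
          have "(\<xi> $ i)\<^sup>2 + (\<xi> $ j)\<^sup>2 \<le> (norm \<xi>)\<^sup>2"
            unfolding norm_sq_sum sum_split_two[OF not_sym[OF j]] by (simp add: sum_nonneg)
          then have le: "(\<xi> $ i)\<^sup>2 + (\<xi> $ j)\<^sup>2 \<le> 1" "c \<le> (\<xi> $ i)\<^sup>2 + (\<xi> $ j)\<^sup>2"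
            using elim True by (simp_all add: P_def)
          then have "\<bar>ln (sqrt ((\<xi> $ i)\<^sup>2 + (\<xi> $ j)\<^sup>2))\<bar> \<le> \<bar>ln (sqrt c)\<bar>"
            using c by (simp add: ln_sqrt)
          moreover have "(\<integral>\<^sup>+\<theta>. log_weight (cos \<theta> * \<xi> $ i - sin \<theta> * \<xi> $ j) \<partial>circle_measure) \<le>
              ennreal \<bar>ln (sqrt ((\<xi> $ i)\<^sup>2 + (\<xi> $ j)\<^sup>2))\<bar> + (\<integral>\<^sup>+\<theta>. log_weight (cos \<theta>) \<partial>circle_measure)"
            using c le by (intro nn_integral_log_weight_rotation) linarith
          ultimately have "(\<integral>\<^sup>+\<theta>. log_weight (cos \<theta> * \<xi> $ i - sin \<theta> * \<xi> $ j) \<partial>circle_measure) \<le> B"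
            unfolding B_def by (meson add_right_mono ennreal_leI order_trans)
          then show ?thesis using True by (simp add: P_rot plane_rotation_nth)
        qed (simp add: P_rot)
      qed
    qed
    also have "\<dots> < \<infinity>"
      using B finite_measure.emeasure_finite[OF finite_sphere_measure, of "UNIV :: (real^'n) set"]
      by (simp add: ennreal_mult_less_top less_top)
    finally show ?thesis .
  qed
  have "(\<integral>\<^sup>+\<xi>. log_weight (\<xi> $ i) \<partial>?\<sigma>) \<le>
      (\<integral>\<^sup>+\<xi>. (\<Sum>j\<in>UNIV - {i}. log_weight (\<xi> $ i) * indicator {\<xi>. P j \<xi>} \<xi>) \<partial>?\<sigma>)"
  proof (rule nn_integral_mono_AE)
    show "AE \<xi> in ?\<sigma>. log_weight (\<xi> $ i) \<le> (\<Sum>j\<in>UNIV - {i}. log_weight (\<xi> $ i) * indicator {\<xi>. P j \<xi>} \<xi>)"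
      using AE_sphere_measure
    proof eventually_elim
      case (elim \<xi>)
      have "\<exists>j\<in>UNIV - {i}. P j \<xi>"
      proof (rule ccontr)
        assume neg: "\<not> ?thesis"
        \<comment> \<open>A second index \<open>k\<close> is needed to bound the square of
          coordinate \<open>i\<close> itself: \<open>P\<close> is negated only for indices other
          than \<open>i\<close>.\<close>
        have "UNIV \<noteq> {i}" using n by (metis card.empty card.insert empty_iff finite.emptyI numeral_2_eq_2 Suc_n_not_le_n One_nat_def)
        then obtain k where k: "k \<noteq> i" by blast
        have "(\<xi> $ j)\<^sup>2 < c" for j
        proof (cases "j = i")
          case True
          have "(\<xi> $ i)\<^sup>2 + (\<xi> $ k)\<^sup>2 < c" using neg k by (auto simp: P_def not_le)
          then show ?thesis unfolding True using zero_le_power2[of "\<xi> $ k"] by linarith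
        next
          case False
          then have "(\<xi> $ i)\<^sup>2 + (\<xi> $ j)\<^sup>2 < c" using neg by (auto simp: P_def not_le)
          then show ?thesis using zero_le_power2[of "\<xi> $ i"] by linarith
        qed
        then have "(\<Sum>j\<in>UNIV. (\<xi> $ j)\<^sup>2) < (\<Sum>j\<in>(UNIV :: 'n set). c)"
          by (intro sum_strict_mono) auto
        also have "\<dots> = 1" by (simp add: c_def)
        finally show False using elim norm_sq_sum[of \<xi>] by simp
      qed
      then obtain j where j: "j \<in> UNIV - {i}" "P j \<xi>" by blast
      have "log_weight (\<xi> $ i) = log_weight (\<xi> $ i) * indicator {\<xi>. P j \<xi>} \<xi>" using j by simp
      also have "\<dots> \<le> (\<Sum>j\<in>UNIV - {i}. log_weight (\<xi> $ i) * indicator {\<xi>. P j \<xi>} \<xi>)"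
        using j by (intro member_le_sum) auto
      finally show ?case .
    qed
  qed
  also have "\<dots> = (\<Sum>j\<in>UNIV - {i}. \<integral>\<^sup>+\<xi>. log_weight (\<xi> $ i) * indicator {\<xi>. P j \<xi>} \<xi> \<partial>?\<sigma>)"
    unfolding P_def by (rule nn_integral_sum) measurable
  also have "\<dots> < \<infinity>" using piece by (simp add: ennreal_sum_less_top)
  finally show ?thesis .
qed

lemma orthogonal_transformation_axis:
  fixes v :: "real^'n::finite" and i :: 'n
  assumes "v \<noteq> 0"
  obtains T :: "real^'n \<Rightarrow> real^'n"
  where "orthogonal_transformation T" "\<And>\<xi>. v \<bullet> T \<xi> = norm v * \<xi> $ i"
proof -
  obtain T :: "real^'n \<Rightarrow> real^'n" where T: "orthogonal_transformation T" "T (axis i 1) = v /\<^sub>R norm v"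
    using orthogonal_transformation_exists_1[of "axis i 1 :: real^'n" "v /\<^sub>R norm v"] assms by auto
  have "v \<bullet> T \<xi> = norm v * \<xi> $ i" for \<xi>
  proof -
    have "v = norm v *\<^sub>R T (axis i 1)" using T assms by simp
    then have "v \<bullet> T \<xi> = norm v * (T (axis i 1) \<bullet> T \<xi>)" by (metis inner_scaleR_left)
    also have "T (axis i 1) \<bullet> T \<xi> = axis i 1 \<bullet> \<xi>"
      using T(1) by (simp add: orthogonal_transformation_def)
    finally show ?thesis by (simp add: inner_axis')
  qed
  then show ?thesis using T(1) that by blast
qed

text \<open>A rotation takes \<open>v\<close> to a multiple of a coordinate axis. There the finite
  integral of \<open>log_weight\<close> yields both claims, since \<open>log_weight\<close> is
  infinite where the inner product vanishes and dominates the logarithm everywhere.\<close>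

lemma ln_inner_sphere:
  fixes v :: "real^'n::finite"
  assumes n: "CARD('n) \<ge> 2" and v: "v \<noteq> 0"
  shows "AE \<xi> in sphere_measure. v \<bullet> \<xi> \<noteq> 0"
    and "integrable sphere_measure (\<lambda>\<xi>. ln \<bar>v \<bullet> \<xi>\<bar>)"
proof -
  fix i :: 'n
  obtain T where T: "orthogonal_transformation T" and vT: "\<And>\<xi>. v \<bullet> T \<xi> = norm v * \<xi> $ i"
    using orthogonal_transformation_axis[OF v] by blast
  have "(\<integral>\<^sup>+\<xi>. log_weight (v \<bullet> \<xi>) \<partial>sphere_measure) = (\<integral>\<^sup>+\<xi>. log_weight (v \<bullet> T \<xi>) \<partial>sphere_measure)"
    by (rule nn_integral_sphere_orthogonal[OF T, symmetric]) measurable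
  also have "\<dots> \<le> (\<integral>\<^sup>+\<xi>. ennreal \<bar>ln (norm v)\<bar> + log_weight (\<xi> $ i) \<partial>(sphere_measure :: (real^'n) measure))"
    unfolding vT using v by (intro nn_integral_mono log_weight_mult) auto
  also have "\<dots> = (\<integral>\<^sup>+\<xi>. ennreal \<bar>ln (norm v)\<bar> \<partial>(sphere_measure :: (real^'n) measure)) +
      (\<integral>\<^sup>+\<xi>. log_weight (\<xi> $ i) \<partial>(sphere_measure :: (real^'n) measure))"
    by (rule nn_integral_add) auto
  also have "\<dots> < \<infinity>"
    using nn_integral_sphere_log_weight[OF n, of i]
      finite_measure.emeasure_finite[OF finite_sphere_measure, of "UNIV :: (real^'n) set"]
    by (simp add: ennreal_mult_less_top less_top)
  finally have fin: "(\<integral>\<^sup>+\<xi>. log_weight (v \<bullet> \<xi>) \<partial>sphere_measure) < \<infinity>" .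
  then have "AE \<xi> in sphere_measure. log_weight (v \<bullet> \<xi>) \<noteq> \<infinity>"
    by (intro nn_integral_PInf_AE) auto
  then show "AE \<xi> in sphere_measure. v \<bullet> \<xi> \<noteq> 0"
    by eventually_elim (auto simp: log_weight_def)
  have "(\<integral>\<^sup>+\<xi>. ennreal (norm (ln \<bar>v \<bullet> \<xi>\<bar>)) \<partial>sphere_measure) \<le> (\<integral>\<^sup>+\<xi>. log_weight (v \<bullet> \<xi>) \<partial>sphere_measure)"
    by (intro nn_integral_mono) (simp add: log_weight_def)
  then show "integrable sphere_measure (\<lambda>\<xi>. ln \<bar>v \<bullet> \<xi>\<bar>)"
    using fin by (subst integrable_iff_bounded) (auto intro: order_le_less_trans)
qed

section \<open>Second derivatives\<close>

text \<open>The first derivative is required on a whole neighbourhood, the second only at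
  \<open>0\<close>. This is what makes the iterated \<open>deriv\<close> inside
  \<open>laplacian\<close> meaningful, as \<open>deriv\<close> is unspecified where no derivative
  exists.\<close>

definition has_second_derivative :: "(real \<Rightarrow> real) \<Rightarrow> real \<Rightarrow> bool" where
  "has_second_derivative f D \<longleftrightarrow> (\<exists>f'. (\<forall>\<^sub>F s in nhds 0. (f has_real_derivative f' s) (at s)) \<and>
     (f' has_real_derivative D) (at 0))"

lemma partial_deriv_second:
  fixes F :: "real^'n::finite \<Rightarrow> real"
  assumes "has_second_derivative (\<lambda>s. F (x + s *\<^sub>R axis j 1)) D"
  shows "partial_deriv j (partial_deriv j F) x = D"
proof -
  obtain f' where f': "\<forall>\<^sub>F s in nhds 0. ((\<lambda>s. F (x + s *\<^sub>R axis j 1)) has_real_derivative f' s) (at s)"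
    and D: "(f' has_real_derivative D) (at 0)"
    using assms unfolding has_second_derivative_def by blast
  have "\<forall>\<^sub>F s in nhds 0. partial_deriv j F (x + s *\<^sub>R axis j 1) = f' s"
    using f'
  proof eventually_elim
    case (elim s)
    have "((\<lambda>t. F (x + (s + t) *\<^sub>R axis j 1)) has_real_derivative f' s) (at 0)"
      using elim DERIV_shift[of "\<lambda>s. F (x + s *\<^sub>R axis j 1)" "f' s" 0 s] by (simp add: add.commute)
    then show ?case
      unfolding partial_deriv_def by (intro DERIV_imp_deriv) (simp add: scaleR_left_distrib add.assoc)
  qed
  then have "deriv (\<lambda>s. partial_deriv j F (x + s *\<^sub>R axis j 1)) 0 = deriv f' 0"
    by (rule deriv_cong_ev) simp
  also have "\<dots> = D" using D by (rule DERIV_imp_deriv)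
  finally show ?thesis by (simp only: partial_deriv_def[of j "partial_deriv j F"])
qed

lemma has_second_derivative_cong:
  assumes "has_second_derivative f D" "\<forall>\<^sub>F s in nhds 0. f s = g s"
  shows "has_second_derivative g D"
proof -
  obtain f' where f': "\<forall>\<^sub>F s in nhds 0. (f has_real_derivative f' s) (at s)"
    and D: "(f' has_real_derivative D) (at 0)"
    using assms unfolding has_second_derivative_def by blast
  have "\<forall>\<^sub>F s in nhds 0. \<forall>\<^sub>F t in nhds s. f t = g t"
    using assms(2) by (simp add: eventually_eventually)
  then have "\<forall>\<^sub>F s in nhds 0. (g has_real_derivative f' s) (at s)"
    using f'
  proof eventually_elim
    case (elim s)
    then show ?case using DERIV_cong_ev[of s s f g "f' s" "f' s"] by simp
  qed
  then show ?thesis using D unfolding has_second_derivative_def by blast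
qed

lemma has_second_derivative_scale:
  assumes f: "has_second_derivative f D" and t: "t \<noteq> 0"
  shows "has_second_derivative (\<lambda>s. c + f (s / t)) (D / t\<^sup>2)"
proof -
  obtain f' where f': "\<forall>\<^sub>F s in nhds 0. (f has_real_derivative f' s) (at s)"
    and D: "(f' has_real_derivative D) (at 0)"
    using f unfolding has_second_derivative_def by blast
  have lim: "filterlim (\<lambda>s. s / t) (nhds 0) (nhds 0)"
    using tendsto_at_iff_tendsto_nhds[of "\<lambda>s. s / t" 0] t
      tendsto_divide[OF tendsto_ident_at tendsto_const, of t 0 UNIV] by simp
  show ?thesis
    unfolding has_second_derivative_def
  proof (intro exI conjI)
    show "\<forall>\<^sub>F s in nhds 0. ((\<lambda>s. c + f (s / t)) has_real_derivative f' (s / t) / t) (at s)"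
      using filterlim_iff[THEN iffD1, OF lim, rule_format, OF f']
    proof eventually_elim
      case (elim s)
      have "((\<lambda>s. f (s / t)) has_real_derivative f' (s / t) * (1 / t)) (at s)"
        by (rule DERIV_chain'[of "\<lambda>s. s / t", OF _ elim]) (use t in \<open>auto intro!: derivative_eq_intros\<close>)
      then show ?case by (auto intro!: derivative_eq_intros)
    qed
    have "((\<lambda>s. f' (s / t)) has_real_derivative D * (1 / t)) (at 0)"
      by (rule DERIV_chain'[of "\<lambda>s. s / t"]) (use D t in \<open>auto intro!: derivative_eq_intros\<close>)
    then show "((\<lambda>s. f' (s / t) / t) has_real_derivative D / t\<^sup>2) (at 0)"
      using t by (auto intro!: derivative_eq_intros simp: power2_eq_square)
  qed
qed

text \<open>This limit transfers inequalities between second differences to \<open>D\<close>, so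
  that a sign can be found without a formula for \<open>D\<close>. L'Hopital's rule is applied once;
  the resulting quotient \<open>(f' s - f' (- s)) / (2 * s)\<close> converges by differentiability
  of \<open>f'\<close> at the single point \<open>0\<close>.\<close>

lemma second_difference_tendsto:
  assumes "has_second_derivative f D"
  shows "((\<lambda>s. (f s + f (- s) - 2 * f 0) / s\<^sup>2) \<longlongrightarrow> D) (at_right 0)"
proof -
  obtain f' where f': "\<forall>\<^sub>F s in nhds 0. (f has_real_derivative f' s) (at s)"
    and D: "(f' has_real_derivative D) (at 0)"
    using assms unfolding has_second_derivative_def by blast
  define \<phi> where "\<phi> = (\<lambda>s. f s + f (- s) - 2 * f 0)"
  obtain d where d: "d > 0" "\<And>s. \<bar>s\<bar> < d \<Longrightarrow> (f has_real_derivative f' s) (at s)"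
    using f' unfolding eventually_nhds_metric by (auto simp: dist_real_def)
  have \<phi>': "(\<phi> has_real_derivative f' s - f' (- s)) (at s)" if "\<bar>s\<bar> < d" for s
  proof -
    have "((\<lambda>s. f (- s)) has_real_derivative f' (- s) * (- 1)) (at s)"
      by (rule DERIV_chain'[of uminus]) (use d(2)[of "- s"] that in \<open>auto intro!: derivative_eq_intros\<close>)
    then show ?thesis
      unfolding \<phi>_def using d(2)[OF that] by (auto intro!: derivative_eq_intros)
  qed
  have small: "\<forall>\<^sub>F s in at_right 0. \<bar>s\<bar> < d"
    using d(1) unfolding eventually_at_right_field by (intro exI[of _ d]) auto
  have lim: "((\<lambda>s. (f' s - f' (- s)) / (2 * s)) \<longlongrightarrow> D) (at_right 0)"
  proof -
    have 1: "((\<lambda>s. (f' s - f' 0) / s) \<longlongrightarrow> D) (at 0)"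
      using D by (simp add: has_field_derivative_iff)
    have "((\<lambda>s. f' (- s)) has_real_derivative D * (- 1)) (at 0)"
      by (rule DERIV_chain'[of uminus]) (use D in \<open>auto intro!: derivative_eq_intros\<close>)
    then have 2: "((\<lambda>s. (f' (- s) - f' 0) / s) \<longlongrightarrow> - D) (at 0)"
      by (simp add: has_field_derivative_iff)
    have "((\<lambda>s. ((f' s - f' 0) / s - (f' (- s) - f' 0) / s) / 2) \<longlongrightarrow> (D - - D) / 2) (at 0)"
      by (intro tendsto_intros 1 2) simp
    then have "((\<lambda>s. (f' s - f' (- s)) / (2 * s)) \<longlongrightarrow> D) (at 0)"
      by (simp add: diff_divide_distrib[symmetric] mult.commute)
    then show ?thesis by (rule filterlim_mono) (auto simp: at_within_le_at)
  qed
  have "((\<lambda>s. \<phi> s / s\<^sup>2) \<longlongrightarrow> D) (at_right 0)"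
  proof (rule lhopital_right_0[where f' = "\<lambda>s. f' s - f' (- s)" and g' = "\<lambda>s. 2 * s"])
    have "\<phi> \<midarrow>0\<rightarrow> \<phi> 0" using \<phi>'[of 0] d(1) by (simp add: DERIV_isCont isContD)
    then show "(\<phi> \<longlongrightarrow> 0) (at_right 0)"
      using filterlim_mono[OF _ order_refl at_within_le_at] by (force simp: \<phi>_def)
    show "((\<lambda>s. s\<^sup>2) \<longlongrightarrow> 0) (at_right (0::real))"
      by (rule tendsto_eq_intros | simp)+
    show "\<forall>\<^sub>F s in at_right 0. (\<phi> has_real_derivative f' s - f' (- s)) (at s)"
      using small by eventually_elim (rule \<phi>')
    show "\<forall>\<^sub>F s in at_right 0. ((\<lambda>s. s\<^sup>2) has_real_derivative 2 * s) (at s)"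
      by (intro always_eventually allI) (auto intro!: derivative_eq_intros)
    show "\<forall>\<^sub>F s in at_right 0. s\<^sup>2 \<noteq> (0::real)" "\<forall>\<^sub>F s in at_right 0. 2 * s \<noteq> (0::real)"
      using eventually_at_right_less[of "0::real"] by (auto elim!: eventually_mono)
    show "((\<lambda>s. (f' s - f' (- s)) / (2 * s)) \<longlongrightarrow> D) (at_right 0)" by (rule lim)
  qed
  then show ?thesis by (simp add: \<phi>_def)
qed

text \<open>By the mean value theorem the bound on \<open>p'\<close> also bounds the difference
  quotients, so dominated convergence applies along every sequence of increments.\<close>

lemma DERIV_integral_dominated:
  fixes p p' :: "real \<Rightarrow> 'a \<Rightarrow> real"
  assumes int: "\<And>t. integrable M (p t)"
    and deriv: "\<And>t x. ((\<lambda>t. p t x) has_real_derivative p' t x) (at t)"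
    and bound: "AE x in M. \<forall>t. \<bar>p' t x\<bar> \<le> w x"
    and w: "integrable M w"
    and meas: "\<And>t. p' t \<in> borel_measurable M"
  shows "((\<lambda>t. \<integral>x. p t x \<partial>M) has_real_derivative (\<integral>x. p' t x \<partial>M)) (at t)"
  unfolding DERIV_def tendsto_at_iff_sequentially comp_def
proof (intro allI impI)
  fix X :: "nat \<Rightarrow> real" assume X: "\<forall>i. X i \<in> UNIV - {0}" "X \<longlonglongrightarrow> 0"
  have "(\<lambda>i. \<integral>x. (p (t + X i) x - p t x) / X i \<partial>M) \<longlonglongrightarrow> (\<integral>x. p' t x \<partial>M)"
  proof (rule integral_dominated_convergence[where w = w])
    show "p' t \<in> borel_measurable M" by (rule meas)
    show "(\<lambda>x. (p (t + X i) x - p t x) / X i) \<in> borel_measurable M" for i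
      using int by (auto dest: borel_measurable_integrable)
    show "integrable M w" by (rule w)
    show "AE x in M. (\<lambda>i. (p (t + X i) x - p t x) / X i) \<longlonglongrightarrow> p' t x"
    proof (rule AE_I2)
      fix x
      have "((\<lambda>h. (p (t + h) x - p t x) / h) \<longlongrightarrow> p' t x) (at 0)"
        using deriv[of x t] by (simp add: DERIV_def)
      then show "(\<lambda>i. (p (t + X i) x - p t x) / X i) \<longlonglongrightarrow> p' t x"
        using X unfolding tendsto_at_iff_sequentially comp_def by blast
    qed
    show "AE x in M. norm ((p (t + X i) x - p t x) / X i) \<le> w x" for i
      using bound
    proof eventually_elim
      case (elim x)
      have "\<bar>p (t + X i) x - p t x\<bar> \<le> w x * \<bar>(t + X i) - t\<bar>"
        using field_differentiable_bound[of UNIV "\<lambda>t. p t x" "\<lambda>t. p' t x" "w x" "t + X i" t] deriv elim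
        by (auto simp: real_norm_def)
      moreover have "X i \<noteq> 0" using X by auto
      ultimately show ?case by (simp add: abs_divide pos_divide_le_eq)
    qed
  qed
  moreover have "(\<integral>x. (p (t + X i) x - p t x) / X i \<partial>M) = ((\<integral>x. p (t + X i) x \<partial>M) - (\<integral>x. p t x \<partial>M)) / X i" for i
    using int by simp
  ultimately show "(\<lambda>i. ((\<integral>x. p (t + X i) x \<partial>M) - (\<integral>x. p t x \<partial>M)) / X i) \<longlonglongrightarrow> (\<integral>x. p' t x \<partial>M)"
    by (simp only:)
qed

section \<open>Logarithmic potentials\<close>

definition log_potential :: "(real^'n::finite \<Rightarrow> real) \<Rightarrow> real^'n \<Rightarrow> real" where
  "log_potential g z = (\<integral>\<xi>. ln \<bar>z \<bullet> \<xi>\<bar> * g \<xi> \<partial>sphere_measure)"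

definition bounded_on_sphere :: "(real^'n::finite \<Rightarrow> real) \<Rightarrow> bool" where
  "bounded_on_sphere g \<longleftrightarrow> g \<in> borel_measurable borel \<and> (\<exists>B. \<forall>\<xi>. norm \<xi> = 1 \<longrightarrow> \<bar>g \<xi>\<bar> \<le> B)"

lemma bounded_on_sphere_measurable: "bounded_on_sphere g \<Longrightarrow> g \<in> borel_measurable borel"
  by (simp add: bounded_on_sphere_def)

lemma integrable_mult_bounded_on_sphere:
  assumes g: "bounded_on_sphere g" and w: "integrable sphere_measure w"
  shows "integrable sphere_measure (\<lambda>\<xi>. w \<xi> * g \<xi>)"
proof -
  obtain B where B: "\<And>\<xi>. norm \<xi> = 1 \<Longrightarrow> \<bar>g \<xi>\<bar> \<le> B" and [measurable]: "g \<in> borel_measurable borel"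
    using g unfolding bounded_on_sphere_def by blast
  have [measurable]: "w \<in> borel_measurable borel"
    using borel_measurable_integrable[OF w] by (simp cong: measurable_cong_sets)
  show ?thesis
  proof (rule Bochner_Integration.integrable_bound)
    show "integrable sphere_measure (\<lambda>\<xi>. B * w \<xi>)" using w by simp
    show "AE \<xi> in sphere_measure. norm (w \<xi> * g \<xi>) \<le> norm (B * w \<xi>)"
      using AE_sphere_measure
    proof eventually_elim
      case (elim \<xi>)
      have "\<bar>w \<xi>\<bar> * \<bar>g \<xi>\<bar> \<le> \<bar>w \<xi>\<bar> * \<bar>B\<bar>"
        using B[OF elim] by (intro mult_left_mono) auto
      then show ?case by (simp add: abs_mult mult.commute)
    qed
  qed measurable
qed

lemma integrable_bounded_on_sphere:
  assumes "bounded_on_sphere g"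
  shows "integrable sphere_measure g"
proof -
  interpret finite_measure "sphere_measure :: (real^'n) measure" by (rule finite_sphere_measure)
  show ?thesis using integrable_mult_bounded_on_sphere[OF assms, of "\<lambda>_. 1"] by simp
qed

lemma integrable_log_potential:
  fixes z :: "real^'n::finite"
  assumes "CARD('n) \<ge> 2" "bounded_on_sphere g" "z \<noteq> 0"
  shows "integrable sphere_measure (\<lambda>\<xi>. ln \<bar>z \<bullet> \<xi>\<bar> * g \<xi>)"
  using assms by (intro integrable_mult_bounded_on_sphere ln_inner_sphere)

lemma log_potential_scale:
  fixes z :: "real^'n::finite"
  assumes n: "CARD('n) \<ge> 2" and g: "bounded_on_sphere g" and z: "z \<noteq> 0" and r: "r > 0"
  shows "log_potential g (r *\<^sub>R z) = ln r * (\<integral>\<xi>. g \<xi> \<partial>sphere_measure) + log_potential g z"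
proof -
  have [measurable]: "g \<in> borel_measurable borel" using g by (rule bounded_on_sphere_measurable)
  have "log_potential g (r *\<^sub>R z) = (\<integral>\<xi>. ln r * g \<xi> + ln \<bar>z \<bullet> \<xi>\<bar> * g \<xi> \<partial>sphere_measure)"
    unfolding log_potential_def
  proof (rule integral_cong_AE)
    show "AE \<xi> in sphere_measure. ln \<bar>r *\<^sub>R z \<bullet> \<xi>\<bar> * g \<xi> = ln r * g \<xi> + ln \<bar>z \<bullet> \<xi>\<bar> * g \<xi>"
      using ln_inner_sphere(1)[OF n z]
      by eventually_elim (use r in \<open>simp add: abs_mult ln_mult algebra_simps\<close>)
  qed measurable
  also have "\<dots> = (\<integral>\<xi>. ln r * g \<xi> \<partial>sphere_measure) + (\<integral>\<xi>. ln \<bar>z \<bullet> \<xi>\<bar> * g \<xi> \<partial>sphere_measure)"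
    using integrable_bounded_on_sphere[OF g] integrable_log_potential[OF n g z]
    by (intro Bochner_Integration.integral_add) auto
  finally show ?thesis by (simp add: log_potential_def)
qed

lemma axis_inner [simp]: "axis i 1 \<bullet> (x :: real^'n::finite) = x $ i"
  by (simp add: inner_axis')

text \<open>The point on the line is \<open>sqrt (1 + s^2)\<close> times the vector
  \<open>axis i 1\<close> rotated by \<open>arctan s\<close>. Scaling splits off the norm, and
  rotation invariance leaves the fixed singular weight \<open>ln \<bar>\<xi> $ i\<bar>\<close>, with
  \<open>s\<close> only inside \<open>g\<close>.\<close>

lemma log_potential_line:
  fixes g :: "real^'n::finite \<Rightarrow> real"
  assumes n: "CARD('n) \<ge> 2" and g: "bounded_on_sphere g" and ij: "i \<noteq> j"
  shows "log_potential g (axis i 1 + s *\<^sub>R axis j 1) = 1 / 2 * ln (1 + s\<^sup>2) * (\<integral>\<xi>. g \<xi> \<partial>sphere_measure) +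
    (\<integral>\<xi>. ln \<bar>\<xi> $ i\<bar> * g (plane_rotation i j (arctan s) \<xi>) \<partial>sphere_measure)"
proof -
  have gm [measurable]: "g \<in> borel_measurable borel" using g by (rule bounded_on_sphere_measurable)
  define r where "r = sqrt (1 + s\<^sup>2)"
  define u where "u = cos (arctan s) *\<^sub>R axis i 1 + sin (arctan s) *\<^sub>R (axis j 1 :: real^'n)"
  have r: "r > 0" by (simp add: r_def add_pos_nonneg)
  have "axis i 1 + s *\<^sub>R axis j 1 = r *\<^sub>R u"
    using r by (simp add: u_def cos_arctan sin_arctan r_def[symmetric] scaleR_add_right)
  moreover have rot: "u \<bullet> plane_rotation i j (arctan s) \<xi> = \<xi> $ i" for \<xi>
  proof -
    have "u \<bullet> plane_rotation i j (arctan s) \<xi> =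
        ((cos (arctan s))\<^sup>2 + (sin (arctan s))\<^sup>2) * \<xi> $ i"
      unfolding u_def inner_add_left inner_scaleR_left axis_inner plane_rotation_nth(1) plane_rotation_nth(2)[OF ij]
      by algebra
    then show ?thesis by simp
  qed
  have "u \<noteq> 0"
  proof
    assume "u = 0"
    then have "axis i (1::real) $ i = (0::real)" using rot[of "axis i 1"] by (simp only: inner_zero_left)
    then show False by simp
  qed
  have "log_potential g u = (\<integral>\<xi>. ln \<bar>u \<bullet> plane_rotation i j (arctan s) \<xi>\<bar> * g (plane_rotation i j (arctan s) \<xi>) \<partial>sphere_measure)"
    unfolding log_potential_def
    by (rule integral_sphere_orthogonal(1)[OF orthogonal_plane_rotation[OF ij], symmetric]) measurable
  moreover have "ln r = 1 / 2 * ln (1 + s\<^sup>2)"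
    by (simp add: r_def ln_sqrt add_pos_nonneg)
  ultimately show ?thesis
    using log_potential_scale[OF n g \<open>u \<noteq> 0\<close> r] by (simp add: rot)
qed

text \<open>To second order at \<open>0\<close>, \<open>arctan s\<close> is \<open>s\<close> and
  \<open>ln (1 + s^2) / 2\<close> is \<open>s^2 / 2\<close>; hence the second derivative of
  \<open>h\<close> survives unchanged and the norm contributes \<open>C\<close>.\<close>

lemma has_second_derivative_log_arctan:
  assumes h: "\<And>\<theta>. (h has_real_derivative h' \<theta>) (at \<theta>)" and D: "(h' has_real_derivative D) (at 0)"
  shows "has_second_derivative (\<lambda>s. 1 / 2 * ln (1 + s\<^sup>2) * C + h (arctan s)) (C + D)"
  unfolding has_second_derivative_def
proof (intro exI conjI)
  have pos: "1 + s\<^sup>2 > 0" for s :: real by (simp add: add_pos_nonneg)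
  show "\<forall>\<^sub>F s in nhds 0. ((\<lambda>s. 1 / 2 * ln (1 + s\<^sup>2) * C + h (arctan s)) has_real_derivative
      (s * C + h' (arctan s)) * inverse (1 + s\<^sup>2)) (at s)"
  proof (intro always_eventually allI)
    fix s :: real
    have 1: "((\<lambda>s. h (arctan s)) has_real_derivative h' (arctan s) * inverse (1 + s\<^sup>2)) (at s)"
      by (rule DERIV_chain'[OF DERIV_arctan h])
    have 2: "((\<lambda>s. 1 / 2 * ln (1 + s\<^sup>2) * C) has_real_derivative s * C * inverse (1 + s\<^sup>2)) (at s)"
      using pos[of s] by (auto intro!: derivative_eq_intros simp: field_simps)
    show "((\<lambda>s. 1 / 2 * ln (1 + s\<^sup>2) * C + h (arctan s)) has_real_derivative
      (s * C + h' (arctan s)) * inverse (1 + s\<^sup>2)) (at s)"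
      using DERIV_add[OF 2 1] by (simp only: distrib_right)
  qed
  have "((\<lambda>s. h' (arctan s)) has_real_derivative D * inverse (1 + 0\<^sup>2)) (at 0)"
    by (rule DERIV_chain'[OF DERIV_arctan]) (use D in simp)
  then have 1: "((\<lambda>s. h' (arctan s)) has_real_derivative D) (at 0)" by simp
  have 2: "((\<lambda>s. inverse (1 + s\<^sup>2)) has_real_derivative 0) (at (0::real))"
    by (auto intro!: derivative_eq_intros)
  have "((\<lambda>s. s * C + h' (arctan s)) has_real_derivative C + D) (at 0)"
    using 1 by (auto intro!: derivative_eq_intros)
  from DERIV_mult[OF this 2]
  show "((\<lambda>s. (s * C + h' (arctan s)) * inverse (1 + s\<^sup>2)) has_real_derivative C + D) (at 0)"
    by simp
qed

text \<open>The singular weight \<open>w\<close> only has to be integrable, since all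
  differentiation falls on \<open>G\<close>. The rotated argument stays in \<open>[-2, 2]\<close>,
  where \<open>G\<close> and its derivatives are bounded by compactness.\<close>

lemma twice_differentiable_rotated_integral:
  fixes G G' G'' :: "real \<Rightarrow> real" and u v w :: "'a \<Rightarrow> real"
  assumes G: "\<And>y. (G has_real_derivative G' y) (at y)" "\<And>y. (G' has_real_derivative G'' y) (at y)"
    and cont: "continuous_on UNIV G''"
    and w: "integrable M w" and [measurable]: "u \<in> borel_measurable M" "v \<in> borel_measurable M"
    and uv: "AE x in M. \<bar>u x\<bar> \<le> 1 \<and> \<bar>v x\<bar> \<le> 1"
  obtains h' D where
    "\<And>\<theta>. ((\<lambda>\<theta>. \<integral>x. w x * G (cos \<theta> * u x + sin \<theta> * v x) \<partial>M) has_real_derivative h' \<theta>) (at \<theta>)"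
    "(h' has_real_derivative D) (at 0)"
proof -
  have contG: "continuous_on UNIV G" "continuous_on UNIV G'"
    using G by (auto intro!: continuous_at_imp_continuous_on DERIV_isCont)
  have [measurable]: "G \<in> borel_measurable borel" "G' \<in> borel_measurable borel" "G'' \<in> borel_measurable borel"
    using contG cont by (auto intro!: borel_measurable_continuous_onI)
  have [measurable]: "w \<in> borel_measurable M" using w by (rule borel_measurable_integrable)
  have bdd: "\<exists>B. \<forall>y\<in>{-2..2}. \<bar>F y\<bar> \<le> B" if F: "continuous_on UNIV F" for F :: "real \<Rightarrow> real"
  proof -
    have "compact (F ` {-2..2})"
      by (rule compact_continuous_image[OF continuous_on_subset[OF F]]) auto
    then have "bounded (F ` {-2..2})" by (rule compact_imp_bounded)
    then obtain B where "\<forall>x\<in>F ` {-2..2}. norm x \<le> B" unfolding bounded_iff by blast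
    then show ?thesis by (intro exI[of _ B]) simp
  qed
  obtain B0 where B0: "\<And>y. y \<in> {-2..2} \<Longrightarrow> \<bar>G y\<bar> \<le> B0" using bdd[OF contG(1)] by blast
  obtain B1 where B1: "\<And>y. y \<in> {-2..2} \<Longrightarrow> \<bar>G' y\<bar> \<le> B1" using bdd[OF contG(2)] by blast
  obtain B2 where B2: "\<And>y. y \<in> {-2..2} \<Longrightarrow> \<bar>G'' y\<bar> \<le> B2" using bdd[OF cont] by blast
  have B_nonneg: "0 \<le> B1" "0 \<le> B2" using B1[of 0] B2[of 0] by auto
  define y where "y = (\<lambda>\<theta> x. cos \<theta> * u x + sin \<theta> * v x)"
  define y' where "y' = (\<lambda>\<theta> x. cos \<theta> * v x - sin \<theta> * u x)"
  have ybd: "\<bar>y \<theta> x\<bar> \<le> 2" "\<bar>y' \<theta> x\<bar> \<le> 2" if "\<bar>u x\<bar> \<le> 1 \<and> \<bar>v x\<bar> \<le> 1" for \<theta> x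
  proof -
    have "\<bar>cos \<theta> * u x\<bar> \<le> 1 * 1" "\<bar>sin \<theta> * v x\<bar> \<le> 1 * 1" "\<bar>cos \<theta> * v x\<bar> \<le> 1 * 1" "\<bar>sin \<theta> * u x\<bar> \<le> 1 * 1"
      unfolding abs_mult using that by (intro mult_mono; simp)+
    then show "\<bar>y \<theta> x\<bar> \<le> 2" "\<bar>y' \<theta> x\<bar> \<le> 2" unfolding y_def y'_def by linarith+
  qed
  have yd: "((\<lambda>\<theta>. y \<theta> x) has_real_derivative y' \<theta> x) (at \<theta>)"
    "((\<lambda>\<theta>. y' \<theta> x) has_real_derivative - y \<theta> x) (at \<theta>)" for \<theta> x
    unfolding y_def y'_def by (auto intro!: derivative_eq_intros)
  define p0 where "p0 = (\<lambda>\<theta> x. w x * G (y \<theta> x))"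
  define p1 where "p1 = (\<lambda>\<theta> x. w x * (G' (y \<theta> x) * y' \<theta> x))"
  define p2 where "p2 = (\<lambda>\<theta> x. w x * (G'' (y \<theta> x) * (y' \<theta> x)\<^sup>2 - G' (y \<theta> x) * y \<theta> x))"
  have [measurable]: "y \<theta> \<in> borel_measurable M" "y' \<theta> \<in> borel_measurable M" for \<theta>
    unfolding y_def y'_def by measurable
  have m: "p0 \<theta> \<in> borel_measurable M" "p1 \<theta> \<in> borel_measurable M" "p2 \<theta> \<in> borel_measurable M" for \<theta>
    unfolding p0_def p1_def p2_def by measurable
  have d0: "((\<lambda>\<theta>. p0 \<theta> x) has_real_derivative p1 \<theta> x) (at \<theta>)" for \<theta> x
    unfolding p0_def p1_def by (intro DERIV_cmult DERIV_chain'[OF yd(1) G(1)])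
  have d1: "((\<lambda>\<theta>. p1 \<theta> x) has_real_derivative p2 \<theta> x) (at \<theta>)" for \<theta> x
  proof -
    have "((\<lambda>\<theta>. G' (y \<theta> x)) has_real_derivative G'' (y \<theta> x) * y' \<theta> x) (at \<theta>)"
      by (rule DERIV_chain'[OF yd(1) G(2)])
    from DERIV_mult[OF this yd(2)]
    show ?thesis unfolding p1_def p2_def
      by (intro DERIV_cmult) (simp add: power2_eq_square algebra_simps)
  qed
  have b0: "AE x in M. norm (p0 \<theta> x) \<le> norm (w x * B0)" for \<theta>
    using uv
  proof eventually_elim
    case (elim x)
    have "\<bar>G (y \<theta> x)\<bar> \<le> B0" using ybd[OF elim, of \<theta>] by (intro B0) auto
    then show ?case by (auto simp: p0_def abs_mult intro!: mult_left_mono)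
  qed
  have b1: "AE x in M. \<forall>\<theta>. \<bar>p1 \<theta> x\<bar> \<le> \<bar>w x\<bar> * (B1 * 2)"
    using uv
  proof eventually_elim
    case (elim x)
    have "\<bar>G' (y \<theta> x) * y' \<theta> x\<bar> \<le> B1 * 2" for \<theta>
      unfolding abs_mult using ybd[OF elim, of \<theta>] B_nonneg by (intro mult_mono B1) auto
    then show ?case by (auto simp: p1_def abs_mult intro!: mult_left_mono)
  qed
  have b2: "AE x in M. \<forall>\<theta>. \<bar>p2 \<theta> x\<bar> \<le> \<bar>w x\<bar> * (B2 * 2\<^sup>2 + B1 * 2)"
    using uv
  proof eventually_elim
    case (elim x)
    have "\<bar>G'' (y \<theta> x) * (y' \<theta> x)\<^sup>2 - G' (y \<theta> x) * y \<theta> x\<bar> \<le> B2 * 2\<^sup>2 + B1 * 2" for \<theta>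
    proof -
      have "\<bar>y' \<theta> x\<bar>\<^sup>2 \<le> 2\<^sup>2" using ybd[OF elim, of \<theta>] by (intro power_mono) auto
      then have "\<bar>G'' (y \<theta> x)\<bar> * \<bar>y' \<theta> x\<bar>\<^sup>2 \<le> B2 * 2\<^sup>2"
        using ybd[OF elim, of \<theta>] B_nonneg by (intro mult_mono B2) auto
      moreover have "\<bar>G' (y \<theta> x)\<bar> * \<bar>y \<theta> x\<bar> \<le> B1 * 2"
        using ybd[OF elim, of \<theta>] B_nonneg by (intro mult_mono B1) auto
      moreover have "\<bar>G'' (y \<theta> x) * (y' \<theta> x)\<^sup>2 - G' (y \<theta> x) * y \<theta> x\<bar> \<le>
          \<bar>G'' (y \<theta> x)\<bar> * \<bar>y' \<theta> x\<bar>\<^sup>2 + \<bar>G' (y \<theta> x)\<bar> * \<bar>y \<theta> x\<bar>"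
        using abs_triangle_ineq4[of "G'' (y \<theta> x) * (y' \<theta> x)\<^sup>2" "G' (y \<theta> x) * y \<theta> x"] by (simp add: abs_mult)
      ultimately show ?thesis by linarith
    qed
    then show ?case by (auto simp: p2_def abs_mult intro!: mult_left_mono)
  qed
  have i0: "integrable M (p0 \<theta>)" for \<theta>
    using w by (intro Bochner_Integration.integrable_bound[OF _ m(1) b0]) auto
  have i1: "integrable M (p1 \<theta>)" for \<theta>
  proof (rule Bochner_Integration.integrable_bound[OF _ m(2)])
    show "integrable M (\<lambda>x. \<bar>w x\<bar> * (B1 * 2))" using w by auto
    show "AE x in M. norm (p1 \<theta> x) \<le> norm (\<bar>w x\<bar> * (B1 * 2))"
      using b1 by eventually_elim (use B_nonneg in \<open>auto simp: abs_mult\<close>)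
  qed
  have 1: "((\<lambda>\<theta>. \<integral>x. p0 \<theta> x \<partial>M) has_real_derivative (\<integral>x. p1 \<theta> x \<partial>M)) (at \<theta>)" for \<theta>
    by (rule DERIV_integral_dominated[OF i0 d0 b1 _ m(2)]) (use w in auto)
  have 2: "((\<lambda>\<theta>. \<integral>x. p1 \<theta> x \<partial>M) has_real_derivative (\<integral>x. p2 0 x \<partial>M)) (at 0)"
    by (rule DERIV_integral_dominated[OF i1 d1 b2 _ m(3)]) (use w in auto)
  show ?thesis by (rule that[OF 1[unfolded p0_def y_def] 2])
qed

lemma bounded_on_sphere_coordinate:
  assumes "continuous_on UNIV (G :: real \<Rightarrow> real)"
  shows "bounded_on_sphere (\<lambda>\<xi> :: real^'n::finite. G (\<xi> $ p))"
proof -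
  have [measurable]: "G \<in> borel_measurable borel" using assms by (rule borel_measurable_continuous_onI)
  have "compact (G ` {-1..1})"
    by (rule compact_continuous_image[OF continuous_on_subset[OF assms]]) auto
  then have "bounded (G ` {-1..1})" by (rule compact_imp_bounded)
  then obtain B where "\<forall>x\<in>G ` {-1..1}. norm x \<le> B" unfolding bounded_iff by blast
  then have B: "\<bar>G y\<bar> \<le> B" if "y \<in> {-1..1}" for y using that by simp
  have "\<bar>G (\<xi> $ p)\<bar> \<le> B" if "norm \<xi> = 1" for \<xi> :: "real^'n"
    using component_le_norm_cart[of \<xi> p] that by (intro B) auto
  then show ?thesis by (auto simp: bounded_on_sphere_def)
qed

text \<open>Rotations in the plane of \<open>i\<close> and \<open>j\<close> do not move coordinate
  \<open>p\<close>, so the rotated integral is constant and only the norm of the point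
  contributes.\<close>

lemma has_second_derivative_log_potential_unrelated:
  fixes i j p :: "'n::finite"
  assumes n: "CARD('n) \<ge> 2" and ij: "i \<noteq> j" and p: "p \<noteq> i" "p \<noteq> j" and G: "continuous_on UNIV G"
  defines "g \<equiv> (\<lambda>\<xi> :: real^'n. G (\<xi> $ p))"
  shows "has_second_derivative (\<lambda>s. log_potential g (axis i 1 + s *\<^sub>R axis j 1)) (\<integral>\<xi>. g \<xi> \<partial>sphere_measure)"
proof -
  have g: "bounded_on_sphere g" unfolding g_def using G by (rule bounded_on_sphere_coordinate)
  have "g (plane_rotation i j \<theta> \<xi>) = g \<xi>" for \<theta> \<xi> by (simp add: g_def plane_rotation_nth p)
  then show ?thesis
    unfolding log_potential_line[OF n g ij]
    using has_second_derivative_log_arctan[of "\<lambda>_. c" "\<lambda>_. 0" 0 for c] by simp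
qed

text \<open>Only existence is claimed. When the plane of \<open>i\<close> and \<open>j\<close>
  contains the axis \<open>p\<close>, the value is estimated separately through second
  differences.\<close>

lemma has_second_derivative_log_potential_ex:
  fixes i j p :: "'n::finite"
  assumes n: "CARD('n) \<ge> 2" and ij: "i \<noteq> j"
    and G: "\<And>y. (G has_real_derivative G' y) (at y)" "\<And>y. (G' has_real_derivative G'' y) (at y)"
    and cont: "continuous_on UNIV G''"
  defines "g \<equiv> (\<lambda>\<xi> :: real^'n. G (\<xi> $ p))"
  obtains D where "has_second_derivative (\<lambda>s. log_potential g (axis i 1 + s *\<^sub>R axis j 1)) D"
proof (cases "p = i \<or> p = j")
  case False
  moreover have "continuous_on UNIV G" using G by (auto intro!: continuous_at_imp_continuous_on DERIV_isCont)
  ultimately show ?thesis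
    using has_second_derivative_log_potential_unrelated[OF n ij, of p G] that unfolding g_def by auto
next
  case True
  have "continuous_on UNIV G" using G by (auto intro!: continuous_at_imp_continuous_on DERIV_isCont)
  then have g: "bounded_on_sphere g" unfolding g_def by (rule bounded_on_sphere_coordinate)
  obtain u v :: "real^'n \<Rightarrow> real" where uv: "\<And>\<theta> \<xi>. plane_rotation i j \<theta> \<xi> $ p = cos \<theta> * u \<xi> + sin \<theta> * v \<xi>"
    and [measurable]: "u \<in> borel_measurable borel" "v \<in> borel_measurable borel"
    and bd: "\<And>\<xi>. norm \<xi> = 1 \<Longrightarrow> \<bar>u \<xi>\<bar> \<le> 1 \<and> \<bar>v \<xi>\<bar> \<le> 1"
  proof (cases "p = i")
    case True
    show ?thesis
    proof (rule that[of "\<lambda>\<xi>. \<xi> $ i" "\<lambda>\<xi>. - \<xi> $ j"])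
      show "plane_rotation i j \<theta> \<xi> $ p = cos \<theta> * \<xi> $ i + sin \<theta> * - \<xi> $ j" for \<theta> \<xi>
        by (simp add: True plane_rotation_nth)
      show "\<bar>\<xi> $ i\<bar> \<le> 1 \<and> \<bar>- \<xi> $ j\<bar> \<le> 1" if "norm \<xi> = 1" for \<xi> :: "real^'n"
        using component_le_norm_cart[of \<xi> i] component_le_norm_cart[of \<xi> j] that by simp
    qed measurable
  next
    case False
    then have p: "p = j" using \<open>p = i \<or> p = j\<close> by simp
    show ?thesis
    proof (rule that[of "\<lambda>\<xi>. \<xi> $ j" "\<lambda>\<xi>. \<xi> $ i"])
      show "plane_rotation i j \<theta> \<xi> $ p = cos \<theta> * \<xi> $ j + sin \<theta> * \<xi> $ i" for \<theta> \<xi>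
        using ij by (simp add: p plane_rotation_nth)
      show "\<bar>\<xi> $ j\<bar> \<le> 1 \<and> \<bar>\<xi> $ i\<bar> \<le> 1" if "norm \<xi> = 1" for \<xi> :: "real^'n"
        using component_le_norm_cart[of \<xi> i] component_le_norm_cart[of \<xi> j] that by simp
    qed measurable
  qed
  have "axis i 1 \<noteq> (0 :: real^'n)" by simp
  then have w: "integrable sphere_measure (\<lambda>\<xi> :: real^'n. ln \<bar>\<xi> $ i\<bar>)"
    using ln_inner_sphere(2)[OF n, of "axis i 1"] by simp
  have ae: "AE \<xi> in sphere_measure. \<bar>u \<xi>\<bar> \<le> 1 \<and> \<bar>v \<xi>\<bar> \<le> 1"
    using AE_sphere_measure by eventually_elim (rule bd)
  have m: "u \<in> borel_measurable sphere_measure" "v \<in> borel_measurable sphere_measure" by measurable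
  obtain h' D where
    h: "\<And>\<theta>. ((\<lambda>\<theta>. \<integral>\<xi>. ln \<bar>\<xi> $ i\<bar> * G (cos \<theta> * u \<xi> + sin \<theta> * v \<xi>) \<partial>sphere_measure) has_real_derivative h' \<theta>) (at \<theta>)"
    "(h' has_real_derivative D) (at 0)"
    using twice_differentiable_rotated_integral[OF G cont w m ae] by blast
  have "g (plane_rotation i j \<theta> \<xi>) = G (cos \<theta> * u \<xi> + sin \<theta> * v \<xi>)" for \<theta> \<xi>
    by (simp add: g_def uv)
  then have "has_second_derivative (\<lambda>s. log_potential g (axis i 1 + s *\<^sub>R axis j 1)) ((\<integral>\<xi>. g \<xi> \<partial>sphere_measure) + D)"
    unfolding log_potential_line[OF n g ij] by (simp only: has_second_derivative_log_arctan[OF h])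
  then show ?thesis by (rule that)
qed

text \<open>Along its own ray the potential is \<open>ln (1 + s)\<close> times the total weight plus
  a constant.\<close>

lemma has_second_derivative_log_potential_radial:
  fixes g :: "real^'n::finite \<Rightarrow> real"
  assumes n: "CARD('n) \<ge> 2" and g: "bounded_on_sphere g"
  shows "has_second_derivative (\<lambda>s. log_potential g (axis i 1 + s *\<^sub>R axis i 1)) (- (\<integral>\<xi>. g \<xi> \<partial>sphere_measure))"
proof -
  let ?C = "\<integral>\<xi>. g \<xi> \<partial>sphere_measure" and ?c = "log_potential g (axis i 1)"
  have near: "\<forall>\<^sub>F s in nhds 0. \<bar>s\<bar> < (1::real)"
    unfolding eventually_nhds_metric by (intro exI[of _ 1]) (auto simp: dist_real_def)
  have "has_second_derivative (\<lambda>s. ln (1 + s) * ?C + ?c) (- ?C)"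
    unfolding has_second_derivative_def
  proof (intro exI conjI)
    show "\<forall>\<^sub>F s in nhds 0. ((\<lambda>s. ln (1 + s) * ?C + ?c) has_real_derivative inverse (1 + s) * ?C) (at s)"
      using near by eventually_elim (auto intro!: derivative_eq_intros simp: divide_inverse)
    show "((\<lambda>s. inverse (1 + s) * ?C) has_real_derivative - ?C) (at 0)"
      by (auto intro!: derivative_eq_intros)
  qed
  then show ?thesis
  proof (rule has_second_derivative_cong)
    show "\<forall>\<^sub>F s in nhds 0. ln (1 + s) * ?C + ?c = log_potential g (axis i 1 + s *\<^sub>R axis i 1)"
      using near
    proof eventually_elim
      case (elim s)
      have "axis i 1 + s *\<^sub>R axis i 1 = (1 + s) *\<^sub>R (axis i 1 :: real^'n)" by (simp add: scaleR_left_distrib)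
      then show ?case using log_potential_scale[OF n g, of "axis i 1" "1 + s"] elim by simp
    qed
  qed
qed

lemma laplacian_log_potential:
  fixes g :: "real^'n::finite \<Rightarrow> real"
  assumes n: "CARD('n) \<ge> 2" and g: "bounded_on_sphere g" and t: "t > 0"
    and D: "\<And>j. has_second_derivative (\<lambda>s. log_potential g (axis i 1 + s *\<^sub>R axis j 1)) (D j)"
  shows "laplacian (log_potential g) (t *\<^sub>R axis i 1) = (\<Sum>j\<in>UNIV. D j) / t\<^sup>2"
proof -
  have "partial_deriv j (partial_deriv j (log_potential g)) (t *\<^sub>R axis i 1) = D j / t\<^sup>2" for j
  proof (rule partial_deriv_second, rule has_second_derivative_cong)
    let ?c = "ln t * (\<integral>\<xi>. g \<xi> \<partial>sphere_measure)"
    show "has_second_derivative (\<lambda>s. ?c + log_potential g (axis i 1 + (s / t) *\<^sub>R axis j 1)) (D j / t\<^sup>2)"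
      using has_second_derivative_scale[OF D] t by simp
    have "\<forall>\<^sub>F s in nhds 0. \<bar>s\<bar> < t"
      unfolding eventually_nhds_metric using t by (intro exI[of _ t]) (auto simp: dist_real_def)
    then show "\<forall>\<^sub>F s in nhds 0. ?c + log_potential g (axis i 1 + (s / t) *\<^sub>R axis j 1) =
        log_potential g (t *\<^sub>R axis i 1 + s *\<^sub>R axis j 1)"
    proof eventually_elim
      case (elim s)
      have "(axis i 1 + (s / t) *\<^sub>R axis j 1 :: real^'n) $ i \<noteq> 0"
        using elim t by (cases "i = j") (auto simp: axis_def field_simps)
      then have "axis i 1 + (s / t) *\<^sub>R axis j 1 \<noteq> (0 :: real^'n)" by (metis zero_index)
      moreover have "t *\<^sub>R axis i 1 + s *\<^sub>R axis j 1 = t *\<^sub>R (axis i 1 + (s / t) *\<^sub>R axis j 1 :: real^'n)"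
        using t by (simp add: scaleR_add_right)
      ultimately show ?case using log_potential_scale[OF n g _ t] by simp
    qed
  qed
  then show ?thesis by (simp add: laplacian_def sum_divide_distrib)
qed

section \<open>One-sided bounds for the second derivatives at coordinate vectors\<close>

lemma log_potential_const_line:
  fixes i j :: "'n::finite"
  assumes n: "CARD('n) \<ge> 2" and ij: "i \<noteq> j"
  shows "log_potential (\<lambda>_. 1) (axis i 1 + s *\<^sub>R axis j 1) =
    1 / 2 * ln (1 + s\<^sup>2) * measure (sphere_measure :: (real^'n) measure) UNIV + log_potential (\<lambda>_. 1) (axis i 1)"
proof -
  have one: "bounded_on_sphere (\<lambda>_ :: real^'n. 1)" by (auto simp: bounded_on_sphere_def)
  show ?thesis
    unfolding log_potential_line[OF n one ij] by (simp add: log_potential_def measure_def)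
qed

text \<open>With \<open>q = (s * y / x)^2\<close> the symmetric difference is
  \<open>ln \<bar>1 - q\<bar>\<close>. For \<open>q < 1\<close> the estimate
  \<open>ln (1 - q) \<le> - q\<close> gives the main term, because the weight turns
  \<open>q * x^2\<close> into \<open>s^2 * y^2\<close> and removes the singularity. The case
  \<open>q \<ge> 1\<close> forces \<open>\<bar>x\<bar> \<le> s\<close>, so its crude bound is an
  error confined to a strip that shrinks with \<open>s\<close>.\<close>

lemma ln_symmetric_difference_le:
  fixes x y s \<kappa> K :: real
  assumes x: "x \<noteq> 0" "x + s * y \<noteq> 0" "x - s * y \<noteq> 0" and y: "\<bar>y\<bar> \<le> 1" and s: "s > 0"
    and \<kappa>: "0 \<le> \<kappa>" "\<kappa> \<le> K"
  shows "(ln \<bar>x + s * y\<bar> + ln \<bar>x - s * y\<bar> - 2 * ln \<bar>x\<bar>) * (x\<^sup>2 * \<kappa>) \<le>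
    s\<^sup>2 * (- (y\<^sup>2 * \<kappa>) + 2 * K * indicator {-s..s} x)"
proof -
  define q where "q = (s * y / x)\<^sup>2"
  have q: "q * x\<^sup>2 = s\<^sup>2 * y\<^sup>2" using x by (simp add: q_def power_divide power_mult_distrib)
  have prod: "\<bar>x + s * y\<bar> * \<bar>x - s * y\<bar> = \<bar>1 - q\<bar> * x\<^sup>2"
  proof -
    have "(x + s * y) * (x - s * y) = (1 - q) * x\<^sup>2"
      using q by (simp add: algebra_simps power2_eq_square)
    then show ?thesis by (metis abs_mult abs_power2)
  qed
  then have q1: "\<bar>1 - q\<bar> > 0" using x by (metis abs_zero mult_eq_0_iff zero_less_abs_iff abs_eq_0)
  have "ln \<bar>x + s * y\<bar> + ln \<bar>x - s * y\<bar> = ln (\<bar>1 - q\<bar> * x\<^sup>2)"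
    using x by (simp add: prod[symmetric] ln_mult)
  also have "\<dots> = ln \<bar>1 - q\<bar> + 2 * ln \<bar>x\<bar>"
    using q1 x ln_realpow[of "\<bar>x\<bar>" 2] by (simp add: ln_mult)
  finally have eq: "ln \<bar>x + s * y\<bar> + ln \<bar>x - s * y\<bar> - 2 * ln \<bar>x\<bar> = ln \<bar>1 - q\<bar>" by simp
  have lnle: "ln \<bar>1 - q\<bar> \<le> \<bar>1 - q\<bar> - 1" using q1 by (rule ln_le_minus_one)
  show ?thesis
  proof (cases "q < 1")
    case True
    then have "ln \<bar>1 - q\<bar> \<le> - q" using lnle by simp
    then have "ln \<bar>1 - q\<bar> * (x\<^sup>2 * \<kappa>) \<le> - q * (x\<^sup>2 * \<kappa>)"
      using \<kappa> by (intro mult_right_mono) auto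
    also have "\<dots> = s\<^sup>2 * (- (y\<^sup>2 * \<kappa>))" using q by (simp add: algebra_simps)
    also have "\<dots> \<le> s\<^sup>2 * (- (y\<^sup>2 * \<kappa>) + 2 * K * indicator {-s..s} x)"
      using \<kappa> by (intro mult_left_mono) (auto simp: indicator_def)
    finally show ?thesis by (simp only: eq)
  next
    case False
    then have "ln \<bar>1 - q\<bar> \<le> q" using lnle by simp
    then have "ln \<bar>1 - q\<bar> * (x\<^sup>2 * \<kappa>) \<le> q * (x\<^sup>2 * \<kappa>)"
      using \<kappa> by (intro mult_right_mono) auto
    also have "\<dots> = s\<^sup>2 * (y\<^sup>2 * \<kappa>)" using q by (simp add: algebra_simps)
    also have "\<dots> \<le> s\<^sup>2 * (- (y\<^sup>2 * \<kappa>) + 2 * K)"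
    proof (intro mult_left_mono)
      have "y\<^sup>2 \<le> 1" using y by (simp add: abs_square_le_1)
      then have "y\<^sup>2 * \<kappa> \<le> 1 * K" using \<kappa> by (intro mult_mono) auto
      then show "y\<^sup>2 * \<kappa> \<le> - (y\<^sup>2 * \<kappa>) + 2 * K" by linarith
    qed simp
    also have "indicator {-s..s} x = (1::real)"
    proof -
      have "1 * x\<^sup>2 \<le> q * x\<^sup>2" using False by (intro mult_right_mono) auto
      also have "\<dots> \<le> s\<^sup>2 * 1" unfolding q using y by (intro mult_left_mono) (auto simp: abs_square_le_1)
      finally have "x\<^sup>2 \<le> s\<^sup>2" by simp
      then have "\<bar>x\<bar> \<le> \<bar>s\<bar>" by (simp only: abs_le_square_iff)
      then have "- s \<le> x" "x \<le> s" using s by linarith+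
      then show ?thesis by simp
    qed
    then have "s\<^sup>2 * (- (y\<^sup>2 * \<kappa>) + 2 * K) = s\<^sup>2 * (- (y\<^sup>2 * \<kappa>) + 2 * K * indicator {-s..s} x)" by simp
    finally show ?thesis by (simp only: eq)
  qed
qed

text \<open>In the second difference divided by \<open>s^2\<close>, the constant part of
  \<open>g\<close> contributes at most \<open>G0 * M\<close>, by
  \<open>ln (1 + s^2) \<le> s^2\<close>. The rest contributes at most \<open>- I\<close> plus a
  multiple of the measure of the strip \<open>\<bar>\<xi>_i\<bar> \<le> s\<close>, which tends to
  \<open>0\<close> because the equator is a null set.\<close>

lemma second_derivative_axis_upper:
  fixes g \<kappa> :: "real^'n::finite \<Rightarrow> real"
  assumes n: "CARD('n) \<ge> 2" and ij: "i \<noteq> j" and g: "bounded_on_sphere g"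
    and \<kappa>m [measurable]: "\<kappa> \<in> borel_measurable borel"
    and \<kappa>: "\<And>\<xi>. norm \<xi> = 1 \<Longrightarrow> 0 \<le> \<kappa> \<xi> \<and> \<kappa> \<xi> \<le> K"
    and g\<kappa>: "\<And>\<xi>. norm \<xi> = 1 \<Longrightarrow> g \<xi> = G0 + (\<xi> $ i)\<^sup>2 * \<kappa> \<xi>" and G0: "G0 \<ge> 0"
    and D: "has_second_derivative (\<lambda>s. log_potential g (axis i 1 + s *\<^sub>R axis j 1)) D"
  shows "D \<le> G0 * measure (sphere_measure :: (real^'n) measure) UNIV - (\<integral>\<xi>. (\<xi> $ j)\<^sup>2 * \<kappa> \<xi> \<partial>sphere_measure)"
proof -
  let ?\<sigma> = "sphere_measure :: (real^'n) measure"
  interpret finite_measure ?\<sigma> by (rule finite_sphere_measure)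
  define M where "M = measure ?\<sigma> UNIV"
  define I where "I = (\<integral>\<xi>. (\<xi> $ j)\<^sup>2 * \<kappa> \<xi> \<partial>?\<sigma>)"
  define f where "f = (\<lambda>s. log_potential g (axis i 1 + s *\<^sub>R axis j 1))"
  define k where "k = (\<lambda>\<xi> :: real^'n. (\<xi> $ i)\<^sup>2 * \<kappa> \<xi>)"
  have coord: "(\<xi> $ l)\<^sup>2 \<le> 1" "\<bar>\<xi> $ l\<bar> \<le> 1" if "norm \<xi> = 1" for \<xi> :: "real^'n" and l
    using component_le_norm_cart[of \<xi> l] that by (simp_all add: abs_square_le_1)
  have bk: "bounded_on_sphere (\<lambda>\<xi>. (\<xi> $ l)\<^sup>2 * \<kappa> \<xi>)" for l
  proof -
    have "\<bar>(\<xi> $ l)\<^sup>2 * \<kappa> \<xi>\<bar> \<le> 1 * K" if "norm \<xi> = 1" for \<xi>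
      using coord(1)[OF that, of l] \<kappa>[OF that] unfolding abs_mult by (intro mult_mono) auto
    then show ?thesis by (auto simp: bounded_on_sphere_def)
  qed
  have one: "bounded_on_sphere (\<lambda>_ :: real^'n. 1)" by (auto simp: bounded_on_sphere_def)
  have gm [measurable]: "g \<in> borel_measurable borel" using g by (rule bounded_on_sphere_measurable)
  have km [measurable]: "k \<in> borel_measurable borel" unfolding k_def by measurable
  have split: "log_potential g z = G0 * log_potential (\<lambda>_. 1) z + log_potential k z" if z: "z \<noteq> 0" for z
  proof -
    have "log_potential g z = (\<integral>\<xi>. G0 * (ln \<bar>z \<bullet> \<xi>\<bar> * 1) + ln \<bar>z \<bullet> \<xi>\<bar> * k \<xi> \<partial>?\<sigma>)"
      unfolding log_potential_def
    proof (rule integral_cong_AE)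
      show "AE \<xi> in ?\<sigma>. ln \<bar>z \<bullet> \<xi>\<bar> * g \<xi> = G0 * (ln \<bar>z \<bullet> \<xi>\<bar> * 1) + ln \<bar>z \<bullet> \<xi>\<bar> * k \<xi>"
        using AE_sphere_measure by eventually_elim (simp add: g\<kappa> k_def algebra_simps)
    qed measurable
    also have "\<dots> = (\<integral>\<xi>. G0 * (ln \<bar>z \<bullet> \<xi>\<bar> * 1) \<partial>?\<sigma>) + (\<integral>\<xi>. ln \<bar>z \<bullet> \<xi>\<bar> * k \<xi> \<partial>?\<sigma>)"
      using integrable_log_potential[OF n one z] integrable_log_potential[OF n bk[of i] z]
      by (intro Bochner_Integration.integral_add) (auto simp: k_def)
    finally show ?thesis by (simp add: log_potential_def)
  qed
  have nz: "axis i 1 + s *\<^sub>R axis j 1 \<noteq> (0 :: real^'n)" for s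
  proof -
    have "(axis i 1 + s *\<^sub>R axis j 1 :: real^'n) $ i = 1" using ij by (simp add: axis_def)
    then show ?thesis by (metis zero_index zero_neq_one)
  qed
  define \<mu> where "\<mu> = (\<lambda>s. measure ?\<sigma> {\<xi>. \<xi> $ i \<in> {-s..s}})"
  have bound: "(f s + f (- s) - 2 * f 0) / s\<^sup>2 \<le> G0 * M - I + 2 * K * \<mu> s" if s: "s > 0" for s
  proof -
    let ?A = "axis i 1 + s *\<^sub>R axis j 1 :: real^'n" and ?B = "axis i 1 + (- s) *\<^sub>R axis j 1 :: real^'n"
      and ?O = "axis i 1 + 0 *\<^sub>R axis j 1 :: real^'n"
    have ind: "integrable ?\<sigma> (\<lambda>\<xi>. indicator {\<xi>. \<xi> $ i \<in> {-s..s}} \<xi> :: real)"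
      by (intro integrable_real_indicator) (auto simp: less_top[symmetric] emeasure_finite)
    note int = integrable_log_potential[OF n bk[of i, folded k_def] nz]
    have "log_potential k ?A + log_potential k ?B - 2 * log_potential k ?O =
        (\<integral>\<xi>. ln \<bar>?A \<bullet> \<xi>\<bar> * k \<xi> + ln \<bar>?B \<bullet> \<xi>\<bar> * k \<xi> - 2 * (ln \<bar>?O \<bullet> \<xi>\<bar> * k \<xi>) \<partial>?\<sigma>)"
      unfolding log_potential_def using int[of s] int[of "- s"] int[of 0]
      by (subst Bochner_Integration.integral_diff) (auto simp del: scaleR_minus_left)
    also have "\<dots> \<le> (\<integral>\<xi>. s\<^sup>2 * (- ((\<xi> $ j)\<^sup>2 * \<kappa> \<xi>) + 2 * K * indicator {\<xi>. \<xi> $ i \<in> {-s..s}} \<xi>) \<partial>?\<sigma>)"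
    proof (rule integral_mono_AE)
      show "integrable ?\<sigma> (\<lambda>\<xi>. ln \<bar>?A \<bullet> \<xi>\<bar> * k \<xi> + ln \<bar>?B \<bullet> \<xi>\<bar> * k \<xi> - 2 * (ln \<bar>?O \<bullet> \<xi>\<bar> * k \<xi>))"
        by (intro Bochner_Integration.integrable_add Bochner_Integration.integrable_diff integrable_mult_right int)
      show "integrable ?\<sigma> (\<lambda>\<xi>. s\<^sup>2 * (- ((\<xi> $ j)\<^sup>2 * \<kappa> \<xi>) + 2 * K * indicator {\<xi>. \<xi> $ i \<in> {-s..s}} \<xi>))"
        using integrable_bounded_on_sphere[OF bk[of j]]
        by (intro integrable_mult_right Bochner_Integration.integrable_add Bochner_Integration.integrable_minus ind)
      show "AE \<xi> in ?\<sigma>. ln \<bar>?A \<bullet> \<xi>\<bar> * k \<xi> + ln \<bar>?B \<bullet> \<xi>\<bar> * k \<xi> - 2 * (ln \<bar>?O \<bullet> \<xi>\<bar> * k \<xi>) \<le>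
          s\<^sup>2 * (- ((\<xi> $ j)\<^sup>2 * \<kappa> \<xi>) + 2 * K * indicator {\<xi>. \<xi> $ i \<in> {-s..s}} \<xi>)"
        using AE_sphere_measure ln_inner_sphere(1)[OF n nz[of s]] ln_inner_sphere(1)[OF n nz[of "- s"]]
          ln_inner_sphere(1)[OF n nz[of 0]]
      proof eventually_elim
        case (elim \<xi>)
        have e: "?A \<bullet> \<xi> = \<xi> $ i + s * \<xi> $ j" "?B \<bullet> \<xi> = \<xi> $ i - s * \<xi> $ j" "?O \<bullet> \<xi> = \<xi> $ i"
          by (simp_all add: inner_add_left inner_diff_left)
        have "(ln \<bar>\<xi> $ i + s * \<xi> $ j\<bar> + ln \<bar>\<xi> $ i - s * \<xi> $ j\<bar> - 2 * ln \<bar>\<xi> $ i\<bar>) * ((\<xi> $ i)\<^sup>2 * \<kappa> \<xi>) \<le>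
            s\<^sup>2 * (- ((\<xi> $ j)\<^sup>2 * \<kappa> \<xi>) + 2 * K * indicator {-s..s} (\<xi> $ i))"
          using elim(2-4) \<kappa>[OF elim(1)] coord(2)[OF elim(1), of j] s unfolding e
          by (intro ln_symmetric_difference_le) auto
        moreover have "indicator {\<xi>. \<xi> $ i \<in> {-s..s}} \<xi> = (indicator {-s..s} (\<xi> $ i) :: real)"
          by (simp add: indicator_def)
        ultimately show ?case unfolding e k_def by (simp only: left_diff_distrib distrib_right mult.assoc)
      qed
    qed
    also have "\<dots> = s\<^sup>2 * (- I + 2 * K * \<mu> s)"
    proof -
      have "(\<integral>\<xi>. - ((\<xi> $ j)\<^sup>2 * \<kappa> \<xi>) + 2 * K * indicator {\<xi>. \<xi> $ i \<in> {-s..s}} \<xi> \<partial>?\<sigma>) =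
          (\<integral>\<xi>. - ((\<xi> $ j)\<^sup>2 * \<kappa> \<xi>) \<partial>?\<sigma>) + (\<integral>\<xi>. 2 * K * indicator {\<xi>. \<xi> $ i \<in> {-s..s}} \<xi> \<partial>?\<sigma>)"
        using integrable_bounded_on_sphere[OF bk[of j]]
        by (intro Bochner_Integration.integral_add Bochner_Integration.integrable_minus integrable_mult_right ind)
      then show ?thesis by (simp add: I_def \<mu>_def)
    qed
    finally have k_le: "log_potential k ?A + log_potential k ?B - 2 * log_potential k ?O \<le> s\<^sup>2 * (- I + 2 * K * \<mu> s)" .
    have "log_potential (\<lambda>_. 1) ?A + log_potential (\<lambda>_. 1) ?B - 2 * log_potential (\<lambda>_. 1) ?O = ln (1 + s\<^sup>2) * M"
      unfolding log_potential_const_line[OF n ij] by (simp add: M_def)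
    moreover have "ln (1 + s\<^sup>2) \<le> s\<^sup>2" by (intro ln_add_one_self_le_self) simp
    ultimately have "log_potential (\<lambda>_. 1) ?A + log_potential (\<lambda>_. 1) ?B - 2 * log_potential (\<lambda>_. 1) ?O \<le> s\<^sup>2 * M"
      by (simp add: M_def mult_right_mono)
    then have "G0 * (log_potential (\<lambda>_. 1) ?A + log_potential (\<lambda>_. 1) ?B - 2 * log_potential (\<lambda>_. 1) ?O) \<le> G0 * (s\<^sup>2 * M)"
      using G0 by (rule mult_left_mono)
    then have "f s + f (- s) - 2 * f 0 \<le> s\<^sup>2 * (G0 * M - I + 2 * K * \<mu> s)"
      unfolding f_def split[OF nz] using k_le by (simp only: algebra_simps)
    then show ?thesis using s by (simp add: pos_divide_le_eq mult.commute)
  qed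
  \<comment> \<open>The second differences are known to converge, so one sequence of scales
    identifies the limit; along it the strips decrease and continuity of the measure from above
    applies.\<close>
  define S where "S = (\<lambda>m. inverse (real (Suc m)))"
  have S: "filterlim S (at_right 0) sequentially"
    unfolding S_def
    by (rule filterlim_compose[OF filterlim_inverse_at_right_top
          filterlim_compose[OF filterlim_real_sequentially filterlim_Suc]])
  have "(\<lambda>m. \<mu> (S m)) \<longlonglongrightarrow> measure ?\<sigma> (\<Inter>m. {\<xi>. \<xi> $ i \<in> {- S m..S m}})"
    unfolding \<mu>_def
  proof (rule finite_Lim_measure_decseq)
    show "range (\<lambda>m. {\<xi> :: real^'n. \<xi> $ i \<in> {- S m..S m}}) \<subseteq> sets ?\<sigma>" by auto
    have "S m' \<le> S m" if "m \<le> m'" for m m' using that by (simp add: S_def field_simps)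
    then show "decseq (\<lambda>m. {\<xi> :: real^'n. \<xi> $ i \<in> {- S m..S m}})"
      unfolding decseq_def by fastforce
  qed
  also have "measure ?\<sigma> (\<Inter>m. {\<xi>. \<xi> $ i \<in> {- S m..S m}}) = 0"
  proof -
    have "S \<longlonglongrightarrow> 0" unfolding S_def by (rule LIMSEQ_inverse_real_of_nat)
    have "\<xi> $ i = 0" if "\<And>m. \<xi> $ i \<in> {- S m..S m}" for \<xi> :: "real^'n"
    proof -
      have "\<bar>\<xi> $ i\<bar> \<le> S m" for m using that[of m] by auto
      then have "\<bar>\<xi> $ i\<bar> \<le> 0" using \<open>S \<longlonglongrightarrow> 0\<close> by (intro LIMSEQ_le_const) auto
      then show ?thesis by simp
    qed
    then have "(\<Inter>m. {\<xi>. \<xi> $ i \<in> {- S m..S m}}) \<subseteq> {\<xi> :: real^'n. \<xi> $ i = 0}" by auto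
    then have "measure ?\<sigma> (\<Inter>m. {\<xi>. \<xi> $ i \<in> {- S m..S m}}) \<le> measure ?\<sigma> {\<xi>. \<xi> $ i = 0}"
      by (intro finite_measure_mono) auto
    also have "AE \<xi> in ?\<sigma>. \<xi> $ i \<noteq> 0" using ln_inner_sphere(1)[OF n, of "axis i 1"] by simp
    then have "measure ?\<sigma> {\<xi>. \<xi> $ i = 0} = 0"
      by (subst (asm) AE_iff_measurable[of "{\<xi>. \<xi> $ i = 0}"]) (auto simp: measure_def)
    finally show ?thesis by (simp add: measure_le_0_iff)
  qed
  finally have \<mu>0: "(\<lambda>m. \<mu> (S m)) \<longlonglongrightarrow> 0" .
  have "(\<lambda>m. (f (S m) + f (- S m) - 2 * f 0) / (S m)\<^sup>2) \<longlonglongrightarrow> D"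
    using filterlim_compose[OF second_difference_tendsto[OF D] S] by (simp add: f_def)
  moreover have "(\<lambda>m. G0 * M - I + 2 * K * \<mu> (S m)) \<longlonglongrightarrow> G0 * M - I + 2 * K * 0"
    by (intro tendsto_intros \<mu>0)
  ultimately have "D \<le> G0 * M - I + 2 * K * 0"
    by (rule LIMSEQ_le) (auto intro!: exI[of _ 0] bound simp: S_def)
  then show ?thesis by (simp add: M_def I_def)
qed

text \<open>Rotations in the plane of \<open>i\<close> and a third index \<open>j\<close> fix
  coordinate \<open>p\<close> and with it the weight. After averaging over them, moving by
  \<open>s\<close> along axis \<open>p\<close> only adds the constant \<open>s * \<xi>_p\<close>
  inside the logarithm of a circle mean, which cannot lower it. So \<open>s = 0\<close> is a global
  minimum of the potential along this line.\<close>

lemma second_derivative_transversal_nonneg: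
  fixes i j p :: "'n::finite"
  assumes n: "CARD('n) \<ge> 2" and ij: "i \<noteq> j" and p: "p \<noteq> i" "p \<noteq> j"
    and G: "continuous_on UNIV G" "\<And>y. 0 \<le> G y"
    and D: "has_second_derivative (\<lambda>s. log_potential (\<lambda>\<xi> :: real^'n. G (\<xi> $ p)) (axis i 1 + s *\<^sub>R axis p 1)) D"
  shows "0 \<le> D"
proof -
  let ?\<sigma> = "sphere_measure :: (real^'n) measure"
  define g where "g = (\<lambda>\<xi> :: real^'n. G (\<xi> $ p))"
  define f where "f = (\<lambda>s. log_potential g (axis i 1 + s *\<^sub>R axis p 1))"
  have g: "bounded_on_sphere g" unfolding g_def using G(1) by (rule bounded_on_sphere_coordinate)
  have nz: "axis i 1 + s *\<^sub>R axis p 1 \<noteq> (0 :: real^'n)" for s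
  proof -
    have "(axis i 1 + s *\<^sub>R axis p 1 :: real^'n) $ i = 1" using p by (simp add: axis_def)
    then show ?thesis by (metis zero_index zero_neq_one)
  qed
  have inner: "(axis i 1 + s *\<^sub>R axis p 1) \<bullet> \<xi> = \<xi> $ i + s * \<xi> $ p" for s and \<xi> :: "real^'n"
    by (simp add: inner_add_left)
  define J where "J = (\<lambda>s \<xi> :: real^'n. (\<integral>\<theta>. ln \<bar>cos \<theta> * \<xi> $ i - sin \<theta> * \<xi> $ j + s * \<xi> $ p\<bar> \<partial>circle_measure) * G (\<xi> $ p))"
  have avg: "integrable ?\<sigma> (J s)" "f s = (\<integral>\<xi>. J s \<xi> \<partial>?\<sigma>)" for s
  proof -
    have "J s = (\<lambda>\<xi>. \<integral>\<theta>. ln \<bar>(axis i 1 + s *\<^sub>R axis p 1) \<bullet> plane_rotation i j \<theta> \<xi>\<bar> *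
        g (plane_rotation i j \<theta> \<xi>) \<partial>circle_measure)"
      unfolding J_def inner g_def plane_rotation_nth(1) plane_rotation_nth(3)[OF p] by simp
    then show "integrable ?\<sigma> (J s)" "f s = (\<integral>\<xi>. J s \<xi> \<partial>?\<sigma>)"
      using integral_sphere_average[OF ij integrable_log_potential[OF n g nz[of s]]]
      by (simp_all add: f_def log_potential_def)
  qed
  have mono: "f 0 \<le> f s" for s
    unfolding avg(2)
  proof (rule integral_mono_AE[OF avg(1) avg(1)])
    have "AE \<xi> in ?\<sigma>. \<xi> $ i \<noteq> 0" using ln_inner_sphere(1)[OF n, of "axis i 1"] by simp
    then show "AE \<xi> in ?\<sigma>. J 0 \<xi> \<le> J s \<xi>"
    proof eventually_elim
      case (elim \<xi>)
      then have "(\<xi> $ i)\<^sup>2 + (\<xi> $ j)\<^sup>2 > 0" by (simp add: add_pos_nonneg)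
      then show ?case
        using ln_rotation_integrable_mean(2)[of "\<xi> $ i" "\<xi> $ j" "s * \<xi> $ p"] G(2)[of "\<xi> $ p"]
        by (auto simp: J_def intro: mult_right_mono)
    qed
  qed
  have "\<forall>\<^sub>F s in at_right 0. 0 \<le> (f s + f (- s) - 2 * f 0) / s\<^sup>2"
  proof (intro always_eventually allI)
    fix s show "0 \<le> (f s + f (- s) - 2 * f 0) / s\<^sup>2"
      using mono[of s] mono[of "- s"] by (intro divide_nonneg_nonneg) auto
  qed
  then show ?thesis
    using second_difference_tendsto[OF D[folded g_def, folded f_def]]
    by (intro tendsto_lowerbound[of _ D "at_right (0::real)"]) auto
qed

section \<open>Elliptic forms and the choice of the symbol\<close>

text \<open>The first condition of \<open>elliptic_symbol\<close>, freed from even degrees so that a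
  symbol can be assembled by sums, products and powers.\<close>

definition is_form :: "nat \<Rightarrow> (real^'n::finite \<Rightarrow> real) \<Rightarrow> bool" where
  "is_form d q \<longleftrightarrow> (\<exists>A. q = homogeneous_form d A)"

lemma finite_lists_of_length [simp]: "finite {is :: 'n::finite list. length is = d}"
  using finite_lists_length_eq[of "UNIV :: 'n set" d] by simp

lemma is_form_add: "is_form d q \<Longrightarrow> is_form d r \<Longrightarrow> is_form d (\<lambda>\<xi>. q \<xi> + r \<xi>)"
proof -
  assume "is_form d q" "is_form d r"
  then obtain A B where "q = homogeneous_form d A" "r = homogeneous_form d B" by (auto simp: is_form_def)
  then have "(\<lambda>\<xi>. q \<xi> + r \<xi>) = homogeneous_form d (\<lambda>is. A is + B is)"
    by (simp add: homogeneous_form_def fun_eq_iff sum.distrib distrib_right)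
  then show ?thesis by (auto simp: is_form_def)
qed

lemma is_form_scale: "is_form d q \<Longrightarrow> is_form d (\<lambda>\<xi>. c * q \<xi>)"
proof -
  assume "is_form d q"
  then obtain A where "q = homogeneous_form d A" by (auto simp: is_form_def)
  then have "(\<lambda>\<xi>. c * q \<xi>) = homogeneous_form d (\<lambda>is. c * A is)"
    by (simp add: homogeneous_form_def fun_eq_iff sum_distrib_left mult.assoc)
  then show ?thesis by (auto simp: is_form_def)
qed

lemma is_form_sum:
  assumes "finite S" "\<And>k. k \<in> S \<Longrightarrow> is_form d (q k)"
  shows "is_form d (\<lambda>\<xi>. \<Sum>k\<in>S. q k \<xi>)"
  using assms
proof (induction S)
  case empty
  have "(\<lambda>\<xi> :: real^'b. 0) = homogeneous_form d (\<lambda>_. 0)"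
    by (simp add: homogeneous_form_def fun_eq_iff)
  then show ?case by (auto simp: is_form_def)
next
  case (insert k S)
  then show ?case using is_form_add[of d "q k" "\<lambda>\<xi>. \<Sum>k\<in>S. q k \<xi>"] by simp
qed

text \<open>Concatenation identifies pairs of index lists of lengths \<open>d\<close> and
  \<open>e\<close> with lists of length \<open>d + e\<close>. No symmetry of coefficients is
  imposed, so the product of the two coefficients can be read off the two pieces of the
  list.\<close>

lemma is_form_mult:
  fixes q r :: "real^'n::finite \<Rightarrow> real"
  assumes "is_form d q" "is_form e r"
  shows "is_form (d + e) (\<lambda>\<xi>. q \<xi> * r \<xi>)"
proof -
  obtain A B where AB: "q = homogeneous_form d A" "r = homogeneous_form e B"
    using assms by (auto simp: is_form_def)
  have "q \<xi> * r \<xi> = homogeneous_form (d + e) (\<lambda>is. A (take d is) * B (drop d is)) \<xi>" for \<xi>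
  proof -
    let ?m = "\<lambda>is. \<Prod>i\<leftarrow>is. \<xi> $ i"
    have "q \<xi> * r \<xi> = (\<Sum>(is, js)\<in>{is. length is = d} \<times> {js. length js = e}. (A is * ?m is) * (B js * ?m js))"
      unfolding AB homogeneous_form_def sum_product sum.cartesian_product ..
    also have "\<dots> = (\<Sum>is\<in>{is. length is = d + e}. A (take d is) * B (drop d is) * ?m is)"
    proof (rule sum.reindex_bij_witness[where i = "\<lambda>is. (take d is, drop d is)" and j = "\<lambda>(is, js). is @ js"])
      fix p :: "'n list \<times> 'n list" assume "p \<in> {is. length is = d} \<times> {js. length js = e}"
      then show "A (take d (case p of (is, js) \<Rightarrow> is @ js)) * B (drop d (case p of (is, js) \<Rightarrow> is @ js)) *
          ?m (case p of (is, js) \<Rightarrow> is @ js) = (case p of (is, js) \<Rightarrow> (A is * ?m is) * (B js * ?m js))"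
        by auto
    qed auto
    finally show ?thesis by (simp add: homogeneous_form_def)
  qed
  then show ?thesis unfolding is_form_def by blast
qed

lemma is_form_power: "is_form d q \<Longrightarrow> is_form (d * k) (\<lambda>\<xi>. q \<xi> ^ k)"
proof (induction k)
  case 0
  have "(\<lambda>\<xi> :: real^'a. 1) = homogeneous_form 0 (\<lambda>_. 1)"
    by (simp add: homogeneous_form_def fun_eq_iff)
  then show ?case by (auto simp: is_form_def)
next
  case (Suc k)
  then show ?case using is_form_mult[of d q "d * k" "\<lambda>\<xi>. q \<xi> ^ k"] by simp
qed

lemma is_form_coordinate: "is_form 1 (\<lambda>\<xi>. \<xi> $ p)"
proof -
  have "\<xi> $ p = homogeneous_form 1 (\<lambda>is. if is = [p] then 1 else 0) \<xi>" for \<xi>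
  proof -
    have "homogeneous_form 1 (\<lambda>is. if is = [p] then 1 else 0) \<xi> =
        (\<Sum>is\<in>{is. length is = 1}. if is = [p] then \<Prod>i\<leftarrow>is. \<xi> $ i else 0)"
      unfolding homogeneous_form_def by (intro sum.cong) auto
    also have "\<dots> = \<xi> $ p" by (subst sum.delta) (auto simp: finite_lists_of_length)
    finally show ?thesis ..
  qed
  then show ?thesis unfolding is_form_def by blast
qed

lemma is_form_norm_sq: "is_form 2 (\<lambda>\<xi> :: real^'n::finite. (norm \<xi>)\<^sup>2)"
  unfolding norm_sq_sum
  using is_form_power[OF is_form_coordinate, where k = 2] by (intro is_form_sum) auto

section \<open>Mass of spherical caps and concentration of the weight\<close>

lemma sphere_measure_pos:
  assumes "CARD('n::finite) \<ge> 2"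
  shows "measure (sphere_measure :: (real^'n) measure) UNIV > 0"
proof -
  interpret finite_measure "sphere_measure :: (real^'n) measure" by (rule finite_sphere_measure)
  have "emeasure (sphere_measure :: (real^'n) measure) UNIV > 0"
    using hausdorff_outer_sphere_pos[where 'a = "real^'n"] assms by (simp add: emeasure_sphere_measure)
  then show ?thesis by (simp add: emeasure_eq_measure)
qed

text \<open>If one cap were null, all its rotated copies would be null. By compactness finitely many
  of them cover the sphere, contradicting its positive measure.\<close>

lemma sphere_measure_cap_pos:
  fixes p :: "'n::finite"
  assumes n: "CARD('n) \<ge> 2"
  shows "measure (sphere_measure :: (real^'n) measure) {\<xi>. 1 / 2 < (\<xi> $ p)\<^sup>2} > 0"
proof (rule ccontr)
  let ?\<sigma> = "sphere_measure :: (real^'n) measure"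
  interpret finite_measure ?\<sigma> by (rule finite_sphere_measure)
  define cap where "cap = (\<lambda>v. {\<xi> :: real^'n. 1 / 2 < (v \<bullet> \<xi>)\<^sup>2})"
  have open_cap: "open (cap v)" for v
    unfolding cap_def by (intro open_Collect_less continuous_intros)
  then have [measurable]: "cap v \<in> sets borel" for v by (rule borel_open)
  assume "\<not> ?thesis"
  then have "measure ?\<sigma> {\<xi>. 1 / 2 < (\<xi> $ p)\<^sup>2} = 0" by (simp add: zero_less_measure_iff)
  then have null: "emeasure ?\<sigma> {\<xi>. 1 / 2 < (\<xi> $ p)\<^sup>2} = 0" by (simp add: emeasure_eq_measure)
  have cap0: "emeasure ?\<sigma> (cap v) = 0" if v: "norm v = 1" for v
  proof -
    have "v \<noteq> 0" using v by auto
    then obtain T :: "real^'n \<Rightarrow> real^'n" where T: "orthogonal_transformation T" "\<And>\<xi>. v \<bullet> T \<xi> = norm v * \<xi> $ p"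
      using orthogonal_transformation_axis[of v p] by blast
    have "emeasure ?\<sigma> (cap v) = (\<integral>\<^sup>+\<xi>. indicator (cap v) \<xi> \<partial>?\<sigma>)" by simp
    also have "\<dots> = (\<integral>\<^sup>+\<xi>. indicator (cap v) (T \<xi>) \<partial>?\<sigma>)"
      by (rule nn_integral_sphere_orthogonal[OF T(1), symmetric]) measurable
    also have "\<dots> = (\<integral>\<^sup>+\<xi>. indicator {\<xi>. 1 / 2 < (\<xi> $ p)\<^sup>2} \<xi> \<partial>?\<sigma>)"
      by (intro nn_integral_cong) (simp add: cap_def T(2) v indicator_def)
    also have "\<dots> = emeasure ?\<sigma> {\<xi>. 1 / 2 < (\<xi> $ p)\<^sup>2}" by (intro nn_integral_indicator) simp
    finally show ?thesis using null by simp
  qed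
  have cover: "sphere 0 1 \<subseteq> (\<Union>v\<in>sphere 0 1. cap v)"
  proof
    fix v :: "real^'n" assume "v \<in> sphere 0 1"
    moreover then have "v \<in> cap v" by (simp add: cap_def dot_square_norm)
    ultimately show "v \<in> (\<Union>v\<in>sphere 0 1. cap v)" by blast
  qed
  have "compact (sphere 0 1 :: (real^'n) set)" by simp
  from compactE_image[OF this open_cap cover] obtain C where
    C: "C \<subseteq> sphere 0 1" "finite C" "sphere 0 1 \<subseteq> (\<Union>v\<in>C. cap v)" by blast
  have "emeasure ?\<sigma> (sphere 0 1) \<le> emeasure ?\<sigma> (\<Union>v\<in>C. cap v)"
    using C by (intro emeasure_mono sets.finite_UN) auto
  also have "\<dots> \<le> (\<Sum>v\<in>C. emeasure ?\<sigma> (cap v))"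
    using C by (intro emeasure_subadditive_finite) auto
  also have "\<dots> = 0" using C cap0 by (intro sum.neutral) auto
  finally have "emeasure ?\<sigma> (sphere 0 1) = 0" by simp
  moreover have "emeasure ?\<sigma> (sphere 0 1) = emeasure ?\<sigma> UNIV"
    by (simp add: emeasure_sphere_measure)
  ultimately show False using sphere_measure_pos[OF n] by (simp add: measure_def)
qed

text \<open>Pigeonhole: among \<open>K\<close> equal intervals covering \<open>[1/2, 1]\<close> one carries at least the \<open>K\<close>-th part
  of the mass of the cap, while with \<open>\<epsilon> = 1 / (2 K)\<close> the integrand is of order \<open>K\<^sup>2\<close> there.\<close>

lemma exists_concentrated_weight:
  fixes p :: "'n::finite" and R :: real
  assumes n: "CARD('n) \<ge> 2"
  obtains a \<epsilon> :: real where "1 / 2 \<le> a" "\<epsilon> > 0"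
    "R < (\<integral>\<xi>. (2 * a - (\<xi> $ p)\<^sup>2) / (((\<xi> $ p)\<^sup>2 - a)\<^sup>2 + \<epsilon>\<^sup>2) \<partial>(sphere_measure :: (real^'n) measure))"
proof -
  let ?\<sigma> = "sphere_measure :: (real^'n) measure"
  interpret finite_measure ?\<sigma> by (rule finite_sphere_measure)
  define \<nu> where "\<nu> = measure ?\<sigma> {\<xi>. 1 / 2 < (\<xi> $ p)\<^sup>2}"
  have \<nu>: "\<nu> > 0" unfolding \<nu>_def by (rule sphere_measure_cap_pos[OF n])
  obtain K0 :: nat where K0: "2 * \<bar>R\<bar> / \<nu> < real K0" using reals_Archimedean2 by blast
  \<comment> \<open>Adding \<open>2\<close> ensures \<open>\<epsilon> \<le> 1 / 4\<close> for the
    later choice \<open>\<epsilon> = 1 / (2 * K)\<close>.\<close>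
  define K where "K = K0 + 2"
  have K: "2 \<le> real K" "R < real K * \<nu> / 2"
  proof -
    show "2 \<le> real K" by (simp add: K_def)
    have "2 * \<bar>R\<bar> / \<nu> < real K" using K0 by (simp add: K_def)
    then show "R < real K * \<nu> / 2" using \<nu> by (simp add: field_simps)
  qed
  define c where "c = (\<lambda>k::nat. 1 / 2 + real k / (2 * real K))"
  define A where "A = (\<lambda>k. {\<xi> :: real^'n. (\<xi> $ p)\<^sup>2 \<in> {c k..c (Suc k)}})"
  have [measurable]: "A k \<in> sets borel" for k unfolding A_def by measurable
  have "\<exists>k<K. \<nu> / real K \<le> measure ?\<sigma> (A k)"
  proof (rule ccontr)
    assume neg: "\<not> ?thesis"
    have "0 < K" by (simp add: K_def)
    have "\<nu> = measure ?\<sigma> ({\<xi>. 1 / 2 < (\<xi> $ p)\<^sup>2} \<inter> sphere 0 1)"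
      unfolding \<nu>_def using AE_sphere_measure[where 'a = "real^'n"]
      by (intro measure_eq_AE) (auto elim!: eventually_mono)
    also have "\<dots> \<le> measure ?\<sigma> (\<Union>k<K. A k)"
    proof (rule finite_measure_mono)
      show "{\<xi>. 1 / 2 < (\<xi> $ p)\<^sup>2} \<inter> sphere 0 1 \<subseteq> (\<Union>k<K. A k)"
      proof
        fix \<xi> assume "\<xi> \<in> {\<xi> :: real^'n. 1 / 2 < (\<xi> $ p)\<^sup>2} \<inter> sphere 0 1"
        then have \<xi>: "1 / 2 < (\<xi> $ p)\<^sup>2" "(\<xi> $ p)\<^sup>2 \<le> 1"
          using component_le_norm_cart[of \<xi> p] by (auto simp: abs_square_le_1)
        define x where "x = (2 * (\<xi> $ p)\<^sup>2 - 1) * real K"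
        have x: "0 < x" "x \<le> 1 * real K" unfolding x_def using \<xi> K by (auto intro!: mult_right_mono mult_pos_pos)
        \<comment> \<open>Rounding up and subtracting one keeps \<open>k < K\<close> also for
          \<open>x = K\<close>, that is, at the poles, where rounding down would leave the range.
          Positivity of \<open>x\<close> makes the subtraction exact.\<close>
        define k where "k = nat \<lceil>x\<rceil> - 1"
        have "0 < \<lceil>x\<rceil>" using x by simp
        then have "real (Suc k) = of_int \<lceil>x\<rceil>" by (simp add: k_def)
        then have k: "real k \<le> x" "x \<le> real (Suc k)"
          using ceiling_correct[of x] by auto
        have "\<lceil>x\<rceil> \<le> int K" using x by (simp add: ceiling_le_iff)
        then have "k < K" using \<open>0 < \<lceil>x\<rceil>\<close> by (simp add: k_def) linarith
        moreover have "\<xi> \<in> A k"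
          using k K by (simp add: A_def c_def x_def field_simps)
        ultimately show "\<xi> \<in> (\<Union>k<K. A k)" by blast
      qed
    qed auto
    also have "\<dots> \<le> (\<Sum>k<K. measure ?\<sigma> (A k))"
      by (intro finite_measure_subadditive_finite) auto
    also have "\<dots> < (\<Sum>k<K. \<nu> / real K)"
      using neg \<open>0 < K\<close> by (intro sum_strict_mono) (auto simp: not_le)
    also have "\<dots> = \<nu>" using K by simp
    finally show False by simp
  qed
  then obtain k where k: "\<nu> / real K \<le> measure ?\<sigma> (A k)" by blast
  define a where "a = c k"
  define \<epsilon> where "\<epsilon> = 1 / (2 * real K)"
  have a: "1 / 2 \<le> a" by (simp add: a_def c_def)
  have \<epsilon>: "\<epsilon> > 0" "\<epsilon> \<le> 1 / 4" using K by (simp_all add: \<epsilon>_def field_simps)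
  have c_Suc: "c (Suc k) = a + \<epsilon>" using K by (simp add: a_def c_def \<epsilon>_def field_simps)
  define u where "u = (\<lambda>\<xi> :: real^'n. (2 * a - (\<xi> $ p)\<^sup>2) / (((\<xi> $ p)\<^sup>2 - a)\<^sup>2 + \<epsilon>\<^sup>2))"
  have den: "((\<xi> $ p)\<^sup>2 - a)\<^sup>2 + \<epsilon>\<^sup>2 > 0" for \<xi> :: "real^'n" using \<epsilon> by (simp add: add_nonneg_pos)
  have cont: "continuous_on UNIV (\<lambda>y. (2 * a - y\<^sup>2) / ((y\<^sup>2 - a)\<^sup>2 + \<epsilon>\<^sup>2))"
    using \<epsilon> by (intro continuous_intros ballI) (metis add_nonneg_pos less_irrefl zero_le_power2 zero_less_power)
  have "integrable ?\<sigma> u"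
    unfolding u_def by (rule integrable_bounded_on_sphere[OF bounded_on_sphere_coordinate[OF cont]])
  moreover have "AE \<xi> in ?\<sigma>. (real K)\<^sup>2 / 2 * indicator (A k) \<xi> \<le> u \<xi>"
    using AE_sphere_measure
  proof eventually_elim
    case (elim \<xi>)
    have "(\<xi> $ p)\<^sup>2 \<le> 1" using component_le_norm_cart[of \<xi> p] elim by (simp add: abs_square_le_1)
    then have nonneg: "0 \<le> u \<xi>" using a den[of \<xi>] by (simp add: u_def)
    show ?case
    proof (cases "\<xi> \<in> A k")
      case True
      then have b: "0 \<le> (\<xi> $ p)\<^sup>2 - a" "(\<xi> $ p)\<^sup>2 - a \<le> \<epsilon>" by (auto simp: A_def c_Suc a_def[symmetric])
      then have "((\<xi> $ p)\<^sup>2 - a)\<^sup>2 \<le> \<epsilon>\<^sup>2" by (intro power_mono)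
      \<comment> \<open>On this interval the numerator is \<open>a - (\<xi>_p^2 - a)\<close>, at
        least \<open>1 / 2 - 1 / 4\<close>, and the denominator is at most
        \<open>2 * \<epsilon>^2\<close>.\<close>
      then have "(1 / 4) / (2 * \<epsilon>\<^sup>2) \<le> u \<xi>"
        unfolding u_def using den[of \<xi>] a b \<epsilon> by (intro frac_le) auto
      moreover have "(1 / 4) / (2 * \<epsilon>\<^sup>2) = (real K)\<^sup>2 / 2"
        using K by (simp add: \<epsilon>_def power_divide power_mult_distrib)
      ultimately show ?thesis using True by simp
    qed (use nonneg in simp)
  qed
  moreover have "integrable ?\<sigma> (\<lambda>\<xi>. (real K)\<^sup>2 / 2 * indicator (A k) \<xi>)"
    by (intro integrable_mult_right integrable_real_indicator) (auto simp: less_top[symmetric] emeasure_finite)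
  ultimately have "(\<integral>\<xi>. (real K)\<^sup>2 / 2 * indicator (A k) \<xi> \<partial>?\<sigma>) \<le> (\<integral>\<xi>. u \<xi> \<partial>?\<sigma>)"
    by (intro integral_mono_AE)
  then have "(real K)\<^sup>2 / 2 * measure ?\<sigma> (A k) \<le> (\<integral>\<xi>. u \<xi> \<partial>?\<sigma>)" by simp
  moreover have "(real K)\<^sup>2 / 2 * (\<nu> / real K) \<le> (real K)\<^sup>2 / 2 * measure ?\<sigma> (A k)"
    using k by (intro mult_left_mono) auto
  moreover have "(real K)\<^sup>2 / 2 * (\<nu> / real K) = real K * \<nu> / 2"
    using K by (simp add: power2_eq_square)
  ultimately have "R < (\<integral>\<xi>. u \<xi> \<partial>?\<sigma>)" using K by linarith
  then show ?thesis using that[OF a \<epsilon>(1)] by (simp add: u_def)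
qed

section \<open>From the potential to the kernel and the symbol\<close>

lemma sum_coordinates_sq_eq_1:
  fixes \<xi> :: "real^'n::finite"
  assumes "norm \<xi> = 1"
  shows "(\<Sum>j\<in>UNIV. (\<xi> $ j)\<^sup>2) = 1"
  using assms norm_sq_sum[of \<xi>] by simp

text \<open>In these dimensions the operator \<open>- laplacian\<close> is applied exactly once. Its
  sign cancels the sign in front of the integral, and \<open>x = 0\<close> gives
  \<open>ln \<bar>- y \<bullet> \<xi>\<bar>\<close>, which is even in \<open>y\<close>.\<close>

lemma john_kernel_origin:
  fixes Q g :: "real^'n::finite \<Rightarrow> real"
  assumes n: "CARD('n) = 2 * m + 2" and Q: "Q \<in> borel_measurable borel" "g \<in> borel_measurable borel"
    and Qg: "\<And>\<xi>. norm \<xi> = 1 \<Longrightarrow> 1 / Q \<xi> = g \<xi>"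
  shows "john_kernel m Q 0 y = 1 / (2 * pi) ^ CARD('n) * laplacian (log_potential g) y"
proof -
  have "(LINT \<xi>:sphere 0 1|hausdorff_measure (CARD('n) - 1). ln \<bar>(0 - y') \<bullet> \<xi>\<bar> / Q \<xi>) = log_potential g y'"
    for y' :: "real^'n"
  proof -
    note [measurable] = Q
    have "(LINT \<xi>:sphere 0 1|hausdorff_measure (CARD('n) - 1). ln \<bar>(0 - y') \<bullet> \<xi>\<bar> / Q \<xi>) =
        (\<integral>\<xi>. ln \<bar>(0 - y') \<bullet> \<xi>\<bar> / Q \<xi> \<partial>sphere_measure)"
      by (subst integral_sphere_measure) auto
    also have "\<dots> = log_potential g y'"
      unfolding log_potential_def
    proof (rule integral_cong_AE)
      show "AE \<xi> in sphere_measure. ln \<bar>(0 - y') \<bullet> \<xi>\<bar> / Q \<xi> = ln \<bar>y' \<bullet> \<xi>\<bar> * g \<xi>"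
        using AE_sphere_measure by eventually_elim (simp flip: Qg)
    qed measurable
    finally show ?thesis .
  qed
  moreover have "(CARD('n) - 2 * m) div 2 = 1" using n by simp
  ultimately show ?thesis unfolding john_kernel_def by simp
qed

lemma sign_changing_near_diagonal_axes:
  fixes Q :: "real^'n::finite \<Rightarrow> real"
  assumes "\<And>t. t > 0 \<Longrightarrow> john_kernel m Q 0 (t *\<^sub>R axis p 1) < 0"
    and "\<And>t. t > 0 \<Longrightarrow> john_kernel m Q 0 (t *\<^sub>R axis i 1) > 0"
  shows "sign_changing_near_diagonal (john_kernel m Q)"
  unfolding sign_changing_near_diagonal_def
proof (intro allI impI conjI)
  fix r :: real assume r: "0 < r"
  have d: "0 < dist 0 ((r / 2) *\<^sub>R axis k 1 :: real^'n)" "dist 0 ((r / 2) *\<^sub>R axis k 1 :: real^'n) < r" for k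
    using r by simp_all
  show "\<exists>x y. 0 < dist x y \<and> dist x y < r \<and> john_kernel m Q x y > 0"
    using assms(2)[of "r / 2"] d[of i] r by (intro exI[of _ 0] exI[of _ "(r / 2) *\<^sub>R axis i 1"] conjI) auto
  show "\<exists>x y. 0 < dist x y \<and> dist x y < r \<and> john_kernel m Q x y < 0"
    using assms(1)[of "r / 2"] d[of p] r by (intro exI[of _ 0] exI[of _ "(r / 2) *\<^sub>R axis p 1"] conjI) auto
qed

theorem theorem1p5:
  fixes m :: nat
  assumes "m \<ge> 2" and "CARD('n::finite) = 2 * m + 2"
  shows "\<exists>Q :: real^'n \<Rightarrow> real. elliptic_symbol m Q \<and> sign_changing_near_diagonal (john_kernel m Q)"
proof -
  let ?\<sigma> = "sphere_measure :: (real^'n) measure"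
  define N where "N = real CARD('n)"
  define M where "M = measure ?\<sigma> UNIV"
  have n: "CARD('n) \<ge> 2" and N: "N \<ge> 6" using assms by (simp_all add: N_def)
  have M: "M > 0" unfolding M_def by (rule sphere_measure_pos[OF n])
  \<comment> \<open>Besides the distinguished axis \<open>p\<close> two more indices are needed:
    \<open>i\<close>, where the kernel will be positive, and \<open>j\<close>, which spans with
    \<open>i\<close> the plane of averaging.\<close>
  have "card (UNIV :: 'n set) \<ge> 3" using assms by simp
  then obtain S :: "'n set" where "card S = 3" by (meson obtain_subset_with_card_n)
  then obtain p i j :: 'n where ij: "i \<noteq> j" and p: "p \<noteq> i" "p \<noteq> j" by (auto simp: card_3_iff)
  obtain a \<epsilon> :: real where a: "1 / 2 \<le> a" and \<epsilon>: "\<epsilon> > 0"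
    and large: "(N - 2) * M < (\<integral>\<xi>. (2 * a - (\<xi> $ p)\<^sup>2) / (((\<xi> $ p)\<^sup>2 - a)\<^sup>2 + \<epsilon>\<^sup>2) \<partial>?\<sigma>)"
    using exists_concentrated_weight[OF n] by blast
  define P where "P = (\<lambda>y::real. (y\<^sup>2 - a)\<^sup>2 + \<epsilon>\<^sup>2)"
  define P' where "P' = (\<lambda>y. 4 * y * (y\<^sup>2 - a))"
  define P'' where "P'' = (\<lambda>y. 12 * y\<^sup>2 - 4 * a)"
  have P: "P y > 0" "P y \<noteq> 0" "\<epsilon>\<^sup>2 \<le> P y" for y
    using \<epsilon> zero_le_power2[of "y\<^sup>2 - a"] unfolding P_def by (auto simp: add_nonneg_pos less_imp_neq[symmetric])
  have P_deriv: "(P has_real_derivative P' y) (at y)" "(P' has_real_derivative P'' y) (at y)" for y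
    unfolding P_def P'_def P''_def
    by (auto intro!: derivative_eq_intros simp: power2_eq_square algebra_simps)
  define G where "G = (\<lambda>y. inverse (P y))"
  define G' where "G' = (\<lambda>y. - (P' y * inverse ((P y)\<^sup>2)))"
  define G'' where "G'' = (\<lambda>y. 2 * (P' y)\<^sup>2 * inverse ((P y) ^ 3) - P'' y * inverse ((P y)\<^sup>2))"
  have G: "(G has_real_derivative G' y) (at y)" "(G' has_real_derivative G'' y) (at y)" for y
    unfolding G_def G'_def G''_def using P(2)[of y]
    by (auto intro!: derivative_eq_intros P_deriv simp: power2_eq_square power3_eq_cube field_simps)
  have cP: "continuous_on UNIV P" "continuous_on UNIV P'" "continuous_on UNIV P''"
    unfolding P_def P'_def P''_def by (intro continuous_intros)+
  have cG: "continuous_on UNIV G" "continuous_on UNIV G''"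
    unfolding G_def G''_def using P(2) by (auto intro!: continuous_intros cP)
  define g where "g = (\<lambda>\<xi> :: real^'n. G (\<xi> $ p))"
  have g: "bounded_on_sphere g" unfolding g_def using cG(1) by (rule bounded_on_sphere_coordinate)
  define C where "C = (\<integral>\<xi>. g \<xi> \<partial>?\<sigma>)"
  \<comment> \<open>From \<open>P 0 - P y = y^2 * (2 * a - y^2)\<close>, dividing by
    \<open>P 0 * P y\<close> gives \<open>G y - G 0\<close> as \<open>y^2\<close> times this
    quotient. The factor \<open>G 0\<close> depends on \<open>a\<close> and \<epsilon> but occurs on
    both sides of the final comparison. Hence the threshold \<open>(N - 2) * M\<close> in
    \<open>large\<close> could be fixed before choosing them.\<close>
  define \<kappa> where "\<kappa> = (\<lambda>\<xi> :: real^'n. (2 * a - (\<xi> $ p)\<^sup>2) / P (\<xi> $ p) * G 0)"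
  have G0: "G 0 > 0" using P(1) by (simp add: G_def)
  have \<kappa>b: "bounded_on_sphere \<kappa>"
    unfolding \<kappa>_def using P(2)
    by (intro bounded_on_sphere_coordinate[of "\<lambda>y. (2 * a - y\<^sup>2) / P y * G 0"]) (auto intro!: continuous_intros cP)
  then have \<kappa>m [measurable]: "\<kappa> \<in> borel_measurable borel" by (rule bounded_on_sphere_measurable)
  have \<kappa>: "0 \<le> \<kappa> \<xi> \<and> \<kappa> \<xi> \<le> 2 * a / \<epsilon>\<^sup>2 * G 0" if "norm \<xi> = 1" for \<xi>
  proof -
    have "(\<xi> $ p)\<^sup>2 \<le> 1" using component_le_norm_cart[of \<xi> p] that by (simp add: abs_square_le_1)
    then have "0 \<le> 2 * a - (\<xi> $ p)\<^sup>2" "2 * a - (\<xi> $ p)\<^sup>2 \<le> 2 * a" using a by auto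
    then have "(2 * a - (\<xi> $ p)\<^sup>2) / P (\<xi> $ p) \<le> 2 * a / \<epsilon>\<^sup>2" "0 \<le> (2 * a - (\<xi> $ p)\<^sup>2) / P (\<xi> $ p)"
      using P[of "\<xi> $ p"] \<epsilon> a by (auto intro!: frac_le)
    then show ?thesis
      unfolding \<kappa>_def using G0 by (intro conjI mult_right_mono mult_nonneg_nonneg) simp_all
  qed
  have g\<kappa>: "g \<xi> = G 0 + (\<xi> $ p)\<^sup>2 * \<kappa> \<xi>" for \<xi>
  proof -
    have "P 0 = P (\<xi> $ p) + (\<xi> $ p)\<^sup>2 * (2 * a - (\<xi> $ p)\<^sup>2)"
      unfolding P_def by (simp add: power2_eq_square algebra_simps)
    then have "inverse (P (\<xi> $ p)) = inverse (P 0) + (\<xi> $ p)\<^sup>2 * ((2 * a - (\<xi> $ p)\<^sup>2) / P (\<xi> $ p) * inverse (P 0))"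
      using P(2)[of "\<xi> $ p"] P(2)[of 0] by (simp add: field_simps)
    then show ?thesis by (simp add: g_def \<kappa>_def G_def)
  qed
  have int\<kappa>: "integrable ?\<sigma> (\<lambda>\<xi>. (\<xi> $ l)\<^sup>2 * \<kappa> \<xi>)" for l
  proof (rule integrable_mult_bounded_on_sphere[OF \<kappa>b])
    show "integrable ?\<sigma> (\<lambda>\<xi>. (\<xi> $ l)\<^sup>2)"
      by (intro integrable_bounded_on_sphere bounded_on_sphere_coordinate continuous_intros)
  qed
  interpret finite_measure ?\<sigma> by (rule finite_sphere_measure)
  have C: "C = G 0 * M + (\<integral>\<xi>. (\<xi> $ p)\<^sup>2 * \<kappa> \<xi> \<partial>?\<sigma>)"
    unfolding C_def g\<kappa> using int\<kappa>[of p] by (simp add: M_def)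
  have "0 \<le> (\<integral>\<xi>. (\<xi> $ p)\<^sup>2 * \<kappa> \<xi> \<partial>?\<sigma>)"
    using AE_sphere_measure by (intro integral_nonneg_AE) (auto elim!: eventually_mono simp: \<kappa>)
  then have C_pos: "C > 0" unfolding C using G0 M by (simp add: add_pos_nonneg)

  have radial: "has_second_derivative (\<lambda>s. log_potential g (axis k 1 + s *\<^sub>R axis k 1)) (- C)" for k
    unfolding C_def by (rule has_second_derivative_log_potential_radial[OF n g])
  have "\<exists>d. has_second_derivative (\<lambda>s. log_potential g (axis k 1 + s *\<^sub>R axis l 1)) d" for k l
    using radial[of k] has_second_derivative_log_potential_ex[OF n _ G cG(2), of k l p] unfolding g_def by metis
  then obtain d where d: "\<And>k l. has_second_derivative (\<lambda>s. log_potential g (axis k 1 + s *\<^sub>R axis l 1)) (d k l)"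
    by metis
  \<comment> \<open>Any two second derivatives along the same line agree, both being the value of
    the iterated \<open>deriv\<close>; this identifies the chosen numbers \<open>d k l\<close> with
    explicit ones.\<close>
  have d_unique: "d k l = D" if "has_second_derivative (\<lambda>s. log_potential g (axis k 1 + s *\<^sub>R axis l 1)) D" for k l D
    using partial_deriv_second[OF d[of k l]] partial_deriv_second[OF that] by simp

  \<comment> \<open>The radial term \<open>- C\<close> supplies \<open>- G 0 * M\<close> and the
    missing integral with \<open>(\<xi> $ p)^2\<close>. As the squared coordinates sum to
    \<open>1\<close>, the total is at most \<open>(N - 2) * G 0 * M\<close> minus the integral of
    \<kappa>.\<close>
  have neg: "(\<Sum>l\<in>UNIV. d p l) < 0"
  proof -
    have "(\<Sum>l\<in>UNIV - {p}. d p l) \<le> (\<Sum>l\<in>UNIV - {p}. G 0 * M - (\<integral>\<xi>. (\<xi> $ l)\<^sup>2 * \<kappa> \<xi> \<partial>?\<sigma>))"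
    proof (rule sum_mono)
      fix l assume "l \<in> UNIV - {p}"
      then have "p \<noteq> l" by simp
      show "d p l \<le> G 0 * M - (\<integral>\<xi>. (\<xi> $ l)\<^sup>2 * \<kappa> \<xi> \<partial>?\<sigma>)"
        unfolding M_def
        by (rule second_derivative_axis_upper[OF n \<open>p \<noteq> l\<close> g \<kappa>m \<kappa> g\<kappa> less_imp_le[OF G0] d])
    qed
    moreover have "(\<Sum>l\<in>UNIV. d p l) = - C + (\<Sum>l\<in>UNIV - {p}. d p l)"
      using d_unique[OF radial] by (subst sum.remove[of UNIV p]) auto
    moreover have "real (card (UNIV - {p})) = N - 1"
      using assms by (simp add: N_def card_Diff_singleton of_nat_diff)
    then have "(\<Sum>l\<in>UNIV - {p}. G 0 * M - (\<integral>\<xi>. (\<xi> $ l)\<^sup>2 * \<kappa> \<xi> \<partial>?\<sigma>)) =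
        (N - 1) * (G 0 * M) - (\<Sum>l\<in>UNIV - {p}. \<integral>\<xi>. (\<xi> $ l)\<^sup>2 * \<kappa> \<xi> \<partial>?\<sigma>)"
      by (simp add: sum_subtractf)
    moreover have "(\<integral>\<xi>. (\<xi> $ p)\<^sup>2 * \<kappa> \<xi> \<partial>?\<sigma>) + (\<Sum>l\<in>UNIV - {p}. \<integral>\<xi>. (\<xi> $ l)\<^sup>2 * \<kappa> \<xi> \<partial>?\<sigma>) = (\<integral>\<xi>. \<kappa> \<xi> \<partial>?\<sigma>)"
    proof -
      have "(\<integral>\<xi>. (\<xi> $ p)\<^sup>2 * \<kappa> \<xi> \<partial>?\<sigma>) + (\<Sum>l\<in>UNIV - {p}. \<integral>\<xi>. (\<xi> $ l)\<^sup>2 * \<kappa> \<xi> \<partial>?\<sigma>) =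
          (\<Sum>l\<in>UNIV. \<integral>\<xi>. (\<xi> $ l)\<^sup>2 * \<kappa> \<xi> \<partial>?\<sigma>)"
        by (subst sum.remove[of UNIV p]) auto
      also have "\<dots> = (\<integral>\<xi>. (\<Sum>l\<in>UNIV. (\<xi> $ l)\<^sup>2 * \<kappa> \<xi>) \<partial>?\<sigma>)"
        using int\<kappa> by (subst Bochner_Integration.integral_sum) auto
      also have "\<dots> = (\<integral>\<xi>. \<kappa> \<xi> \<partial>?\<sigma>)"
      proof (rule integral_cong_AE)
        show "AE \<xi> in ?\<sigma>. (\<Sum>l\<in>UNIV. (\<xi> $ l)\<^sup>2 * \<kappa> \<xi>) = \<kappa> \<xi>"
          using AE_sphere_measure
          by eventually_elim (simp add: sum_coordinates_sq_eq_1 flip: sum_distrib_right)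
      qed measurable
      finally show ?thesis .
    qed
    moreover have "(N - 2) * M * G 0 < (\<integral>\<xi>. \<kappa> \<xi> \<partial>?\<sigma>)"
      unfolding \<kappa>_def P_def integral_mult_left_zero using large G0 by (rule mult_strict_right_mono)
    ultimately show ?thesis unfolding C by (simp add: algebra_simps)
  qed
  \<comment> \<open>The radial direction gives \<open>- C\<close>, each of the \<open>N - 2\<close>
    directions other than \<open>i\<close> and \<open>p\<close> gives \<open>C\<close>, and
    direction \<open>p\<close> gives something nonnegative; since \<open>N \<ge> 6\<close>, the sum
    is positive.\<close>
  have pos: "(\<Sum>l\<in>UNIV. d i l) > 0"
  proof -
    have "d i l = C" if "l \<in> UNIV - {i, p}" for l
      using has_second_derivative_log_potential_unrelated[OF n _ _ _ cG(1), of i l p] that p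
      unfolding C_def g_def[symmetric] by (intro d_unique) auto
    moreover have "real (card (UNIV - {i, p})) = N - 2"
      using assms p by (simp add: N_def card_Diff_subset of_nat_diff)
    ultimately have "(\<Sum>l\<in>UNIV - {i, p}. d i l) = (N - 2) * C" by simp
    moreover have "(\<Sum>l\<in>UNIV. d i l) = d i i + (d i p + (\<Sum>l\<in>UNIV - {i, p}. d i l))"
      using p by (intro sum_split_two) auto
    moreover have "d i i = - C" by (rule d_unique[OF radial])
    moreover have "0 \<le> d i p"
      using second_derivative_transversal_nonneg[OF n ij p cG(1), of "d i p"] d[of i p] P(1)
      by (auto simp: g_def G_def less_imp_le)
    moreover have "3 * C \<le> (N - 2) * C" using N C_pos by (intro mult_right_mono) auto
    ultimately show ?thesis using C_pos by linarith
  qed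

  \<comment> \<open>The quartic \<open>P\<close> in coordinate \<open>p\<close>, made homogeneous by
    powers of the norm and raised from degree \<open>4\<close> to degree \<open>2 * m\<close>; here
    \<open>m \<ge> 2\<close> makes the exponent \<open>m - 2\<close> exact. Dropping the first
    square shows ellipticity with the constant \<open>\<epsilon>^2\<close>.\<close>
  define Q where "Q = (\<lambda>\<xi> :: real^'n. (((\<xi> $ p) ^ 2 + - a * (norm \<xi>)\<^sup>2) ^ 2 + \<epsilon>\<^sup>2 * ((norm \<xi>)\<^sup>2) ^ 2) *
    ((norm \<xi>)\<^sup>2) ^ (m - 2))"
  have "is_form (2 * 2 + 2 * (m - 2)) Q"
    unfolding Q_def
    using is_form_power[OF is_form_coordinate, of 2 p]
    by (intro is_form_mult is_form_add is_form_scale is_form_power is_form_norm_sq) simp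
  moreover have "2 * 2 + 2 * (m - 2) = 2 * m" using assms by simp
  ultimately have "is_form (2 * m) Q" by simp
  moreover have "\<epsilon>\<^sup>2 * norm \<xi> ^ (2 * m) \<le> Q \<xi>" for \<xi>
  proof -
    have "2 * m = 2 * (2 + (m - 2))" using assms by simp
    then have "norm \<xi> ^ (2 * m) = ((norm \<xi>)\<^sup>2) ^ (2 + (m - 2))" by (metis power_mult)
    then have "\<epsilon>\<^sup>2 * norm \<xi> ^ (2 * m) = (\<epsilon>\<^sup>2 * ((norm \<xi>)\<^sup>2) ^ 2) * ((norm \<xi>)\<^sup>2) ^ (m - 2)"
      by (simp only: power_add mult.assoc)
    also have "\<dots> \<le> Q \<xi>" unfolding Q_def by (intro mult_right_mono) auto
    finally show ?thesis .
  qed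
  ultimately have elliptic: "elliptic_symbol m Q"
    using \<epsilon> unfolding elliptic_symbol_def is_form_def by (intro conjI exI[of _ "\<epsilon>\<^sup>2"]) auto
  have Qm: "Q \<in> borel_measurable borel" unfolding Q_def by measurable
  have Qg: "1 / Q \<xi> = g \<xi>" if "norm \<xi> = 1" for \<xi>
    using that by (simp add: Q_def g_def G_def P_def inverse_eq_divide)
  have kernel: "john_kernel m Q 0 (t *\<^sub>R axis k 1) = 1 / (2 * pi) ^ CARD('n) * ((\<Sum>l\<in>UNIV. d k l) / t\<^sup>2)"
    if "t > 0" for t k
    using john_kernel_origin[OF assms(2) Qm bounded_on_sphere_measurable[OF g] Qg]
      laplacian_log_potential[OF n g that d] by simp
  have "sign_changing_near_diagonal (john_kernel m Q)"
  proof (rule sign_changing_near_diagonal_axes)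
    show "john_kernel m Q 0 (t *\<^sub>R axis p 1) < 0" if "t > 0" for t
      unfolding kernel[OF that] using neg that by (intro mult_pos_neg divide_neg_pos) auto
    show "john_kernel m Q 0 (t *\<^sub>R axis i 1) > 0" if "t > 0" for t
      unfolding kernel[OF that] using pos that by (intro mult_pos_pos divide_pos_pos) auto
  qed
  with elliptic show ?thesis by blast
qed

end
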